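(* Let $q:\mathbb{Z}^n\to\mathbb{Z}$ be a connected non-negative unit form. Then there is an isomorphism of graded Lie algebras between $\tilde{G}(q)/I$ and $E(q)$, where $I$ is the unique maximal ideal of $\tilde{G}(q)$ with $I\cap\tilde{H}=\{0\}$.
   Context: **Unit forms.** A unit form is a quadratic form $q:\mathbb{Z}^n\to\mathbb{Z}$, $q(x)=\sum_{i=1}^n x_i^2+\sum_{i<j}q_{ij}x_ix_j$ with $q_{ij}\in\mathbb{Z}$. It is non-negative if $q(x)\ge 0$ for all $x$. It is connected if the graph on vertices $1,\dots,n$ with $i,j$ joined whenever $q_{ij}\ne 0$ is connected. The associated symmetric bilinear form is $q(x,y)=q(x+y)-q(x)-q(y)$, extended bilinearly to $\mathbb{C}^n$; its matrix is $C=(C_{ij})$, $C_{ij}=q(c_i,c_j)$, where $c_1,\dots,c_n$ is the standard basis of $\mathbb{Z}^n$. The radical is $\operatorname{rad} q=\{x\in\mathbb{Z}^n: q(x,-)=0\}$; for non-negative $q$, $\operatorname{rad} q=q^{-1}(0)$. Put $\operatorname{rad}_{\mathbb{C}}q=\mathbb{C}\otimes_{\mathbb{Z}}\operatorname{rad}q\subseteq\mathbb{C}^n$, with $\mathbb{C}$-dual $(\operatorname{rad}_{\mathbb{C}}q)^*$. Write $R=R(q)=q^{-1}(0)\cup q^{-1}(1)$, $R^\times=q^{-1}(1)$, $R^0=q^{-1}(0)$. Fix a linear projection $\rho:\mathbb{C}^n\to\operatorname{rad}_{\mathbb{C}}q$ (identity on $\operatorname{rad}_{\mathbb{C}}q$).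 **The Lie algebra $\tilde G(q)$.** Let $F$ be the free complex Lie algebra on $3n$ generators $f_{-i},h_i,f_i$ ($1\le i\le n$), homogeneous of degrees $-c_i,0,c_i$. Let $I(q)$ be the ideal generated by the relations: - $[h_i,h_j]=0$ for all $i,j$; - $[h_i,f_{\varepsilon j}]=\varepsilon C_{ij}f_{\varepsilon j}$ for all $i,j$ and $\varepsilon=\pm1$; - $[f_i,f_{-i}]=h_i$ for all $i$; - $[f_{\varepsilon_ti_t},[f_{\varepsilon_{t-1}i_{t-1}},\dots,[f_{\varepsilon_2i_2},f_{\varepsilon_1i_1}]]]=0$ whenever $\sum_{k=1}^t\varepsilon_kc_{i_k}\notin R$, $\varepsilon_k=\pm1$. Let $G=F/I(q)$, let $H$ be the abelian subalgebra generated by $h_1,\dots,h_n$, and let $G_\alpha$ be the span of the monomials (iterated brackets of generators) of degree $\alpha\in\mathbb{Z}^n$. Set $\tilde G=\tilde G(q)=G\oplus(\operatorname{rad}_{\mathbb{C}}q)^*$ and $\tilde H=H\oplus(\operatorname{rad}_{\mathbb{C}}q)^*$, with the bracket extending that of $G$ by $[\xi,x]=-[x,\xi]=\xi(\rho(\alpha))x$ for $\xi\in(\operatorname{rad}_{\mathbb{C}}q)^*$, $x\in G_\alpha$, and $[\xi,\zeta]=0$ for $\xi,\zeta\in(\operatorname{rad}_{\mathbb{C}}q)^*$. This is a Lie algebra, graded by $\mathbb{Z}^n$ with support in $R$ (elements of $(\operatorname{rad}_{\mathbb{C}}q)^*$ have degree $0$), independent of $\rho$ up to isomorphism. It has a unique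 maximal ideal $I$ among ideals with $I\cap\tilde H=\{0\}$, and $I$ is graded. **The Lie algebra $E(q)$.** First let $N=\bigoplus_{\alpha\in R}N_\alpha$, where $N_\alpha=\mathbb{C}e_\alpha$ (one-dimensional with basis $e_\alpha$) for $\alpha\in R^\times$, $N_\alpha=\mathbb{C}^n/\mathbb{C}\alpha$ for $\alpha\in R^0\setminus\{0\}$, and $N_0=\mathbb{C}^n\oplus(\operatorname{rad}_{\mathbb{C}}q)^*$. For $0\ne\sigma\in R^0$ let $\pi_\sigma:\mathbb{C}^n\to N_\sigma$ be the canonical projection; let $\pi_0:\mathbb{C}^n\to N_0$ be the inclusion. Choose a (not necessarily symmetric) bilinear form $B:\mathbb{Z}^n\times\mathbb{Z}^n\to\mathbb{Z}$ with $B(x,x)=q(x)$ for all $x$ and set $\epsilon(\alpha,\beta)=(-1)^{B(\alpha,\beta)}$. For $\alpha,\beta\in R^\times$, $\sigma,\tau\in R^0$, $v,w\in\mathbb{C}^n$, $\xi,\zeta\in(\operatorname{rad}_{\mathbb{C}}q)^*$ the bracket of $N$ is the bilinear map given by: - $[\pi_\sigma(v),\pi_\tau(w)]=\epsilon(\sigma,\tau)q(v,w)\pi_{\sigma+\tau}(\sigma)$; - $[\pi_\sigma(v),e_\beta]=-[e_\beta,\pi_\sigma(v)]=\epsilon(\sigma,\beta)q(v,\beta)e_{\beta+\sigma}$; - $[e_\alpha,e_\beta]=\epsilon(\alpha,\beta)e_{\alpha+\beta}$ if $\alpha+\beta\in R^\times$, $=\epsilon(\alpha,\beta)\pi_{\alpha+\beta}(\alpha)$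 if $\alpha+\beta\in R^0$, and $=0$ otherwise; - $[\xi,e_\beta]=-[e_\beta,\xi]=\xi(\rho(\beta))e_\beta$; - $[\xi,\pi_\tau(w)]=-[\pi_\tau(w),\xi]=\xi(\rho(\tau))\pi_\tau(w)$; - $[\xi,\zeta]=0$. This makes $N$ a Lie algebra, independent of the choices of $B$ and $\rho$ up to isomorphism. $E=E(q)$ is the factor Lie algebra of $N$ induced by the canonical epimorphisms $N_\alpha\to\mathbb{C}^n/\operatorname{rad}_{\mathbb{C}}q$ for $\alpha\in R^0\setminus\{0\}$. So $E=\bigoplus_{\alpha\in R}E_\alpha$ with $E_\alpha=\mathbb{C}e_\alpha$ for $\alpha\in R^\times$, $E_\alpha=\mathbb{C}^n/\operatorname{rad}_{\mathbb{C}}q$ for $\alpha\in R^0\setminus\{0\}$, $E_0=\mathbb{C}^n\oplus(\operatorname{rad}_{\mathbb{C}}q)^*$; it is graded by $\mathbb{Z}^n$ with support $R$. An isomorphism of graded Lie algebras between $\tilde G(q)/I$ and $E(q)$ is a Lie algebra isomorphism preserving the $\mathbb{Z}^n$-degree.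
   Formalization: A unique maximal ideal I need not exist (it fails for q=(x1+x2+x3)^2), so uniqueness is not claimed: the isomorphism is proved for I whenever a unique maximal I exists, and, for every q, for some maximal ideal I with I∩H~={0}. *)

theory Defs
  imports
    "HOL-Analysis.Cartesian_Space"
    "HOL-Library.Poly_Mapping"
    "HOL-Library.Function_Algebras"
    "HOL-Algebra.Module"
    "HOL-Algebra.QuotRing"
    "HOL-Algebra.Algebraic_Closure_Type"
begin

section \<open>Complex Lie algebras\<close>

text \<open>
  A complex algebra, associative or not, is a record of type \<open>(complex, 'a) module\<close>; the
  field \<open>mult\<close> is its product, which for a Lie algebra is the bracket. The field \<open>one\<close>
  of that record has no meaning here and is filled with zero.
\<close>

abbreviation complex_ring :: "complex ring"
  where "complex_ring \<equiv> ring_of_type_algebra"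

locale lie_algebra = Module.module complex_ring L for L (structure) +
  assumes bracket_closed: "x \<in> carrier L \<Longrightarrow> y \<in> carrier L \<Longrightarrow> x \<otimes> y \<in> carrier L"
    and bracket_add_left: "x \<in> carrier L \<Longrightarrow> y \<in> carrier L \<Longrightarrow> z \<in> carrier L \<Longrightarrow>
      (x \<oplus> y) \<otimes> z = (x \<otimes> z) \<oplus> (y \<otimes> z)"
    and bracket_add_right: "x \<in> carrier L \<Longrightarrow> y \<in> carrier L \<Longrightarrow> z \<in> carrier L \<Longrightarrow>
      x \<otimes> (y \<oplus> z) = (x \<otimes> y) \<oplus> (x \<otimes> z)"
    and bracket_smult_left: "x \<in> carrier L \<Longrightarrow> y \<in> carrier L \<Longrightarrow>
      (c \<odot> x) \<otimes> y = c \<odot> (x \<otimes> y)"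
    and bracket_smult_right: "x \<in> carrier L \<Longrightarrow> y \<in> carrier L \<Longrightarrow>
      x \<otimes> (c \<odot> y) = c \<odot> (x \<otimes> y)"
    and bracket_alternating: "x \<in> carrier L \<Longrightarrow> x \<otimes> x = \<zero>"
    and jacobi: "x \<in> carrier L \<Longrightarrow> y \<in> carrier L \<Longrightarrow> z \<in> carrier L \<Longrightarrow>
      (x \<otimes> (y \<otimes> z)) \<oplus> (y \<otimes> (z \<otimes> x)) \<oplus> (z \<otimes> (x \<otimes> y)) = \<zero>"

definition alg_ideal :: "(complex, 'a) module \<Rightarrow> 'a set \<Rightarrow> bool" where
  "alg_ideal L J \<longleftrightarrow> submodule J complex_ring L \<and>
    (\<forall>x\<in>carrier L. \<forall>y\<in>J. x \<otimes>\<^bsub>L\<^esub> y \<in> J \<and> y \<otimes>\<^bsub>L\<^esub> x \<in> J)"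

definition subalg :: "(complex, 'a) module \<Rightarrow> 'a set \<Rightarrow> bool" where
  "subalg L S \<longleftrightarrow> submodule S complex_ring L \<and> (\<forall>x\<in>S. \<forall>y\<in>S. x \<otimes>\<^bsub>L\<^esub> y \<in> S)"

definition lin_span :: "(complex, 'a) module \<Rightarrow> 'a set \<Rightarrow> 'a set" where
  "lin_span L S = (\<lambda>V. submodule V complex_ring L) hull S"

definition alg_quotient :: "(complex, 'a) module \<Rightarrow> 'a set \<Rightarrow> (complex, 'a set) module" where
  "alg_quotient L J =
    \<lparr>carrier = a_rcosets\<^bsub>L\<^esub> J, monoid.mult = rcoset_mult L J, one = J, zero = J, add = set_add L,
     module.smult = (\<lambda>c A. \<Union>x\<in>A. J +>\<^bsub>L\<^esub> (c \<odot>\<^bsub>L\<^esub> x))\<rparr>"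

text \<open>
  \<open>T\<close> stands for a subalgebra that the ideals are required to meet trivially; maximality is
  with respect to inclusion among these ideals.
\<close>

definition maximal_ideal_avoiding :: "(complex, 'a) module \<Rightarrow> 'a set \<Rightarrow> 'a set \<Rightarrow> bool" where
  "maximal_ideal_avoiding L T I \<longleftrightarrow> alg_ideal L I \<and> I \<inter> T = {\<zero>\<^bsub>L\<^esub>} \<and>
    (\<forall>J. alg_ideal L J \<and> J \<inter> T = {\<zero>\<^bsub>L\<^esub>} \<and> I \<subseteq> J \<longrightarrow> J = I)"

definition unique_maximal_ideal_avoiding :: "(complex, 'a) module \<Rightarrow> 'a set \<Rightarrow> 'a set \<Rightarrow> bool" where
  "unique_maximal_ideal_avoiding L T I \<longleftrightarrow> maximal_ideal_avoiding L T I \<and>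
    (\<forall>J. maximal_ideal_avoiding L T J \<longrightarrow> J = I)"

section \<open>Gradings\<close>

definition homogeneous_decomposition ::
    "(complex, 'a) module \<Rightarrow> ('d \<Rightarrow> 'a set) \<Rightarrow> 'a \<Rightarrow> ('d \<Rightarrow> 'a) \<Rightarrow> bool" where
  "homogeneous_decomposition L g x f \<longleftrightarrow>
    (\<forall>\<alpha>. f \<alpha> \<in> g \<alpha>) \<and> finite {\<alpha>. f \<alpha> \<noteq> \<zero>\<^bsub>L\<^esub>} \<and>
    x = (\<Oplus>\<^bsub>L\<^esub>\<alpha>\<in>{\<alpha>. f \<alpha> \<noteq> \<zero>\<^bsub>L\<^esub>}. f \<alpha>)"

definition graded_lie_algebra :: "(complex, 'a) module \<Rightarrow> ('d::plus \<Rightarrow> 'a set) \<Rightarrow> bool" where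
  "graded_lie_algebra L g \<longleftrightarrow> lie_algebra L \<and>
    (\<forall>\<alpha>. submodule (g \<alpha>) complex_ring L) \<and>
    (\<forall>\<alpha> \<beta>. \<forall>x\<in>g \<alpha>. \<forall>y\<in>g \<beta>. x \<otimes>\<^bsub>L\<^esub> y \<in> g (\<alpha> + \<beta>)) \<and>
    (\<forall>x\<in>carrier L. \<exists>!f. homogeneous_decomposition L g x f)"

definition quotient_grading ::
    "(complex, 'a) module \<Rightarrow> ('d \<Rightarrow> 'a set) \<Rightarrow> 'a set \<Rightarrow> 'd \<Rightarrow> 'a set set" where
  "quotient_grading L g J \<alpha> = (\<lambda>x. J +>\<^bsub>L\<^esub> x) ` g \<alpha>"

text \<open>The linear map that multiplies every homogeneous element of degree \<open>\<alpha>\<close> by \<open>c \<alpha>\<close>.\<close>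

definition degree_action ::
    "(complex, 'a) module \<Rightarrow> ('d \<Rightarrow> 'a set) \<Rightarrow> ('d \<Rightarrow> complex) \<Rightarrow> 'a \<Rightarrow> 'a" where
  "degree_action L g c x = (THE y. \<exists>f. homogeneous_decomposition L g x f \<and>
    y = (\<Oplus>\<^bsub>L\<^esub>\<alpha>\<in>{\<alpha>. f \<alpha> \<noteq> \<zero>\<^bsub>L\<^esub>}. c \<alpha> \<odot>\<^bsub>L\<^esub> f \<alpha>))"

definition graded_lie_iso :: "(complex, 'a) module \<Rightarrow> ('d \<Rightarrow> 'a set) \<Rightarrow>
    (complex, 'b) module \<Rightarrow> ('d \<Rightarrow> 'b set) \<Rightarrow> ('a \<Rightarrow> 'b) set" where
  "graded_lie_iso L g M k = {\<phi>. bij_betw \<phi> (carrier L) (carrier M) \<and>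
    (\<forall>x\<in>carrier L. \<forall>y\<in>carrier L. \<phi> (x \<oplus>\<^bsub>L\<^esub> y) = \<phi> x \<oplus>\<^bsub>M\<^esub> \<phi> y) \<and>
    (\<forall>c. \<forall>x\<in>carrier L. \<phi> (c \<odot>\<^bsub>L\<^esub> x) = c \<odot>\<^bsub>M\<^esub> \<phi> x) \<and>
    (\<forall>x\<in>carrier L. \<forall>y\<in>carrier L. \<phi> (x \<otimes>\<^bsub>L\<^esub> y) = \<phi> x \<otimes>\<^bsub>M\<^esub> \<phi> y) \<and>
    (\<forall>\<alpha>. \<phi> ` g \<alpha> = k \<alpha>)}"

definition isomorphic_graded_lie_algebras :: "(complex, 'a) module \<Rightarrow> ('d::plus \<Rightarrow> 'a set) \<Rightarrow>
    (complex, 'b) module \<Rightarrow> ('d \<Rightarrow> 'b set) \<Rightarrow> bool" where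
  "isomorphic_graded_lie_algebras L g M k \<longleftrightarrow>
    graded_lie_algebra L g \<and> graded_lie_algebra M k \<and> graded_lie_iso L g M k \<noteq> {}"

section \<open>Free Lie algebras\<close>

datatype 'g bracketing = Gen 'g | Br "'g bracketing" "'g bracketing"

text \<open>The free nonassociative algebra: its basis is the free magma on the generators.\<close>

definition free_alg :: "(complex, 'g bracketing \<Rightarrow>\<^sub>0 complex) module" where
  "free_alg =
    \<lparr>carrier = UNIV,
     monoid.mult = (\<lambda>x y. \<Sum>s\<in>Poly_Mapping.keys x. \<Sum>t\<in>Poly_Mapping.keys y.
       Poly_Mapping.single (Br s t) (Poly_Mapping.lookup x s * Poly_Mapping.lookup y t)),
     one = 0, zero = 0, add = (+),
     module.smult = (\<lambda>c. Poly_Mapping.map ((*) c))\<rparr>"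

definition lie_identities :: "('g bracketing \<Rightarrow>\<^sub>0 complex) set" where
  "lie_identities = alg_ideal free_alg hull
    ({x \<otimes>\<^bsub>free_alg\<^esub> x | x. True} \<union>
     {(x \<otimes>\<^bsub>free_alg\<^esub> (y \<otimes>\<^bsub>free_alg\<^esub> z)) \<oplus>\<^bsub>free_alg\<^esub> (y \<otimes>\<^bsub>free_alg\<^esub> (z \<otimes>\<^bsub>free_alg\<^esub> x))
        \<oplus>\<^bsub>free_alg\<^esub> (z \<otimes>\<^bsub>free_alg\<^esub> (x \<otimes>\<^bsub>free_alg\<^esub> y)) | x y z. True})"

definition free_lie :: "(complex, ('g bracketing \<Rightarrow>\<^sub>0 complex) set) module" where
  "free_lie = alg_quotient free_alg lie_identities"

definition free_lie_gen :: "'g \<Rightarrow> ('g bracketing \<Rightarrow>\<^sub>0 complex) set" where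
  "free_lie_gen g = lie_identities +>\<^bsub>free_alg\<^esub> Poly_Mapping.single (Gen g) 1"

primrec monomial_value :: "(complex, 'a) module \<Rightarrow> ('g \<Rightarrow> 'a) \<Rightarrow> 'g bracketing \<Rightarrow> 'a" where
  "monomial_value L v (Gen g) = v g"
| "monomial_value L v (Br s t) = monomial_value L v s \<otimes>\<^bsub>L\<^esub> monomial_value L v t"

text \<open>\<open>[x\<^sub>t, [x\<^sub>t\<^sub>-\<^sub>1, \<dots>, [x\<^sub>2, x\<^sub>1]]]\<close> for the list \<open>x\<^sub>t, \<dots>, x\<^sub>1\<close>; only nonempty lists are used.\<close>

fun nested_bracket :: "(complex, 'a) module \<Rightarrow> 'a list \<Rightarrow> 'a" where
  "nested_bracket L [] = \<zero>\<^bsub>L\<^esub>"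
| "nested_bracket L [x] = x"
| "nested_bracket L (x # y # xs) = x \<otimes>\<^bsub>L\<^esub> nested_bracket L (y # xs)"

section \<open>Unit forms\<close>

text \<open>Only the coefficients \<open>c i j\<close> with \<open>i < j\<close> are used.\<close>

definition unit_form :: "('n \<Rightarrow> 'n \<Rightarrow> int) \<Rightarrow> int ^ 'n::{finite,linorder} \<Rightarrow> int" where
  "unit_form c x = (\<Sum>i\<in>UNIV. (x $ i)\<^sup>2) + (\<Sum>(i, j)\<in>{(i, j). i < j}. c i j * x $ i * x $ j)"

definition connected_coeffs :: "('n::linorder \<Rightarrow> 'n \<Rightarrow> int) \<Rightarrow> bool" where
  "connected_coeffs c \<longleftrightarrow>
    {(i, j). i < j \<and> c i j \<noteq> 0 \<or> j < i \<and> c j i \<noteq> 0}\<^sup>* = UNIV"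

definition nonneg_form :: "(int ^ 'n \<Rightarrow> int) \<Rightarrow> bool" where
  "nonneg_form q \<longleftrightarrow> (\<forall>x. 0 \<le> q x)"

definition polar :: "(int ^ 'n \<Rightarrow> int) \<Rightarrow> int ^ 'n \<Rightarrow> int ^ 'n \<Rightarrow> int" where
  "polar q x y = q (x + y) - q x - q y"

abbreviation basis_vec :: "'n \<Rightarrow> int ^ 'n" where
  "basis_vec i \<equiv> axis i 1"

definition form_matrix :: "(int ^ 'n \<Rightarrow> int) \<Rightarrow> 'n \<Rightarrow> 'n \<Rightarrow> int" where
  "form_matrix q i j = polar q (basis_vec i) (basis_vec j)"

definition polarC :: "(int ^ 'n::finite \<Rightarrow> int) \<Rightarrow> complex ^ 'n \<Rightarrow> complex ^ 'n \<Rightarrow> complex" where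
  "polarC q v w = (\<Sum>i\<in>UNIV. \<Sum>j\<in>UNIV. v $ i * of_int (form_matrix q i j) * w $ j)"

definition cvec :: "int ^ 'n \<Rightarrow> complex ^ 'n" where
  "cvec x = (\<chi> i. of_int (x $ i))"

definition rad :: "(int ^ 'n \<Rightarrow> int) \<Rightarrow> (int ^ 'n) set" where
  "rad q = {x. \<forall>y. polar q x y = 0}"

definition radC :: "(int ^ 'n::finite \<Rightarrow> int) \<Rightarrow> (complex ^ 'n) set" where
  "radC q = vec.span (cvec ` rad q)"

text \<open>Functionals on \<open>radC q\<close> are represented by their extension by zero outside \<open>radC q\<close>.\<close>

definition radC_dual :: "(int ^ 'n::finite \<Rightarrow> int) \<Rightarrow> (complex ^ 'n \<Rightarrow> complex) set" where
  "radC_dual q = {\<xi>. (\<forall>v\<in>radC q. \<forall>w\<in>radC q. \<xi> (v + w) = \<xi> v + \<xi> w) \<and>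
     (\<forall>a. \<forall>v\<in>radC q. \<xi> (a *s v) = a * \<xi> v) \<and> (\<forall>v. v \<notin> radC q \<longrightarrow> \<xi> v = 0)}"

definition radC_projection ::
    "(int ^ 'n::finite \<Rightarrow> int) \<Rightarrow> (complex ^ 'n \<Rightarrow> complex ^ 'n) \<Rightarrow> bool" where
  "radC_projection q \<rho> \<longleftrightarrow> Vector_Spaces.linear (*s) (*s) \<rho> \<and>
    (\<forall>v. \<rho> v \<in> radC q) \<and> (\<forall>v\<in>radC q. \<rho> v = v)"

definition imag_roots :: "(int ^ 'n \<Rightarrow> int) \<Rightarrow> (int ^ 'n) set" where
  "imag_roots q = {x. q x = 0}"

definition real_roots :: "(int ^ 'n \<Rightarrow> int) \<Rightarrow> (int ^ 'n) set" where
  "real_roots q = {x. q x = 1}"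

abbreviation roots :: "(int ^ 'n \<Rightarrow> int) \<Rightarrow> (int ^ 'n) set" where
  "roots q \<equiv> imag_roots q \<union> real_roots q"

section \<open>The Lie algebra defined by generators and relations\<close>

datatype 'n generator = Fminus 'n | Hgen 'n | Fplus 'n

primrec gen_degree :: "'n generator \<Rightarrow> int ^ 'n" where
  "gen_degree (Fminus i) = - basis_vec i"
| "gen_degree (Hgen i) = 0"
| "gen_degree (Fplus i) = basis_vec i"

primrec monomial_degree :: "'n::finite generator bracketing \<Rightarrow> int ^ 'n" where
  "monomial_degree (Gen g) = gen_degree g"
| "monomial_degree (Br s t) = monomial_degree s + monomial_degree t"

type_synonym 'n free_elt = "('n generator bracketing \<Rightarrow>\<^sub>0 complex) set"

abbreviation (input) F_h :: "'n \<Rightarrow> 'n free_elt" where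
  "F_h i \<equiv> free_lie_gen (Hgen i)"

definition F_f :: "int \<Rightarrow> 'n \<Rightarrow> 'n free_elt" where
  "F_f \<epsilon> i = free_lie_gen (if \<epsilon> = 1 then Fplus i else Fminus i)"

definition G_relations :: "(int ^ 'n::finite \<Rightarrow> int) \<Rightarrow> 'n free_elt set" where
  "G_relations q =
    {F_h i \<otimes>\<^bsub>free_lie\<^esub> F_h j | i j. True} \<union>
    {(F_h i \<otimes>\<^bsub>free_lie\<^esub> F_f \<epsilon> j) \<ominus>\<^bsub>free_lie\<^esub> (of_int (\<epsilon> * form_matrix q i j) \<odot>\<^bsub>free_lie\<^esub> F_f \<epsilon> j)
      | i j \<epsilon>. \<epsilon> \<in> {1, -1}} \<union>
    {(F_f 1 i \<otimes>\<^bsub>free_lie\<^esub> F_f (-1) i) \<ominus>\<^bsub>free_lie\<^esub> F_h i | i. True} \<union>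
    {nested_bracket free_lie (map (\<lambda>(\<epsilon>, i). F_f \<epsilon> i) ws)
      | ws. ws \<noteq> [] \<and> (\<forall>(\<epsilon>, i)\<in>set ws. \<epsilon> \<in> {1, -1}) \<and>
            (\<Sum>(\<epsilon>, i)\<leftarrow>ws. \<epsilon> *s basis_vec i) \<notin> roots q}"

definition G_ideal :: "(int ^ 'n::finite \<Rightarrow> int) \<Rightarrow> 'n free_elt set" where
  "G_ideal q = alg_ideal free_lie hull G_relations q"

definition G_alg :: "(int ^ 'n::finite \<Rightarrow> int) \<Rightarrow> (complex, 'n free_elt set) module" where
  "G_alg q = alg_quotient free_lie (G_ideal q)"

definition G_gen :: "(int ^ 'n::finite \<Rightarrow> int) \<Rightarrow> 'n generator \<Rightarrow> 'n free_elt set" where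
  "G_gen q g = G_ideal q +>\<^bsub>free_lie\<^esub> free_lie_gen g"

definition G_grading :: "(int ^ 'n::finite \<Rightarrow> int) \<Rightarrow> int ^ 'n \<Rightarrow> 'n free_elt set set" where
  "G_grading q \<alpha> = lin_span (G_alg q)
    {monomial_value (G_alg q) (G_gen q) t | t. monomial_degree t = \<alpha>}"

definition G_H :: "(int ^ 'n::finite \<Rightarrow> int) \<Rightarrow> 'n free_elt set set" where
  "G_H q = subalg (G_alg q) hull {G_gen q (Hgen i) | i. True}"

type_synonym 'n tilde_elt = "'n free_elt set \<times> (complex ^ 'n \<Rightarrow> complex)"

definition dual_action :: "(int ^ 'n::finite \<Rightarrow> int) \<Rightarrow> (complex ^ 'n \<Rightarrow> complex ^ 'n) \<Rightarrow>
    (complex ^ 'n \<Rightarrow> complex) \<Rightarrow> 'n free_elt set \<Rightarrow> 'n free_elt set" where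
  "dual_action q \<rho> \<xi> = degree_action (G_alg q) (G_grading q) (\<lambda>\<alpha>. \<xi> (\<rho> (cvec \<alpha>)))"

definition G_tilde :: "(int ^ 'n::finite \<Rightarrow> int) \<Rightarrow> (complex ^ 'n \<Rightarrow> complex ^ 'n) \<Rightarrow>
    (complex, 'n tilde_elt) module" where
  "G_tilde q \<rho> =
    \<lparr>carrier = carrier (G_alg q) \<times> radC_dual q,
     monoid.mult = (\<lambda>(x, \<xi>) (y, \<zeta>).
       ((x \<otimes>\<^bsub>G_alg q\<^esub> y) \<oplus>\<^bsub>G_alg q\<^esub> dual_action q \<rho> \<xi> y \<ominus>\<^bsub>G_alg q\<^esub> dual_action q \<rho> \<zeta> x, 0)),
     one = (\<zero>\<^bsub>G_alg q\<^esub>, 0),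
     zero = (\<zero>\<^bsub>G_alg q\<^esub>, 0),
     add = (\<lambda>(x, \<xi>) (y, \<zeta>). (x \<oplus>\<^bsub>G_alg q\<^esub> y, \<xi> + \<zeta>)),
     module.smult = (\<lambda>c (x, \<xi>). (c \<odot>\<^bsub>G_alg q\<^esub> x, \<lambda>v. c * \<xi> v))\<rparr>"

definition H_tilde :: "(int ^ 'n::finite \<Rightarrow> int) \<Rightarrow> 'n tilde_elt set" where
  "H_tilde q = G_H q \<times> radC_dual q"

definition G_tilde_grading :: "(int ^ 'n::finite \<Rightarrow> int) \<Rightarrow> int ^ 'n \<Rightarrow> 'n tilde_elt set" where
  "G_tilde_grading q \<alpha> = G_grading q \<alpha> \<times> (if \<alpha> = 0 then radC_dual q else {0})"

section \<open>The Lie algebra defined by roots\<close>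

definition admissible_bilinear :: "(int ^ 'n \<Rightarrow> int) \<Rightarrow> (int ^ 'n \<Rightarrow> int ^ 'n \<Rightarrow> int) \<Rightarrow> bool" where
  "admissible_bilinear q B \<longleftrightarrow>
    (\<forall>x y z. B (x + y) z = B x z + B y z) \<and> (\<forall>x y z. B x (y + z) = B x y + B x z) \<and>
    (\<forall>x. B x x = q x)"

definition sgn_cocycle :: "(int ^ 'n \<Rightarrow> int ^ 'n \<Rightarrow> int) \<Rightarrow> int ^ 'n \<Rightarrow> int ^ 'n \<Rightarrow> complex" where
  "sgn_cocycle B \<alpha> \<beta> = (-1) powi B \<alpha> \<beta>"

text \<open>
  A triple \<open>(a, u, \<xi>)\<close> represents
  \<open>(\<Sum>\<alpha>. a \<alpha> \<cdot> e\<^sub>\<alpha>) + (\<Sum>\<sigma>. \<pi>\<^sub>\<sigma> (u \<sigma>)) + \<xi>\<close>; two triples with the same \<open>a\<close> and \<open>\<xi>\<close> represent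
  the same element if and only if the values \<open>u \<sigma>\<close> agree modulo \<open>\<complex>\<sigma>\<close>. As \<open>\<complex>0 = 0\<close>, this includes
  the case \<open>\<sigma> = 0\<close>, where \<open>\<pi>\<^sub>0\<close> is injective.
\<close>

type_synonym 'n root_elt =
  "(int ^ 'n \<Rightarrow>\<^sub>0 complex) \<times> (int ^ 'n \<Rightarrow>\<^sub>0 complex ^ 'n) \<times> (complex ^ 'n \<Rightarrow> complex)"

definition e_elt :: "int ^ 'n \<Rightarrow> 'n::finite root_elt" where
  "e_elt \<alpha> = (Poly_Mapping.single \<alpha> 1, 0, 0)"

definition pi_elt :: "int ^ 'n \<Rightarrow> complex ^ 'n \<Rightarrow> 'n::finite root_elt" where
  "pi_elt \<sigma> v = (0, Poly_Mapping.single \<sigma> v, 0)"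

definition scale_elt :: "complex \<Rightarrow> 'n::finite root_elt \<Rightarrow> 'n root_elt" where
  "scale_elt c = (\<lambda>(a, u, \<xi>).
    (Poly_Mapping.map ((*) c) a, Poly_Mapping.map ((*s) c) u, \<lambda>v. c * \<xi> v))"

definition bracket_pi_pi :: "(int ^ 'n \<Rightarrow> int) \<Rightarrow> (int ^ 'n \<Rightarrow> int ^ 'n \<Rightarrow> int) \<Rightarrow>
    int ^ 'n \<Rightarrow> complex ^ 'n \<Rightarrow> int ^ 'n \<Rightarrow> complex ^ 'n \<Rightarrow> 'n::finite root_elt" where
  "bracket_pi_pi q B \<sigma> v \<tau> w =
    scale_elt (sgn_cocycle B \<sigma> \<tau> * polarC q v w) (pi_elt (\<sigma> + \<tau>) (cvec \<sigma>))"

definition bracket_pi_e :: "(int ^ 'n \<Rightarrow> int) \<Rightarrow> (int ^ 'n \<Rightarrow> int ^ 'n \<Rightarrow> int) \<Rightarrow>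
    int ^ 'n \<Rightarrow> complex ^ 'n \<Rightarrow> int ^ 'n \<Rightarrow> 'n::finite root_elt" where
  "bracket_pi_e q B \<sigma> v \<beta> =
    scale_elt (sgn_cocycle B \<sigma> \<beta> * polarC q v (cvec \<beta>)) (e_elt (\<beta> + \<sigma>))"

definition bracket_e_e :: "(int ^ 'n \<Rightarrow> int) \<Rightarrow> (int ^ 'n \<Rightarrow> int ^ 'n \<Rightarrow> int) \<Rightarrow>
    int ^ 'n \<Rightarrow> int ^ 'n \<Rightarrow> 'n::finite root_elt" where
  "bracket_e_e q B \<alpha> \<beta> =
    (if \<alpha> + \<beta> \<in> real_roots q then scale_elt (sgn_cocycle B \<alpha> \<beta>) (e_elt (\<alpha> + \<beta>))
     else if \<alpha> + \<beta> \<in> imag_roots q then scale_elt (sgn_cocycle B \<alpha> \<beta>) (pi_elt (\<alpha> + \<beta>) (cvec \<alpha>))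
     else 0)"

definition bracket_dual :: "(complex ^ 'n \<Rightarrow> complex ^ 'n) \<Rightarrow> (complex ^ 'n \<Rightarrow> complex) \<Rightarrow>
    (int ^ 'n \<Rightarrow>\<^sub>0 complex) \<Rightarrow> (int ^ 'n \<Rightarrow>\<^sub>0 complex ^ 'n) \<Rightarrow> 'n::finite root_elt" where
  "bracket_dual \<rho> \<xi> b w =
    (\<Sum>\<beta>\<in>Poly_Mapping.keys b.
       scale_elt (Poly_Mapping.lookup b \<beta>) (scale_elt (\<xi> (\<rho> (cvec \<beta>))) (e_elt \<beta>))) +
    (\<Sum>\<tau>\<in>Poly_Mapping.keys w.
       scale_elt (\<xi> (\<rho> (cvec \<tau>))) (pi_elt \<tau> (Poly_Mapping.lookup w \<tau>)))"

definition root_bracket :: "(int ^ 'n \<Rightarrow> int) \<Rightarrow> (int ^ 'n \<Rightarrow> int ^ 'n \<Rightarrow> int) \<Rightarrow>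
    (complex ^ 'n \<Rightarrow> complex ^ 'n) \<Rightarrow> 'n::finite root_elt \<Rightarrow> 'n root_elt \<Rightarrow> 'n root_elt" where
  "root_bracket q B \<rho> = (\<lambda>(a, u, \<xi>) (b, w, \<zeta>).
    (\<Sum>\<sigma>\<in>Poly_Mapping.keys u. \<Sum>\<tau>\<in>Poly_Mapping.keys w.
       bracket_pi_pi q B \<sigma> (Poly_Mapping.lookup u \<sigma>) \<tau> (Poly_Mapping.lookup w \<tau>)) +
    (\<Sum>\<sigma>\<in>Poly_Mapping.keys u. \<Sum>\<beta>\<in>Poly_Mapping.keys b.
       scale_elt (Poly_Mapping.lookup b \<beta>) (bracket_pi_e q B \<sigma> (Poly_Mapping.lookup u \<sigma>) \<beta>)) -
    (\<Sum>\<tau>\<in>Poly_Mapping.keys w. \<Sum>\<alpha>\<in>Poly_Mapping.keys a.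
       scale_elt (Poly_Mapping.lookup a \<alpha>) (bracket_pi_e q B \<tau> (Poly_Mapping.lookup w \<tau>) \<alpha>)) +
    (\<Sum>\<alpha>\<in>Poly_Mapping.keys a. \<Sum>\<beta>\<in>Poly_Mapping.keys b.
       scale_elt (Poly_Mapping.lookup a \<alpha> * Poly_Mapping.lookup b \<beta>) (bracket_e_e q B \<alpha> \<beta>)) +
    bracket_dual \<rho> \<xi> b w - bracket_dual \<rho> \<zeta> a u)"

definition root_alg :: "(int ^ 'n \<Rightarrow> int) \<Rightarrow> (int ^ 'n \<Rightarrow> int ^ 'n \<Rightarrow> int) \<Rightarrow>
    (complex ^ 'n \<Rightarrow> complex ^ 'n) \<Rightarrow> (complex, 'n::finite root_elt) module" where
  "root_alg q B \<rho> =
    \<lparr>carrier = {(a, u, \<xi>). Poly_Mapping.keys a \<subseteq> real_roots q \<and>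
       Poly_Mapping.keys u \<subseteq> imag_roots q \<and> \<xi> \<in> radC_dual q},
     monoid.mult = root_bracket q B \<rho>, one = 0, zero = 0, add = (+), module.smult = scale_elt\<rparr>"

definition root_grading :: "(int ^ 'n \<Rightarrow> int) \<Rightarrow> int ^ 'n \<Rightarrow> 'n::finite root_elt set" where
  "root_grading q \<alpha> = {(a, u, \<xi>). Poly_Mapping.keys a \<subseteq> real_roots q \<inter> {\<alpha>} \<and>
     Poly_Mapping.keys u \<subseteq> imag_roots q \<inter> {\<alpha>} \<and> \<xi> \<in> (if \<alpha> = 0 then radC_dual q else {0})}"

definition N_kernel :: "(int ^ 'n \<Rightarrow> int) \<Rightarrow> 'n::finite root_elt set" where
  "N_kernel q = {(a, u, \<xi>). a = 0 \<and> \<xi> = 0 \<and> Poly_Mapping.keys u \<subseteq> imag_roots q \<and>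
     (\<forall>\<sigma>. Poly_Mapping.lookup u \<sigma> \<in> vec.span {cvec \<sigma>})}"

definition N_alg :: "(int ^ 'n \<Rightarrow> int) \<Rightarrow> (int ^ 'n \<Rightarrow> int ^ 'n \<Rightarrow> int) \<Rightarrow>
    (complex ^ 'n \<Rightarrow> complex ^ 'n) \<Rightarrow> (complex, 'n::finite root_elt set) module" where
  "N_alg q B \<rho> = alg_quotient (root_alg q B \<rho>) (N_kernel q)"

definition N_grading :: "(int ^ 'n \<Rightarrow> int) \<Rightarrow> (int ^ 'n \<Rightarrow> int ^ 'n \<Rightarrow> int) \<Rightarrow>
    (complex ^ 'n \<Rightarrow> complex ^ 'n) \<Rightarrow> int ^ 'n \<Rightarrow> 'n::finite root_elt set set" where
  "N_grading q B \<rho> = quotient_grading (root_alg q B \<rho>) (root_grading q) (N_kernel q)"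

text \<open>
  The kernel of the maps \<open>N\<^sub>\<sigma> \<rightarrow> \<complex>\<^sup>n / radC q\<close> for nonzero imaginary roots \<open>\<sigma>\<close>; the degree-zero
  part of \<open>N\<close> is left unchanged.
\<close>

definition E_kernel :: "(int ^ 'n \<Rightarrow> int) \<Rightarrow> (int ^ 'n \<Rightarrow> int ^ 'n \<Rightarrow> int) \<Rightarrow>
    (complex ^ 'n \<Rightarrow> complex ^ 'n) \<Rightarrow> 'n::finite root_elt set set" where
  "E_kernel q B \<rho> = (\<lambda>x. N_kernel q +>\<^bsub>root_alg q B \<rho>\<^esub> x) `
    {(a, u, \<xi>). a = 0 \<and> \<xi> = 0 \<and> Poly_Mapping.keys u \<subseteq> imag_roots q - {0} \<and>
       (\<forall>\<sigma>. Poly_Mapping.lookup u \<sigma> \<in> radC q)}"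

definition E_alg :: "(int ^ 'n \<Rightarrow> int) \<Rightarrow> (int ^ 'n \<Rightarrow> int ^ 'n \<Rightarrow> int) \<Rightarrow>
    (complex ^ 'n \<Rightarrow> complex ^ 'n) \<Rightarrow> (complex, 'n::finite root_elt set set) module" where
  "E_alg q B \<rho> = alg_quotient (N_alg q B \<rho>) (E_kernel q B \<rho>)"

definition E_grading :: "(int ^ 'n \<Rightarrow> int) \<Rightarrow> (int ^ 'n \<Rightarrow> int ^ 'n \<Rightarrow> int) \<Rightarrow>
    (complex ^ 'n \<Rightarrow> complex ^ 'n) \<Rightarrow> int ^ 'n \<Rightarrow> 'n::finite root_elt set set set" where
  "E_grading q B \<rho> = quotient_grading (N_alg q B \<rho>) (N_grading q B \<rho>) (E_kernel q B \<rho>)"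

end

theory Submission
  imports Defs
begin

text \<open>
  The isomorphism is induced by the homomorphism from the extended algebra \<open>G_tilde\<close> to \<open>E\<close> that sends
  \<open>f\<^sub>i\<close> and \<open>f\<^sub>-\<^sub>i\<close> to the root vectors of the simple roots \<open>c\<^sub>i\<close> and (up to a sign) \<open>- c\<^sub>i\<close>, sends \<open>h\<^sub>i\<close> to \<open>\<pi>\<^sub>0(c\<^sub>i)\<close>, and
  is the identity on the functionals. It exists because \<open>E\<close> is a Lie algebra whose degrees all lie in
  \<open>R\<close>: a nested bracket whose degree is outside \<open>R\<close> can only go to zero
  (\<open>simple_values_relations\<close>, \<open>comparison_homomorphism\<close>).

  That \<open>E\<close> is a Lie algebra is checked on generating triples. Every defect of antisymmetry or of the
  Jacobi identity is a multiple of some \<open>\<pi>\<^sub>\<sigma>(\<sigma>)\<close> with \<open>\<sigma>\<close> imaginary, which is zero already in \<open>N\<close>. The one case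
  that needs work is that of three real root vectors, where non-negativity leaves finitely many
  possibilities for the three products of the roots (\<open>jacobiator_e_e_e\<close>).

  The homomorphism is onto. Let \<open>\<alpha>\<close> be a real root. Since \<open>q(\<alpha>, \<alpha>) = 2\<close> is the sum of the \<open>\<alpha>\<^sub>i q(\<alpha>, c\<^sub>i)\<close>, a simple
  root or its negative can be subtracted so that the difference is a shorter element of \<open>R\<close>. From
  an imaginary root any simple root in its support, with the sign of its coefficient, can be split off,
  which leaves a real root, and connectedness spreads the
  resulting \<open>\<pi>\<^sub>\<sigma>(c\<^sub>i)\<close> over all indices (\<open>generated_by_simple_root_vectors\<close>).

  Its kernel \<open>K\<close> is maximal among the ideals that meet \<open>H_tilde\<close> trivially. The degree-zero part of \<open>E\<close>, onto
  which \<open>H_tilde\<close> is mapped bijectively, acts on \<open>E\<close> diagonally with weights that separate the degrees, so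
  ideals of \<open>E\<close> are graded; and a nonzero homogeneous element can be moved to a nonzero element of degree
  zero by a bracket. So every nonzero ideal of \<open>E\<close> meets the degree-zero part
  (\<open>E_ideal_avoiding_degree_zero\<close>). For imaginary degrees this rests on the fact that the kernel of the
  complexified form is spanned by integral vectors (\<open>radC_if_polarC_zero\<close>).

  Hence \<open>K\<close> is a maximal ideal of the required kind, it equals the unique one whenever there is a unique
  one, and the first isomorphism theorem identifies the quotient with \<open>E\<close>. The grading of \<open>G\<close> and the
  action of the functionals on it are well defined because rescaling the generators by
  characters gives automorphisms that have distinct eigenvalues on distinct pieces
  (\<open>G_graded_module\<close>).
\<close>

section \<open>Bilinear algebras, quotients and homomorphisms\<close>

lemma complex_ring_simps [simp]:
  "carrier complex_ring = UNIV"
  "a \<otimes>\<^bsub>complex_ring\<^esub> b = a * b" "a \<oplus>\<^bsub>complex_ring\<^esub> b = a + b"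
  "\<one>\<^bsub>complex_ring\<^esub> = 1" "\<zero>\<^bsub>complex_ring\<^esub> = 0"
  by (simp_all add: ring_of_type_algebra_def)

lemma complex_ring_minus [simp]: "\<ominus>\<^bsub>complex_ring\<^esub> a = - a"
proof -
  interpret cring "complex_ring" by (rule cring_from_type_algebra)
  show ?thesis by (rule minus_equality) simp_all
qed

text \<open>The module laws are stated over the ring record \<open>complex_ring\<close>; here they are restated with the
  arithmetic of the type of complex numbers, so that scalars simplify.\<close>

locale complex_module = Module.module complex_ring L for L :: "(complex, 'a) module" (structure)
begin

lemma csmult_closed [simp, intro]: "x \<in> carrier L \<Longrightarrow> c \<odot> x \<in> carrier L"
  by (rule smult_closed) simp_all

lemma csmult_rules:
  "x \<in> carrier L \<Longrightarrow> (a + b) \<odot> x = a \<odot> x \<oplus> b \<odot> x"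
  "x \<in> carrier L \<Longrightarrow> y \<in> carrier L \<Longrightarrow> a \<odot> (x \<oplus> y) = a \<odot> x \<oplus> a \<odot> y"
  "x \<in> carrier L \<Longrightarrow> a \<odot> (b \<odot> x) = (a * b) \<odot> x"
  using smult_l_distr[of a b x] smult_r_distr[of a x y] smult_assoc1[of a b x] by simp_all

lemma csmult_simps [simp]:
  "x \<in> carrier L \<Longrightarrow> 1 \<odot> x = x" "x \<in> carrier L \<Longrightarrow> 0 \<odot> x = \<zero>" "c \<odot> \<zero> = \<zero>"
  using smult_one[of x] smult_l_null[of x] smult_r_null[of c] by simp_all

lemma neg_eq_smult: "x \<in> carrier L \<Longrightarrow> \<ominus> x = (-1) \<odot> x"
  using smult_l_minus[of 1 x] smult_one[of x] by simp

lemma diff_eq_smult: "x \<in> carrier L \<Longrightarrow> y \<in> carrier L \<Longrightarrow> x \<ominus> y = x \<oplus> (-1) \<odot> y"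
  by (simp add: a_minus_def neg_eq_smult)

lemma csmult_neg [simp]: "x \<in> carrier L \<Longrightarrow> x \<oplus> (-1) \<odot> x = \<zero>" "x \<in> carrier L \<Longrightarrow> (-1) \<odot> x \<oplus> x = \<zero>"
  by (simp_all add: neg_eq_smult[symmetric] M.r_neg M.l_neg)

lemma diff_eq_zero_iff [simp]: "x \<in> carrier L \<Longrightarrow> y \<in> carrier L \<Longrightarrow> x \<ominus> y = \<zero> \<longleftrightarrow> x = y"
  using M.a_assoc[of x "(-1) \<odot> y" y] by (auto simp: diff_eq_smult)

lemma submodule_iff:
  "submodule H complex_ring L \<longleftrightarrow> H \<subseteq> carrier L \<and> \<zero> \<in> H \<and>
    (\<forall>x\<in>H. \<forall>y\<in>H. x \<oplus> y \<in> H) \<and> (\<forall>c. \<forall>x\<in>H. c \<odot> x \<in> H)"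
proof
  assume s: "submodule H complex_ring L"
  show "H \<subseteq> carrier L \<and> \<zero> \<in> H \<and> (\<forall>x\<in>H. \<forall>y\<in>H. x \<oplus> y \<in> H) \<and> (\<forall>c. \<forall>x\<in>H. c \<odot> x \<in> H)"
    using submoduleE[OF s] subgroup.one_closed[OF submodule.axioms(1)[OF s]] by auto
next
  assume h: "H \<subseteq> carrier L \<and> \<zero> \<in> H \<and> (\<forall>x\<in>H. \<forall>y\<in>H. x \<oplus> y \<in> H) \<and> (\<forall>c. \<forall>x\<in>H. c \<odot> x \<in> H)"
  show "submodule H complex_ring L"
    by (rule submoduleI) (use h in \<open>auto simp: neg_eq_smult subset_iff\<close>)
qed

lemma finsum_csmult:
  "finite A \<Longrightarrow> f \<in> A \<rightarrow> carrier L \<Longrightarrow> c \<odot> (\<Oplus>i\<in>A. f i) = (\<Oplus>i\<in>A. c \<odot> f i)"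
  by (rule finsum_smult_ldistr) simp_all

lemma lin_span_submodule:
  assumes "S \<subseteq> carrier L"
  shows "submodule (lin_span L S) complex_ring L"
  unfolding lin_span_def hull_def submodule_iff using assms
  by (intro conjI; auto 0 3)

end

text \<open>The free nonassociative algebra is not a Lie algebra, and the algebra of triples that presents \<open>N\<close> and
  \<open>E\<close> need not be one. Ideals, quotients and homomorphisms of both are needed.\<close>

locale bilinear_algebra = complex_module L for L (structure) +
  assumes prod_closed [simp, intro]: "x \<in> carrier L \<Longrightarrow> y \<in> carrier L \<Longrightarrow> x \<otimes> y \<in> carrier L"
    and prod_add_left: "x \<in> carrier L \<Longrightarrow> y \<in> carrier L \<Longrightarrow> z \<in> carrier L \<Longrightarrow>
      (x \<oplus> y) \<otimes> z = (x \<otimes> z) \<oplus> (y \<otimes> z)"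
    and prod_add_right: "x \<in> carrier L \<Longrightarrow> y \<in> carrier L \<Longrightarrow> z \<in> carrier L \<Longrightarrow>
      x \<otimes> (y \<oplus> z) = (x \<otimes> y) \<oplus> (x \<otimes> z)"
    and prod_smult_left: "x \<in> carrier L \<Longrightarrow> y \<in> carrier L \<Longrightarrow> (c \<odot> x) \<otimes> y = c \<odot> (x \<otimes> y)"
    and prod_smult_right: "x \<in> carrier L \<Longrightarrow> y \<in> carrier L \<Longrightarrow> x \<otimes> (c \<odot> y) = c \<odot> (x \<otimes> y)"
begin

lemma prod_zero_left [simp]: "y \<in> carrier L \<Longrightarrow> \<zero> \<otimes> y = \<zero>"
  using prod_smult_left[of \<zero> y 0] by simp

lemma prod_zero_right [simp]: "y \<in> carrier L \<Longrightarrow> y \<otimes> \<zero> = \<zero>"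
  using prod_smult_right[of y \<zero> 0] by simp

lemma alg_ideal_iff: "alg_ideal L J \<longleftrightarrow> J \<subseteq> carrier L \<and> \<zero> \<in> J \<and>
    (\<forall>x\<in>J. \<forall>y\<in>J. x \<oplus> y \<in> J) \<and> (\<forall>c. \<forall>x\<in>J. c \<odot> x \<in> J) \<and>
    (\<forall>x\<in>carrier L. \<forall>y\<in>J. x \<otimes> y \<in> J \<and> y \<otimes> x \<in> J)"
  unfolding alg_ideal_def using submodule_iff by auto

lemma hull_alg_ideal:
  assumes "S \<subseteq> carrier L"
  shows "alg_ideal L (alg_ideal L hull S)"
  unfolding hull_def alg_ideal_iff using assms by (intro conjI; auto 0 3)

lemma subalg_iff: "subalg L S \<longleftrightarrow> S \<subseteq> carrier L \<and> \<zero> \<in> S \<and>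
    (\<forall>x\<in>S. \<forall>y\<in>S. x \<oplus> y \<in> S) \<and> (\<forall>c. \<forall>x\<in>S. c \<odot> x \<in> S) \<and> (\<forall>x\<in>S. \<forall>y\<in>S. x \<otimes> y \<in> S)"
  unfolding subalg_def using submodule_iff by auto

lemma hull_subalg:
  assumes "S \<subseteq> carrier L"
  shows "subalg L (subalg L hull S)"
  unfolding hull_def subalg_iff using assms by (intro conjI; auto 0 3)

end

lemma bilinear_algebraI:
  fixes L (structure)
  assumes "complex_module L"
    and "\<And>x y. x \<in> carrier L \<Longrightarrow> y \<in> carrier L \<Longrightarrow> x \<otimes> y \<in> carrier L"
    and "\<And>x y z. x \<in> carrier L \<Longrightarrow> y \<in> carrier L \<Longrightarrow> z \<in> carrier L \<Longrightarrow>
      (x \<oplus> y) \<otimes> z = (x \<otimes> z) \<oplus> (y \<otimes> z)"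
    and "\<And>x y z. x \<in> carrier L \<Longrightarrow> y \<in> carrier L \<Longrightarrow> z \<in> carrier L \<Longrightarrow>
      x \<otimes> (y \<oplus> z) = (x \<otimes> y) \<oplus> (x \<otimes> z)"
    and "\<And>c x y. x \<in> carrier L \<Longrightarrow> y \<in> carrier L \<Longrightarrow> (c \<odot> x) \<otimes> y = c \<odot> (x \<otimes> y)"
    and "\<And>c x y. x \<in> carrier L \<Longrightarrow> y \<in> carrier L \<Longrightarrow> x \<otimes> (c \<odot> y) = c \<odot> (x \<otimes> y)"
  shows "bilinear_algebra L"
  using assms by (simp add: bilinear_algebra_def bilinear_algebra_axioms_def)

lemma lie_algebra_bilinear: "lie_algebra L \<Longrightarrow> bilinear_algebra L"
  by (simp add: lie_algebra_def lie_algebra_axioms_def bilinear_algebra_def bilinear_algebra_axioms_def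
      complex_module_def)

lemma lie_algebraI:
  fixes L (structure)
  assumes "bilinear_algebra L"
    and "\<And>x. x \<in> carrier L \<Longrightarrow> x \<otimes> x = \<zero>"
    and "\<And>x y z. x \<in> carrier L \<Longrightarrow> y \<in> carrier L \<Longrightarrow> z \<in> carrier L \<Longrightarrow>
      (x \<otimes> (y \<otimes> z)) \<oplus> (y \<otimes> (z \<otimes> x)) \<oplus> (z \<otimes> (x \<otimes> y)) = \<zero>"
  shows "lie_algebra L"
  using assms by (simp add: lie_algebra_def lie_algebra_axioms_def bilinear_algebra_def
      bilinear_algebra_axioms_def complex_module_def)

lemma complex_moduleI:
  fixes L (structure)
  assumes "\<zero> \<in> carrier L"
    and "\<And>x y. x \<in> carrier L \<Longrightarrow> y \<in> carrier L \<Longrightarrow> x \<oplus> y \<in> carrier L"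
    and "\<And>c x. x \<in> carrier L \<Longrightarrow> c \<odot> x \<in> carrier L"
    and "\<And>x y z. x \<in> carrier L \<Longrightarrow> y \<in> carrier L \<Longrightarrow> z \<in> carrier L \<Longrightarrow> (x \<oplus> y) \<oplus> z = x \<oplus> (y \<oplus> z)"
    and "\<And>x y. x \<in> carrier L \<Longrightarrow> y \<in> carrier L \<Longrightarrow> x \<oplus> y = y \<oplus> x"
    and "\<And>x. x \<in> carrier L \<Longrightarrow> \<zero> \<oplus> x = x"
    and "\<And>x. x \<in> carrier L \<Longrightarrow> (-1) \<odot> x \<oplus> x = \<zero>"
    and "\<And>a b x. x \<in> carrier L \<Longrightarrow> (a + b) \<odot> x = a \<odot> x \<oplus> b \<odot> x"
    and "\<And>a x y. x \<in> carrier L \<Longrightarrow> y \<in> carrier L \<Longrightarrow> a \<odot> (x \<oplus> y) = a \<odot> x \<oplus> a \<odot> y"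
    and "\<And>a b x. x \<in> carrier L \<Longrightarrow> (a * b) \<odot> x = a \<odot> (b \<odot> x)"
    and "\<And>x. x \<in> carrier L \<Longrightarrow> 1 \<odot> x = x"
  shows "complex_module L"
unfolding complex_module_def
proof (rule Module.moduleI)
  show "cring complex_ring" by (rule cring_from_type_algebra)
  show "abelian_group L"
  proof (rule abelian_groupI)
    fix x assume "x \<in> carrier L"
    then show "\<exists>y\<in>carrier L. y \<oplus> x = \<zero>" using assms(3,7) by blast
  qed (use assms in auto)
qed (use assms in auto)

definition linear_map :: "(complex, 'a) module \<Rightarrow> (complex, 'b) module \<Rightarrow> ('a \<Rightarrow> 'b) \<Rightarrow> bool" where
  "linear_map L M f \<longleftrightarrow> (\<forall>x\<in>carrier L. f x \<in> carrier M) \<and>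
    (\<forall>x\<in>carrier L. \<forall>y\<in>carrier L. f (x \<oplus>\<^bsub>L\<^esub> y) = f x \<oplus>\<^bsub>M\<^esub> f y) \<and>
    (\<forall>c. \<forall>x\<in>carrier L. f (c \<odot>\<^bsub>L\<^esub> x) = c \<odot>\<^bsub>M\<^esub> f x)"

definition alg_hom :: "(complex, 'a) module \<Rightarrow> (complex, 'b) module \<Rightarrow> ('a \<Rightarrow> 'b) \<Rightarrow> bool" where
  "alg_hom L M f \<longleftrightarrow> linear_map L M f \<and>
    (\<forall>x\<in>carrier L. \<forall>y\<in>carrier L. f (x \<otimes>\<^bsub>L\<^esub> y) = f x \<otimes>\<^bsub>M\<^esub> f y)"

lemma linear_mapD:
  assumes "linear_map L M f"
  shows "x \<in> carrier L \<Longrightarrow> f x \<in> carrier M"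
    and "x \<in> carrier L \<Longrightarrow> y \<in> carrier L \<Longrightarrow> f (x \<oplus>\<^bsub>L\<^esub> y) = f x \<oplus>\<^bsub>M\<^esub> f y"
    and "x \<in> carrier L \<Longrightarrow> f (c \<odot>\<^bsub>L\<^esub> x) = c \<odot>\<^bsub>M\<^esub> f x"
  using assms by (auto simp: linear_map_def)

lemma alg_homD:
  assumes "alg_hom L M f"
  shows "x \<in> carrier L \<Longrightarrow> f x \<in> carrier M"
    and "x \<in> carrier L \<Longrightarrow> y \<in> carrier L \<Longrightarrow> f (x \<oplus>\<^bsub>L\<^esub> y) = f x \<oplus>\<^bsub>M\<^esub> f y"
    and "x \<in> carrier L \<Longrightarrow> f (c \<odot>\<^bsub>L\<^esub> x) = c \<odot>\<^bsub>M\<^esub> f x"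
    and "x \<in> carrier L \<Longrightarrow> y \<in> carrier L \<Longrightarrow> f (x \<otimes>\<^bsub>L\<^esub> y) = f x \<otimes>\<^bsub>M\<^esub> f y"
    and "linear_map L M f"
  using assms by (auto simp: linear_map_def alg_hom_def)

lemma linear_map_zero:
  assumes "complex_module L" "complex_module M" "linear_map L M f"
  shows "f \<zero>\<^bsub>L\<^esub> = \<zero>\<^bsub>M\<^esub>"
proof -
  interpret L: complex_module L by fact
  interpret M: complex_module M by fact
  have "f (0 \<odot>\<^bsub>L\<^esub> \<zero>\<^bsub>L\<^esub>) = 0 \<odot>\<^bsub>M\<^esub> f \<zero>\<^bsub>L\<^esub>"
    using assms(3) L.M.zero_closed unfolding linear_map_def by blast
  moreover have "f \<zero>\<^bsub>L\<^esub> \<in> carrier M" using assms(3) by (simp add: linear_map_def)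
  ultimately show ?thesis by simp
qed

lemma linear_map_minus:
  assumes "complex_module L" "complex_module M" "linear_map L M f" "x \<in> carrier L" "y \<in> carrier L"
  shows "f (x \<ominus>\<^bsub>L\<^esub> y) = f x \<ominus>\<^bsub>M\<^esub> f y"
  using assms by (simp add: complex_module.diff_eq_smult complex_module.csmult_closed linear_mapD)

lemma linear_map_finsum:
  assumes "complex_module L" "complex_module M" "linear_map L M f"
    and "finite A" "x \<in> A \<rightarrow> carrier L"
  shows "f (\<Oplus>\<^bsub>L\<^esub>a\<in>A. x a) = (\<Oplus>\<^bsub>M\<^esub>a\<in>A. f (x a))"
proof -
  interpret L: complex_module L by fact
  interpret M: complex_module M by fact
  show ?thesis using assms(4,5)
  proof (induction A rule: finite_induct)
    case empty
    show ?case by (simp add: linear_map_zero[OF assms(1-3)])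
  next
    case (insert a A)
    then have "(\<lambda>a. f (x a)) \<in> A \<rightarrow> carrier M" "f (x a) \<in> carrier M"
      using linear_mapD(1)[OF assms(3)] by auto
    with insert show ?case
      by (simp add: linear_mapD[OF assms(3)] Pi_def)
  qed
qed

text \<open>A surjection that respects the operations carries every identity of its domain over to its
  range; this is how all the quotients below inherit their algebra structure.\<close>

lemma surjective_image_module:
  assumes "complex_module L" "carrier Q = p ` carrier L" "\<zero>\<^bsub>Q\<^esub> = p \<zero>\<^bsub>L\<^esub>"
    and "linear_map L Q p"
  shows "complex_module Q"
proof -
  interpret L: complex_module L by fact
  have p: "p x \<oplus>\<^bsub>Q\<^esub> p y = p (x \<oplus>\<^bsub>L\<^esub> y)" "c \<odot>\<^bsub>Q\<^esub> p x = p (c \<odot>\<^bsub>L\<^esub> x)"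
    if "x \<in> carrier L" "y \<in> carrier L" for x y c
    using assms(4) that by (auto simp: linear_map_def)
  show ?thesis
    by (rule complex_moduleI; unfold assms(2,3); (elim imageE)?; hypsubst?)
      (auto simp: p L.M.a_ac L.csmult_rules)
qed

lemma surjective_image_bilinear_algebra:
  assumes "bilinear_algebra L" "carrier Q = p ` carrier L" "\<zero>\<^bsub>Q\<^esub> = p \<zero>\<^bsub>L\<^esub>" "alg_hom L Q p"
  shows "bilinear_algebra Q"
proof -
  interpret L: bilinear_algebra L by fact
  have p: "p x \<oplus>\<^bsub>Q\<^esub> p y = p (x \<oplus>\<^bsub>L\<^esub> y)" "c \<odot>\<^bsub>Q\<^esub> p x = p (c \<odot>\<^bsub>L\<^esub> x)" "p x \<otimes>\<^bsub>Q\<^esub> p y = p (x \<otimes>\<^bsub>L\<^esub> y)"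
    if "x \<in> carrier L" "y \<in> carrier L" for x y c
    using assms(4) that by (auto simp: linear_map_def alg_hom_def)
  show ?thesis
  proof (rule bilinear_algebraI)
    show "complex_module Q"
      using surjective_image_module[OF L.complex_module_axioms assms(2,3)] assms(4) by (simp add: alg_hom_def)
  qed (unfold assms(2), (elim imageE, hypsubst)+, (auto simp: p L.prod_add_left L.prod_add_right L.prod_smult_left L.prod_smult_right))
qed

context bilinear_algebra
begin

lemma alg_idealD:
  assumes "alg_ideal L J"
  shows "J \<subseteq> carrier L" "\<zero> \<in> J" "x \<in> J \<Longrightarrow> y \<in> J \<Longrightarrow> x \<oplus> y \<in> J" "x \<in> J \<Longrightarrow> c \<odot> x \<in> J"
    "x \<in> carrier L \<Longrightarrow> y \<in> J \<Longrightarrow> x \<otimes> y \<in> J" "x \<in> carrier L \<Longrightarrow> y \<in> J \<Longrightarrow> y \<otimes> x \<in> J"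
    "x \<in> J \<Longrightarrow> x \<in> carrier L"
  using assms by (auto simp: alg_ideal_iff)

lemma ideal_coset_eq_iff:
  assumes J: "alg_ideal L J" and "x \<in> carrier L" "y \<in> carrier L"
  shows "J +> x = J +> y \<longleftrightarrow> x \<ominus> y \<in> J"
proof -
  have "additive_subgroup J L"
    using J submodule.axioms(1) by (auto simp: alg_ideal_def intro: additive_subgroup.intro)
  then interpret J: abelian_subgroup J L
    by (rule abelian_subgroupI3) (rule M.abelian_group_axioms)
  have "J +> x = J +> y \<longleftrightarrow> x \<in> J +> y"
    using assms J.a_repr_independence'[of x y] J.a_repr_independenceD[of x y] by metis
  then show ?thesis
    using J.a_rcos_module[of y x] assms by (simp add: a_minus_def)
qed

lemma ideal_coset_mem:
  assumes J: "alg_ideal L J" and "x \<in> carrier L"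
  shows "y \<in> J +> x \<longleftrightarrow> y \<in> carrier L \<and> J +> y = J +> x"
proof -
  have "additive_subgroup J L"
    using J submodule.axioms(1) by (auto simp: alg_ideal_def intro: additive_subgroup.intro)
  then interpret J: abelian_subgroup J L
    by (rule abelian_subgroupI3) (rule M.abelian_group_axioms)
  show ?thesis
    using assms J.a_rcos_self[of y] J.a_repr_independence'[of y x] J.a_elemrcos_carrier[of x y]
    by metis
qed

lemma quotient_operations:
  assumes J: "alg_ideal L J" and x: "x \<in> carrier L" and y: "y \<in> carrier L"
  shows "(J +> x) \<oplus>\<^bsub>alg_quotient L J\<^esub> (J +> y) = J +> (x \<oplus> y)"
    and "(J +> x) \<otimes>\<^bsub>alg_quotient L J\<^esub> (J +> y) = J +> (x \<otimes> y)"
    and "c \<odot>\<^bsub>alg_quotient L J\<^esub> (J +> x) = J +> (c \<odot> x)"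
proof -
  note jd = alg_idealD[OF J]
  have sub: "additive_subgroup J L"
    using J submodule.axioms(1) by (auto simp: alg_ideal_def intro: additive_subgroup.intro)
  then interpret J: abelian_subgroup J L
    by (rule abelian_subgroupI3) (rule M.abelian_group_axioms)
  show "(J +> x) \<oplus>\<^bsub>alg_quotient L J\<^esub> (J +> y) = J +> (x \<oplus> y)"
    using x y by (simp add: alg_quotient_def J.a_rcos_sum)
  have prod: "J +> (a \<otimes> b) = J +> (x \<otimes> y)" if "a \<in> J +> x" "b \<in> J +> y" for a b
  proof -
    have ab: "a \<in> carrier L" "b \<in> carrier L" "a \<ominus> x \<in> J" "b \<ominus> y \<in> J"
      using that x y by (auto simp: ideal_coset_mem[OF J] ideal_coset_eq_iff[OF J])
    \<comment> \<open>the product of cosets does not depend on the representatives\<close>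
    have "a \<otimes> b \<ominus> x \<otimes> y = (a \<ominus> x) \<otimes> b \<oplus> x \<otimes> (b \<ominus> y)"
    proof -
      have z: "(-1) \<odot> u \<oplus> (u \<oplus> v) = v" if "u \<in> carrier L" "v \<in> carrier L" for u v
        using that by (simp add: neg_eq_smult[symmetric] M.r_neg1)
      show ?thesis using ab x y
        by (simp add: diff_eq_smult prod_add_left prod_add_right prod_smult_left prod_smult_right
            M.a_assoc z)
    qed
    then show ?thesis using ab x y jd by (simp add: ideal_coset_eq_iff[OF J])
  qed
  have "x \<in> J +> x" "y \<in> J +> y" using x y by (auto simp: ideal_coset_mem[OF J])
  then have ne: "J +> x \<noteq> {}" "J +> y \<noteq> {}" by auto
  have "rcoset_mult L J (J +> x) (J +> y) = (\<Union>a\<in>J +> x. \<Union>b\<in>J +> y. J +> (x \<otimes> y))"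
    unfolding rcoset_mult_def by (intro SUP_cong refl prod)
  then show "(J +> x) \<otimes>\<^bsub>alg_quotient L J\<^esub> (J +> y) = J +> (x \<otimes> y)"
    using ne by (simp add: alg_quotient_def)
  have smult: "J +> (c \<odot> a) = J +> (c \<odot> x)" if "a \<in> J +> x" for a
  proof -
    have a: "a \<in> carrier L" "a \<ominus> x \<in> J"
      using that x by (auto simp: ideal_coset_mem[OF J] ideal_coset_eq_iff[OF J])
    have "c \<odot> a \<ominus> c \<odot> x = c \<odot> (a \<ominus> x)"
      using a x by (simp add: a_minus_def smult_r_distr smult_r_minus[of c x, simplified])
    then show ?thesis using a x jd(4) by (simp add: ideal_coset_eq_iff[OF J])
  qed
  have "(\<Union>a\<in>J +> x. J +> (c \<odot> a)) = (\<Union>a\<in>J +> x. J +> (c \<odot> x))"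
    by (intro SUP_cong refl smult)
  then show "c \<odot>\<^bsub>alg_quotient L J\<^esub> (J +> x) = J +> (c \<odot> x)"
    using ne by (simp add: alg_quotient_def)
qed

lemma quotient_zero: "alg_ideal L J \<Longrightarrow> \<zero>\<^bsub>alg_quotient L J\<^esub> = J +> \<zero>"
  using alg_idealD(1) by (simp add: alg_quotient_def)

lemma quotient_carrier: "carrier (alg_quotient L J) = (\<lambda>x. J +> x) ` carrier L"
  by (auto simp: alg_quotient_def A_RCOSETS_def')

lemma quotient_hom: "alg_ideal L J \<Longrightarrow> alg_hom L (alg_quotient L J) (\<lambda>x. J +> x)"
  by (auto simp: alg_hom_def linear_map_def quotient_carrier quotient_operations)

lemma quotient_bilinear_algebra: "alg_ideal L J \<Longrightarrow> bilinear_algebra (alg_quotient L J)"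
  by (rule surjective_image_bilinear_algebra[OF bilinear_algebra_axioms quotient_carrier])
    (auto simp: quotient_hom quotient_zero)

lemma quotient_eq_zero_iff:
  assumes J: "alg_ideal L J" and "x \<in> carrier L"
  shows "J +> x = \<zero>\<^bsub>alg_quotient L J\<^esub> \<longleftrightarrow> x \<in> J"
  using assms ideal_coset_eq_iff[OF J, of x \<zero>] quotient_zero[OF J]
  by (simp add: diff_eq_smult)

end

lemma kernel_alg_ideal:
  assumes "bilinear_algebra L" "bilinear_algebra M" "alg_hom L M f"
  shows "alg_ideal L {x \<in> carrier L. f x = \<zero>\<^bsub>M\<^esub>}"
proof -
  interpret L: bilinear_algebra L by fact
  interpret M: bilinear_algebra M by fact
  note h = alg_homD[OF assms(3)]
  have "f \<zero>\<^bsub>L\<^esub> = \<zero>\<^bsub>M\<^esub>"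
    by (rule linear_map_zero[OF L.complex_module_axioms M.complex_module_axioms h(5)])
  moreover have "c \<odot>\<^bsub>M\<^esub> \<zero>\<^bsub>M\<^esub> = \<zero>\<^bsub>M\<^esub>" for c using M.smult_r_null by simp
  ultimately show ?thesis unfolding L.alg_ideal_iff by (auto simp: h)
qed

lemma image_alg_ideal:
  assumes "bilinear_algebra L" "bilinear_algebra M" "alg_hom L M f"
    and "f ` carrier L = carrier M" "alg_ideal L J"
  shows "alg_ideal M (f ` J)"
proof -
  interpret L: bilinear_algebra L by fact
  interpret M: bilinear_algebra M by fact
  note h = alg_homD[OF assms(3)] note j = L.alg_idealD[OF assms(5)]
  have z: "f \<zero>\<^bsub>L\<^esub> = \<zero>\<^bsub>M\<^esub>"
    by (rule linear_map_zero[OF L.complex_module_axioms M.complex_module_axioms h(5)])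
  show ?thesis unfolding M.alg_ideal_iff
  proof (intro conjI ballI allI)
    show "f ` J \<subseteq> carrier M" using j(7) h(1) by auto
    show "\<zero>\<^bsub>M\<^esub> \<in> f ` J" using j(2) z by force
  next
    fix x y assume "x \<in> f ` J" "y \<in> f ` J"
    then obtain a b where "a \<in> J" "b \<in> J" "x = f a" "y = f b" by auto
    then show "x \<oplus>\<^bsub>M\<^esub> y \<in> f ` J" using h(2)[of a b] j(7) j(3)[of a b] by (metis image_eqI)
  next
    fix c x assume "x \<in> f ` J"
    then show "c \<odot>\<^bsub>M\<^esub> x \<in> f ` J" using h(3) j(7) j(4) by (metis imageE image_eqI)
  next
    fix x y assume "x \<in> carrier M" "y \<in> f ` J"
    then have "x \<in> f ` carrier L" "y \<in> f ` J" using assms(4) by simp_all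
    then obtain a b where "a \<in> carrier L" "b \<in> J" "x = f a" "y = f b" by blast
    then show "x \<otimes>\<^bsub>M\<^esub> y \<in> f ` J" "y \<otimes>\<^bsub>M\<^esub> x \<in> f ` J"
      using h(4)[of a b] h(4)[of b a] j(7)[of b] j(5)[of a b] j(6)[of a b] by (metis image_eqI)+
  qed
qed

lemma alg_hom_compose:
  "alg_hom L M f \<Longrightarrow> alg_hom M N g \<Longrightarrow> alg_hom L N (\<lambda>x. g (f x))"
  by (simp add: alg_hom_def linear_map_def)

lemma hom_factors_through_quotient:
  assumes "bilinear_algebra L" "bilinear_algebra M" "alg_hom L M f" "alg_ideal L J"
    and kill: "\<forall>x\<in>J. f x = \<zero>\<^bsub>M\<^esub>"
  obtains g where "alg_hom (alg_quotient L J) M g" "\<forall>x\<in>carrier L. g (J +>\<^bsub>L\<^esub> x) = f x"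
proof -
  interpret L: bilinear_algebra L by fact
  interpret M: bilinear_algebra M by fact
  note h = alg_homD[OF assms(3)] note q = L.quotient_operations[OF assms(4)]
  define g where "g A = f (SOME x. x \<in> carrier L \<and> A = J +>\<^bsub>L\<^esub> x)" for A
  have g: "g (J +>\<^bsub>L\<^esub> x) = f x" if x: "x \<in> carrier L" for x
  proof -
    define y where "y = (SOME y. y \<in> carrier L \<and> J +>\<^bsub>L\<^esub> x = J +>\<^bsub>L\<^esub> y)"
    have y: "y \<in> carrier L" "J +>\<^bsub>L\<^esub> x = J +>\<^bsub>L\<^esub> y"
      unfolding y_def using someI_ex[of "\<lambda>y. y \<in> carrier L \<and> J +>\<^bsub>L\<^esub> x = J +>\<^bsub>L\<^esub> y"] x by auto
    then have "f (x \<ominus>\<^bsub>L\<^esub> y) = \<zero>\<^bsub>M\<^esub>" using kill L.ideal_coset_eq_iff[OF assms(4) x y(1)] by simp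
    then have "f x \<ominus>\<^bsub>M\<^esub> f y = \<zero>\<^bsub>M\<^esub>"
      using linear_map_minus[OF L.complex_module_axioms M.complex_module_axioms h(5) x y(1)] by simp
    then have "f x = f y" using h(1) x y(1) M.diff_eq_zero_iff by simp
    then show ?thesis by (simp add: g_def y_def)
  qed
  have "alg_hom (alg_quotient L J) M g"
    unfolding alg_hom_def linear_map_def L.quotient_carrier
    by (auto simp: q g h)
  with g that show ?thesis by blast
qed

lemma first_isomorphism_theorem:
  assumes "bilinear_algebra L" "bilinear_algebra M" "alg_hom L M f" "f ` carrier L = carrier M"
    and K: "K = {x \<in> carrier L. f x = \<zero>\<^bsub>M\<^esub>}"
  obtains g where "alg_hom (alg_quotient L K) M g" "\<forall>x\<in>carrier L. g (K +>\<^bsub>L\<^esub> x) = f x"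
    "bij_betw g (carrier (alg_quotient L K)) (carrier M)"
proof -
  interpret L: bilinear_algebra L by fact
  interpret M: bilinear_algebra M by fact
  have id: "alg_ideal L K" unfolding K by (rule kernel_alg_ideal[OF assms(1-3)])
  obtain g where g: "alg_hom (alg_quotient L K) M g" "\<forall>x\<in>carrier L. g (K +>\<^bsub>L\<^esub> x) = f x"
    by (rule hom_factors_through_quotient[OF assms(1-3) id]) (auto simp: K)
  have "inj_on g (carrier (alg_quotient L K))"
  proof (rule inj_onI)
    fix A B assume A: "A \<in> carrier (alg_quotient L K)" and B: "B \<in> carrier (alg_quotient L K)"
      and eq: "g A = g B"
    obtain x y where xy: "x \<in> carrier L" "A = K +>\<^bsub>L\<^esub> x" "y \<in> carrier L" "B = K +>\<^bsub>L\<^esub> y"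
      using A B by (auto simp: L.quotient_carrier)
    have "f x = f y" using eq g xy by simp
    then have "f (x \<ominus>\<^bsub>L\<^esub> y) = \<zero>\<^bsub>M\<^esub>"
      using linear_map_minus[OF L.complex_module_axioms M.complex_module_axioms alg_homD(5)[OF assms(3)] xy(1,3)] xy
        alg_homD(1)[OF assms(3)] M.diff_eq_zero_iff by simp
    then show "A = B" using xy L.ideal_coset_eq_iff[OF id xy(1,3)] by (simp add: K L.M.minus_closed)
  qed
  moreover have "g ` carrier (alg_quotient L K) = carrier M"
    using g(2) assms(4) by (force simp: L.quotient_carrier image_image)
  ultimately show ?thesis using that g by (simp add: bij_betw_def)
qed

lemma lie_algebra_if_injective_hom:
  assumes "bilinear_algebra L" "lie_algebra M" "alg_hom L M f" "inj_on f (carrier L)"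
  shows "lie_algebra L"
proof -
  interpret L: bilinear_algebra L by fact
  interpret M: lie_algebra M by fact
  interpret M: bilinear_algebra M by (rule lie_algebra_bilinear) (rule M.lie_algebra_axioms)
  note h = alg_homD[OF assms(3)]
  have z: "f \<zero>\<^bsub>L\<^esub> = \<zero>\<^bsub>M\<^esub>"
    by (rule linear_map_zero[OF L.complex_module_axioms M.complex_module_axioms h(5)])
  have inj: "x = \<zero>\<^bsub>L\<^esub>" if "x \<in> carrier L" "f x = \<zero>\<^bsub>M\<^esub>" for x
    using inj_onD[OF assms(4), of x "\<zero>\<^bsub>L\<^esub>"] that z by simp
  show ?thesis
    by (rule lie_algebraI[OF assms(1)]; rule inj) (auto simp: h M.bracket_alternating M.jacobi)
qed

section \<open>Homogeneous components\<close>

text \<open>The elimination argument for eigenvectors: one component after another is removed by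
  applying an operator minus the eigenvalue of that component.\<close>

lemma eigen_components:
  fixes L (structure)
  assumes M: "complex_module L" and J: "submodule J complex_ring L"
    and linT: "\<And>t. t \<in> S \<Longrightarrow> linear_map L L (T t)"
    and stable: "\<And>t x. t \<in> S \<Longrightarrow> x \<in> J \<Longrightarrow> T t x \<in> J"
    and "finite A" "\<forall>a\<in>A. x a \<in> carrier L" "(\<Oplus>a\<in>A. x a) \<in> J"
    and "\<forall>a\<in>A. \<forall>t\<in>S. T t (x a) = ev t a \<odot> x a"
    and "\<forall>a\<in>A. \<forall>b\<in>A. a \<noteq> b \<longrightarrow> (\<exists>t\<in>S. ev t a \<noteq> ev t b)"
  shows "\<forall>a\<in>A. x a \<in> J"
proof
  interpret complex_module L by fact
  note sub = J[unfolded complex_module.submodule_iff[OF M]]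
  fix a0 assume "a0 \<in> A"
  define B where "B = A - {a0}"
  have "finite B" "a0 \<notin> B" using assms(5) by (auto simp: B_def)
  have A: "A = insert a0 B" using \<open>a0 \<in> A\<close> by (auto simp: B_def)
  from \<open>finite B\<close> \<open>a0 \<notin> B\<close> show "x a0 \<in> J"
    using assms(6-9) unfolding A
  proof (induction B arbitrary: x rule: finite_induct)
    case empty
    then show ?case by (simp add: M.r_zero)
  next
    case (insert b B)
    obtain t where t: "t \<in> S" "ev t a0 \<noteq> ev t b" using insert.prems by auto
    note l = linear_mapD[OF linT[OF t(1)]]
    define y where "y a = (ev t a - ev t b) \<odot> x a" for a
    let ?A = "insert a0 (insert b B)"
    have xc: "x \<in> ?A \<rightarrow> carrier L" using insert.prems(2) by auto
    have yc: "y \<in> ?A \<rightarrow> carrier L" using insert.prems(2) by (auto simp: y_def)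
    have s: "(\<Oplus>a\<in>?A. y a) = T t (\<Oplus>a\<in>?A. x a) \<oplus> (- ev t b) \<odot> (\<Oplus>a\<in>?A. x a)"
    proof -
      have "(\<Oplus>a\<in>?A. y a) = (\<Oplus>a\<in>?A. T t (x a) \<oplus> (- ev t b) \<odot> x a)"
      proof (rule M.finsum_cong')
        fix a assume a: "a \<in> ?A"
        have "x a \<in> carrier L" "T t (x a) = ev t a \<odot> x a"
          using bspec[OF insert.prems(2) a] bspec[OF bspec[OF insert.prems(4) a] t(1)] by simp_all
        then show "y a = T t (x a) \<oplus> (- ev t b) \<odot> x a"
          using csmult_rules(1)[of "x a" "ev t a" "- ev t b"] by (simp add: y_def)
      qed (use insert.prems(2) in \<open>auto intro!: l(1)\<close>)
      also have "\<dots> = (\<Oplus>a\<in>?A. T t (x a)) \<oplus> (\<Oplus>a\<in>?A. (- ev t b) \<odot> x a)"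
        using insert.prems(2) by (intro M.finsum_addf) (auto intro!: l(1))
      also have "(\<Oplus>a\<in>?A. T t (x a)) = T t (\<Oplus>a\<in>?A. x a)"
        using linear_map_finsum[OF M M linT[OF t(1)] _ xc] insert.hyps by simp
      also have "(\<Oplus>a\<in>?A. (- ev t b) \<odot> x a) = (- ev t b) \<odot> (\<Oplus>a\<in>?A. x a)"
        using finsum_smult_ldistr[of ?A "- ev t b" x] insert.hyps xc by simp
      finally show ?thesis .
    qed
    have "(\<Oplus>a\<in>?A. y a) \<in> J"
      unfolding s using insert.prems(3) sub stable[OF t(1)] by auto
    moreover have "(\<Oplus>a\<in>?A. y a) = (\<Oplus>a\<in>insert a0 B. y a)"
    proof -
      have "y b = \<zero>" using insert.prems(2) by (simp add: y_def)
      have eq: "?A = insert b (insert a0 B)" by auto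
      have "b \<notin> insert a0 B" using insert by auto
      then have "(\<Oplus>a\<in>?A. y a) = y b \<oplus> (\<Oplus>a\<in>insert a0 B. y a)"
        unfolding eq using insert.hyps yc by (intro M.finsum_insert) auto
      moreover have "(\<Oplus>a\<in>insert a0 B. y a) \<in> carrier L" using yc by (intro M.finsum_closed) auto
      ultimately show ?thesis using \<open>y b = \<zero>\<close> by simp
    qed
    ultimately have yJ: "(\<Oplus>a\<in>insert a0 B. y a) \<in> J" by simp
    have "y a0 \<in> J"
    proof (rule insert.IH)
      show "(\<Oplus>a\<in>insert a0 B. y a) \<in> J" by (rule yJ)
      show "a0 \<notin> B" using insert.prems(1) by simp
      show "\<forall>a\<in>insert a0 B. y a \<in> carrier L" using yc by auto
      show "\<forall>a\<in>insert a0 B. \<forall>b\<in>insert a0 B. a \<noteq> b \<longrightarrow> (\<exists>t\<in>S. ev t a \<noteq> ev t b)"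
        using insert.prems(5) by simp
      show "\<forall>a\<in>insert a0 B. \<forall>t'\<in>S. T t' (y a) = ev t' a \<odot> y a"
      proof (intro ballI)
        fix a u assume a: "a \<in> insert a0 B" and u: "u \<in> S"
        have xa: "x a \<in> carrier L" using a insert.prems by auto
        have "T u (y a) = (ev t a - ev t b) \<odot> T u (x a)"
          using linear_mapD(3)[OF linT[OF u] xa] by (simp add: y_def)
        also have "T u (x a) = ev u a \<odot> x a" using insert.prems a u by auto
        finally show "T u (y a) = ev u a \<odot> y a"
          using xa smult_assoc1[of "ev t a - ev t b" "ev u a" "x a"]
            smult_assoc1[of "ev u a" "ev t a - ev t b" "x a"] by (simp add: y_def mult.commute)
      qed
    qed
    then have "inverse (ev t a0 - ev t b) \<odot> y a0 \<in> J" using sub by blast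
    moreover have "inverse (ev t a0 - ev t b) \<odot> y a0 = x a0"
      using insert.prems(2) t(2) smult_assoc1[of "inverse (ev t a0 - ev t b)" "ev t a0 - ev t b" "x a0"]
        smult_one[of "x a0"] by (simp add: y_def)
    ultimately show ?case by simp
  qed
qed

lemma finsum_support:
  fixes L (structure)
  assumes "complex_module L" "finite A" "\<forall>a. f a \<in> carrier L" "{a. f a \<noteq> \<zero>} \<subseteq> A"
  shows "(\<Oplus>a\<in>{a. f a \<noteq> \<zero>}. f a) = (\<Oplus>a\<in>A. f a)"
proof -
  interpret complex_module L by fact
  have "(\<Oplus>a\<in>A. f a) = (\<Oplus>a\<in>{a. f a \<noteq> \<zero>}. f a)"
    using assms by (intro M.add.finprod_mono_neutral_cong_left[symmetric]) auto
  then show ?thesis by simp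
qed

lemma homogeneous_decompositionI:
  fixes L (structure)
  assumes "complex_module L" "\<forall>\<alpha>. g \<alpha> \<subseteq> carrier L"
    and "\<forall>\<alpha>. f \<alpha> \<in> g \<alpha>" "finite A" "{a. f a \<noteq> \<zero>} \<subseteq> A" "x = (\<Oplus>a\<in>A. f a)"
  shows "homogeneous_decomposition L g x f"
proof -
  have "(\<Oplus>a\<in>{a. f a \<noteq> \<zero>}. f a) = (\<Oplus>a\<in>A. f a)"
    using assms by (intro finsum_support[OF assms(1)]) auto
  then show ?thesis using assms finite_subset unfolding homogeneous_decomposition_def by auto
qed

lemma homogeneous_decompositionD:
  fixes L (structure)
  assumes "complex_module L" "\<forall>\<alpha>. g \<alpha> \<subseteq> carrier L" "homogeneous_decomposition L g x f"
    and "finite A" "{a. f a \<noteq> \<zero>} \<subseteq> A"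
  shows "x = (\<Oplus>a\<in>A. f a)"
proof -
  have "(\<Oplus>a\<in>{a. f a \<noteq> \<zero>}. f a) = (\<Oplus>a\<in>A. f a)"
    using assms by (intro finsum_support[OF assms(1)]) (auto simp: homogeneous_decomposition_def)
  then show ?thesis using assms unfolding homogeneous_decomposition_def by auto
qed

lemma homogeneous_decomposition_add:
  fixes L (structure)
  assumes "complex_module L" "\<forall>\<alpha>. submodule (g \<alpha>) complex_ring L"
    and x: "homogeneous_decomposition L g x f" and y: "homogeneous_decomposition L g y k"
  shows "homogeneous_decomposition L g (x \<oplus> y) (\<lambda>\<alpha>. f \<alpha> \<oplus> k \<alpha>)"
proof -
  interpret complex_module L by fact
  have g: "\<forall>\<alpha>. g \<alpha> \<subseteq> carrier L" using assms(2) by (auto simp: complex_module.submodule_iff[OF assms(1)])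
  have f: "f \<alpha> \<in> g \<alpha>" "k \<alpha> \<in> g \<alpha>" for \<alpha> using x y by (auto simp: homogeneous_decomposition_def)
  then have c: "f \<alpha> \<in> carrier L" "k \<alpha> \<in> carrier L" for \<alpha> using g by auto
  let ?A = "{a. f a \<noteq> \<zero>} \<union> {a. k a \<noteq> \<zero>}"
  have fin: "finite ?A" using x y by (auto simp: homogeneous_decomposition_def)
  have "x = (\<Oplus>a\<in>?A. f a)" by (rule homogeneous_decompositionD[OF assms(1) g x fin]) auto
  moreover have "y = (\<Oplus>a\<in>?A. k a)" by (rule homogeneous_decompositionD[OF assms(1) g y fin]) auto
  ultimately have "x \<oplus> y = (\<Oplus>a\<in>?A. f a \<oplus> k a)" using c by (subst M.finsum_addf) auto
  then show ?thesis
    by (intro homogeneous_decompositionI[OF assms(1) g _ fin])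
      (use assms(2) f in \<open>auto simp: complex_module.submodule_iff[OF assms(1)]\<close>)
qed

lemma homogeneous_decomposition_smult:
  fixes L (structure)
  assumes "complex_module L" "\<forall>\<alpha>. submodule (g \<alpha>) complex_ring L"
    and x: "homogeneous_decomposition L g x f"
  shows "homogeneous_decomposition L g (c \<odot> x) (\<lambda>\<alpha>. c \<odot> f \<alpha>)"
proof -
  interpret complex_module L by fact
  have g: "\<forall>\<alpha>. g \<alpha> \<subseteq> carrier L" using assms(2) by (auto simp: complex_module.submodule_iff[OF assms(1)])
  have f: "f \<alpha> \<in> g \<alpha>" for \<alpha> using x by (auto simp: homogeneous_decomposition_def)
  then have c: "f \<alpha> \<in> carrier L" for \<alpha> using g by auto
  have fin: "finite {a. f a \<noteq> \<zero>}" using x by (auto simp: homogeneous_decomposition_def)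
  have "x = (\<Oplus>a\<in>{a. f a \<noteq> \<zero>}. f a)" using x by (auto simp: homogeneous_decomposition_def)
  then have "c \<odot> x = (\<Oplus>a\<in>{a. f a \<noteq> \<zero>}. c \<odot> f a)"
    using finsum_smult_ldistr[OF fin, of c f] c by simp
  moreover have "c \<odot> \<zero> = \<zero>" using smult_r_null by simp
  ultimately show ?thesis
    by (intro homogeneous_decompositionI[OF assms(1) g _ fin])
      (use assms(2) f in \<open>auto simp: complex_module.submodule_iff[OF assms(1)]\<close>)
qed

lemma homogeneous_decomposition_homogeneous:
  fixes L (structure)
  assumes "complex_module L" "\<forall>\<alpha>. submodule (g \<alpha>) complex_ring L" "x \<in> g \<beta>"
  shows "homogeneous_decomposition L g x (\<lambda>\<alpha>. if \<alpha> = \<beta> then x else \<zero>)"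
proof -
  interpret complex_module L by fact
  have g: "\<forall>\<alpha>. g \<alpha> \<subseteq> carrier L" using assms(2) by (auto simp: complex_module.submodule_iff[OF assms(1)])
  show ?thesis
    by (rule homogeneous_decompositionI[OF assms(1) g _, of _ "{\<beta>}"])
      (use assms(2,3) g in \<open>auto simp: complex_module.submodule_iff[OF assms(1)] subset_iff\<close>)
qed

lemma decomposable_submodule:
  fixes L (structure)
  assumes "complex_module L" "\<forall>\<alpha>. submodule (g \<alpha>) complex_ring L"
  shows "submodule {x. \<exists>f. homogeneous_decomposition L g x f} complex_ring L"
proof -
  interpret complex_module L by fact
  have g: "\<forall>\<alpha>. g \<alpha> \<subseteq> carrier L" using assms(2) by (auto simp: complex_module.submodule_iff[OF assms(1)])
  have "x \<in> carrier L" if "homogeneous_decomposition L g x f" for x f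
  proof -
    have "f \<in> {a. f a \<noteq> \<zero>} \<rightarrow> carrier L" using that g by (auto simp: homogeneous_decomposition_def)
    then show ?thesis using that M.finsum_closed by (auto simp: homogeneous_decomposition_def)
  qed
  moreover have "\<zero> \<in> g undefined" using assms(2) by (auto simp: complex_module.submodule_iff[OF assms(1)])
  ultimately show ?thesis unfolding complex_module.submodule_iff[OF assms(1)]
    using homogeneous_decomposition_add[OF assms] homogeneous_decomposition_smult[OF assms]
      homogeneous_decomposition_homogeneous[OF assms, of "\<zero>" undefined] by blast
qed

text \<open>The difference of two decompositions of one element is a decomposition of zero. If operators tell
  the degrees apart by their eigenvalues, elimination inside the zero submodule shows that each of
  its components is zero.\<close>

lemma homogeneous_decomposition_unique:
  fixes L (structure)
  assumes M: "complex_module L" and sub: "\<forall>\<alpha>. submodule (g \<alpha>) complex_ring L"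
    and linT: "\<And>t. t \<in> S \<Longrightarrow> linear_map L L (T t)"
    and ev: "\<And>t \<alpha> x. t \<in> S \<Longrightarrow> x \<in> g \<alpha> \<Longrightarrow> T t x = ev t \<alpha> \<odot> x"
    and sep: "\<And>\<alpha> \<beta>. \<alpha> \<noteq> \<beta> \<Longrightarrow> \<exists>t\<in>S. ev t \<alpha> \<noteq> ev t \<beta>"
    and x: "homogeneous_decomposition L g x f" and y: "homogeneous_decomposition L g x k"
  shows "f = k"
proof
  fix \<alpha>
  interpret complex_module L by fact
  have g: "\<forall>\<alpha>. g \<alpha> \<subseteq> carrier L" using sub by (auto simp: complex_module.submodule_iff[OF M])
  have y': "homogeneous_decomposition L g ((-1) \<odot> x) (\<lambda>\<alpha>. (-1) \<odot> k \<alpha>)"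
    by (rule homogeneous_decomposition_smult[OF M sub y])
  have d: "homogeneous_decomposition L g (x \<oplus> (-1) \<odot> x) (\<lambda>\<alpha>. f \<alpha> \<oplus> (-1) \<odot> k \<alpha>)" (is "homogeneous_decomposition L g _ ?d")
    by (rule homogeneous_decomposition_add[OF M sub x y'])
  have neg: "(-1) \<odot> u = \<ominus> u" if "u \<in> carrier L" for u
    using smult_l_minus[of 1 u] smult_one[of u] that by simp
  have xc: "x \<in> carrier L"
    using decomposable_submodule[OF M sub] x by (auto simp: complex_module.submodule_iff[OF M])
  let ?A = "insert \<alpha> {a. ?d a \<noteq> \<zero>}"
  have fin: "finite ?A" using d by (auto simp: homogeneous_decomposition_def)
  have dg: "?d a \<in> g a" for a using d by (auto simp: homogeneous_decomposition_def)
  have "(\<Oplus>a\<in>?A. ?d a) = x \<oplus> (-1) \<odot> x"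
    by (rule homogeneous_decompositionD[OF M g d fin, symmetric]) auto
  also have "\<dots> = \<zero>" using xc by (simp add: neg M.r_neg)
  finally have z: "(\<Oplus>a\<in>?A. ?d a) \<in> {\<zero>}" by simp
  have "\<forall>a\<in>?A. ?d a \<in> {\<zero>}"
  proof (rule eigen_components[OF M, where S = S and T = T and ev = ev])
    have "c \<odot> \<zero> = \<zero>" for c using smult_r_null by simp
    then show "submodule {\<zero>} complex_ring L" by (auto simp: complex_module.submodule_iff[OF M])
    show "T t x \<in> {\<zero>}" if "t \<in> S" "x \<in> {\<zero>}" for t x
      using linear_map_zero[OF M M linT] that by auto
    show "\<forall>a\<in>?A. \<forall>t\<in>S. T t (?d a) = ev t a \<odot> ?d a" using ev dg by auto
    show "\<forall>a\<in>?A. ?d a \<in> carrier L" using dg g by auto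
  qed (use linT fin z sep in auto)
  then have "f \<alpha> \<oplus> (-1) \<odot> k \<alpha> = \<zero>" by auto
  moreover have c: "f \<alpha> \<in> carrier L" "k \<alpha> \<in> carrier L"
    using x y g by (auto simp: homogeneous_decomposition_def)
  ultimately show "f \<alpha> = k \<alpha>" by (simp add: neg M.minus_equality[symmetric] M.minus_eq[symmetric])
qed

text \<open>The Lie identities hold in the domain because they hold in the range and the map is injective;
  decompositions correspond to each other because the map is bijective and matches the pieces.\<close>

lemma graded_lie_algebra_transport:
  assumes L: "bilinear_algebra L" and f: "alg_hom L M f" and bij: "bij_betw f (carrier L) (carrier M)"
    and M: "graded_lie_algebra M k" and g: "\<forall>\<alpha>. g \<alpha> \<subseteq> carrier L" "\<forall>\<alpha>. f ` g \<alpha> = k \<alpha>"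
  shows "graded_lie_algebra L g"
proof -
  interpret L: bilinear_algebra L by fact
  have lieM: "lie_algebra M" using M by (simp add: graded_lie_algebra_def)
  interpret M: lie_algebra M by fact
  interpret M: bilinear_algebra M by (rule lie_algebra_bilinear) (rule M.lie_algebra_axioms)
  note h = alg_homD[OF f]
  have inj: "inj_on f (carrier L)" using bij by (simp add: bij_betw_def)
  have mem: "x \<in> g \<alpha> \<longleftrightarrow> f x \<in> k \<alpha>" if "x \<in> carrier L" for x \<alpha>
    using inj_on_image_mem_iff[OF inj that, of "g \<alpha>"] g by auto
  have z: "f \<zero>\<^bsub>L\<^esub> = \<zero>\<^bsub>M\<^esub>"
    by (rule linear_map_zero[OF L.complex_module_axioms M.complex_module_axioms h(5)])
  have ks: "submodule (k \<alpha>) complex_ring M" for \<alpha> using M by (simp add: graded_lie_algebra_def)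
  note ks' = ks[unfolded complex_module.submodule_iff[OF M.complex_module_axioms]]
  have gs: "submodule (g \<alpha>) complex_ring L" for \<alpha>
    unfolding complex_module.submodule_iff[OF L.complex_module_axioms]
  proof (intro conjI ballI allI)
    show "\<zero>\<^bsub>L\<^esub> \<in> g \<alpha>" using mem[of "\<zero>\<^bsub>L\<^esub>" \<alpha>] z ks'[of \<alpha>] by simp
    show "x \<oplus>\<^bsub>L\<^esub> y \<in> g \<alpha>" if "x \<in> g \<alpha>" "y \<in> g \<alpha>" for x y
    proof -
      have "x \<in> carrier L" "y \<in> carrier L" using that g by auto
      then show ?thesis using that mem[of "x \<oplus>\<^bsub>L\<^esub> y" \<alpha>] mem[of x \<alpha>] mem[of y \<alpha>] ks'[of \<alpha>]
        by (simp add: h)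
    qed
    show "c \<odot>\<^bsub>L\<^esub> x \<in> g \<alpha>" if "x \<in> g \<alpha>" for c x
    proof -
      have "x \<in> carrier L" using that g by auto
      then show ?thesis using that mem[of "c \<odot>\<^bsub>L\<^esub> x" \<alpha>] mem[of x \<alpha>] ks'[of \<alpha>]
        by (simp add: h)
    qed
  qed (use g in auto)
  have prod: "x \<otimes>\<^bsub>L\<^esub> y \<in> g (\<alpha> + \<beta>)" if "x \<in> g \<alpha>" "y \<in> g \<beta>" for x y \<alpha> \<beta>
  proof -
    have c: "x \<in> carrier L" "y \<in> carrier L" using that g by auto
    then have "f x \<otimes>\<^bsub>M\<^esub> f y \<in> k (\<alpha> + \<beta>)"
      using M that mem[of x \<alpha>] mem[of y \<beta>] by (auto simp: graded_lie_algebra_def)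
    then show ?thesis using mem[of "x \<otimes>\<^bsub>L\<^esub> y"] c by (simp add: h)
  qed
  have dec: "homogeneous_decomposition L g x u \<longleftrightarrow>
      (\<forall>\<alpha>. u \<alpha> \<in> carrier L) \<and> homogeneous_decomposition M k (f x) (\<lambda>\<alpha>. f (u \<alpha>))" if x: "x \<in> carrier L" for x u
  proof (cases "\<forall>\<alpha>. u \<alpha> \<in> carrier L")
    case False
    then obtain \<alpha> where "u \<alpha> \<notin> g \<alpha>" using g(1) by auto
    then have "\<not> homogeneous_decomposition L g x u"
      by (auto simp: homogeneous_decomposition_def)
    with False show ?thesis by blast
  next
    case True
    have s: "{\<alpha>. f (u \<alpha>) \<noteq> \<zero>\<^bsub>M\<^esub>} = {\<alpha>. u \<alpha> \<noteq> \<zero>\<^bsub>L\<^esub>}"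
      using inj_on_eq_iff[OF inj, of _ "\<zero>\<^bsub>L\<^esub>"] True z by auto
    have "x = (\<Oplus>\<^bsub>L\<^esub>\<alpha>\<in>{\<alpha>. u \<alpha> \<noteq> \<zero>\<^bsub>L\<^esub>}. u \<alpha>) \<longleftrightarrow> f x = (\<Oplus>\<^bsub>M\<^esub>\<alpha>\<in>{\<alpha>. u \<alpha> \<noteq> \<zero>\<^bsub>L\<^esub>}. f (u \<alpha>))"
      if fin: "finite {\<alpha>. u \<alpha> \<noteq> \<zero>\<^bsub>L\<^esub>}"
    proof -
      have "(\<Oplus>\<^bsub>M\<^esub>\<alpha>\<in>{\<alpha>. u \<alpha> \<noteq> \<zero>\<^bsub>L\<^esub>}. f (u \<alpha>)) = f (\<Oplus>\<^bsub>L\<^esub>\<alpha>\<in>{\<alpha>. u \<alpha> \<noteq> \<zero>\<^bsub>L\<^esub>}. u \<alpha>)"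
        using linear_map_finsum[OF L.complex_module_axioms M.complex_module_axioms h(5) fin, of u] True by auto
      moreover have "(\<Oplus>\<^bsub>L\<^esub>\<alpha>\<in>{\<alpha>. u \<alpha> \<noteq> \<zero>\<^bsub>L\<^esub>}. u \<alpha>) \<in> carrier L"
        using True by (intro L.M.finsum_closed) auto
      ultimately show ?thesis using inj_on_eq_iff[OF inj x] by metis
    qed
    moreover have "u \<alpha> \<in> g \<alpha> \<longleftrightarrow> f (u \<alpha>) \<in> k \<alpha>" for \<alpha> using mem True by blast
    ultimately show ?thesis
      unfolding homogeneous_decomposition_def s using True by blast
  qed
  have "\<exists>!u. homogeneous_decomposition L g x u" if x: "x \<in> carrier L" for x
  proof -
    obtain v where v: "homogeneous_decomposition M k (f x) v"
      "\<And>w. homogeneous_decomposition M k (f x) w \<Longrightarrow> w = v"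
      using M h(1)[OF x] unfolding graded_lie_algebra_def by metis
    have "\<forall>\<alpha>. \<exists>y. y \<in> carrier L \<and> f y = v \<alpha>"
      using v(1) g unfolding homogeneous_decomposition_def by (metis imageE subset_iff)
    then obtain u where u: "\<forall>\<alpha>. u \<alpha> \<in> carrier L \<and> f (u \<alpha>) = v \<alpha>" by metis
    show ?thesis
    proof (rule ex1I[of _ u])
      show "homogeneous_decomposition L g x u" using dec[OF x] u v(1) by simp
      fix w assume "homogeneous_decomposition L g x w"
      then have w: "\<forall>\<alpha>. w \<alpha> \<in> carrier L" "(\<lambda>\<alpha>. f (w \<alpha>)) = v" using dec[OF x] v(2) by auto
      show "w = u"
      proof
        fix \<alpha>
        have "f (w \<alpha>) = f (u \<alpha>)" using w(2) u by auto
        then show "w \<alpha> = u \<alpha>" using inj_onD[OF inj] w(1) u by blast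
      qed
    qed
  qed
  then show ?thesis
    unfolding graded_lie_algebra_def
    using lie_algebra_if_injective_hom[OF L lieM f inj] gs prod by blast
qed

section \<open>Scaling by degree\<close>

text \<open>The operator \<open>degree_action\<close> is given by a definite description, which has a meaning only where
  every element has exactly one homogeneous decomposition.\<close>

locale graded_module = complex_module L for L :: "(complex, 'a) module" (structure) +
  fixes g :: "'d \<Rightarrow> 'a set"
  assumes graded_piece: "submodule (g \<alpha>) complex_ring L"
    and decomposition: "x \<in> carrier L \<Longrightarrow> \<exists>!f. homogeneous_decomposition L g x f"
begin

lemma graded_piece_carrier: "g \<alpha> \<subseteq> carrier L"
  using graded_piece by (simp add: submodule_iff)

lemma degree_action_eq:
  assumes "x \<in> carrier L" and f: "homogeneous_decomposition L g x f"
    and A: "finite A" "{\<alpha>. f \<alpha> \<noteq> \<zero>} \<subseteq> A"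
  shows "degree_action L g c x = (\<Oplus>\<alpha>\<in>A. c \<alpha> \<odot> f \<alpha>)"
proof -
  have fc: "f \<alpha> \<in> carrier L" for \<alpha>
    using f graded_piece_carrier by (auto simp: homogeneous_decomposition_def)
  have unique: "k = f" if "homogeneous_decomposition L g x k" for k
    using decomposition[OF assms(1)] f that by auto
  have "degree_action L g c x = (\<Oplus>\<alpha>\<in>{\<alpha>. f \<alpha> \<noteq> \<zero>}. c \<alpha> \<odot> f \<alpha>)"
    unfolding degree_action_def using f by (intro the_equality) (auto dest: unique)
  also have "\<dots> = (\<Oplus>\<alpha>\<in>A. c \<alpha> \<odot> f \<alpha>)"
    using A fc by (intro M.add.finprod_mono_neutral_cong_left) auto
  finally show ?thesis .
qed

lemma degree_action_closed [simp]:
  assumes "x \<in> carrier L"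
  shows "degree_action L g c x \<in> carrier L"
proof -
  obtain f where f: "homogeneous_decomposition L g x f" using decomposition[OF assms] by auto
  then have "f \<alpha> \<in> carrier L" for \<alpha>
    using graded_piece_carrier by (auto simp: homogeneous_decomposition_def)
  then show ?thesis using degree_action_eq[OF assms f _ subset_refl, of c] f
    by (auto simp: homogeneous_decomposition_def intro!: M.finsum_closed)
qed

lemma degree_action_add:
  assumes x: "x \<in> carrier L" and y: "y \<in> carrier L"
  shows "degree_action L g c (x \<oplus> y) = degree_action L g c x \<oplus> degree_action L g c y"
proof -
  obtain f k where f: "homogeneous_decomposition L g x f" and k: "homogeneous_decomposition L g y k"
    using decomposition[OF x] decomposition[OF y] by auto
  have fk: "homogeneous_decomposition L g (x \<oplus> y) (\<lambda>\<alpha>. f \<alpha> \<oplus> k \<alpha>)"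
    by (rule homogeneous_decomposition_add[OF complex_module_axioms _ f k]) (simp add: graded_piece)
  have c: "f \<alpha> \<in> carrier L" "k \<alpha> \<in> carrier L" for \<alpha>
    using f k graded_piece_carrier by (auto simp: homogeneous_decomposition_def)
  let ?A = "{\<alpha>. f \<alpha> \<noteq> \<zero>} \<union> {\<alpha>. k \<alpha> \<noteq> \<zero>}"
  have fin: "finite ?A" using f k by (auto simp: homogeneous_decomposition_def)
  have "degree_action L g c (x \<oplus> y) = (\<Oplus>\<alpha>\<in>?A. c \<alpha> \<odot> (f \<alpha> \<oplus> k \<alpha>))"
    by (rule degree_action_eq[OF _ fk fin]) (use x y in auto)
  also have "\<dots> = (\<Oplus>\<alpha>\<in>?A. c \<alpha> \<odot> f \<alpha> \<oplus> c \<alpha> \<odot> k \<alpha>)"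
    using c by (intro M.finsum_cong') (auto simp: csmult_rules)
  also have "\<dots> = (\<Oplus>\<alpha>\<in>?A. c \<alpha> \<odot> f \<alpha>) \<oplus> (\<Oplus>\<alpha>\<in>?A. c \<alpha> \<odot> k \<alpha>)"
    using c by (intro M.finsum_addf) auto
  also have "(\<Oplus>\<alpha>\<in>?A. c \<alpha> \<odot> f \<alpha>) = degree_action L g c x"
    by (rule degree_action_eq[OF x f fin, symmetric]) auto
  also have "(\<Oplus>\<alpha>\<in>?A. c \<alpha> \<odot> k \<alpha>) = degree_action L g c y"
    by (rule degree_action_eq[OF y k fin, symmetric]) auto
  finally show ?thesis .
qed

lemma degree_action_smult:
  assumes x: "x \<in> carrier L"
  shows "degree_action L g c (a \<odot> x) = a \<odot> degree_action L g c x"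
proof -
  obtain f where f: "homogeneous_decomposition L g x f" using decomposition[OF x] by auto
  have af: "homogeneous_decomposition L g (a \<odot> x) (\<lambda>\<alpha>. a \<odot> f \<alpha>)"
    by (rule homogeneous_decomposition_smult[OF complex_module_axioms _ f]) (simp add: graded_piece)
  have c: "f \<alpha> \<in> carrier L" for \<alpha>
    using f graded_piece_carrier by (auto simp: homogeneous_decomposition_def)
  let ?A = "{\<alpha>. f \<alpha> \<noteq> \<zero>}"
  have fin: "finite ?A" using f by (auto simp: homogeneous_decomposition_def)
  have "degree_action L g c (a \<odot> x) = (\<Oplus>\<alpha>\<in>?A. c \<alpha> \<odot> (a \<odot> f \<alpha>))"
    by (rule degree_action_eq[OF _ af fin]) (use x in auto)
  also have "\<dots> = (\<Oplus>\<alpha>\<in>?A. a \<odot> (c \<alpha> \<odot> f \<alpha>))"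
    using c by (intro M.finsum_cong') (auto simp: csmult_rules mult.commute)
  also have "\<dots> = a \<odot> (\<Oplus>\<alpha>\<in>?A. c \<alpha> \<odot> f \<alpha>)"
    using c fin by (intro finsum_csmult[symmetric]) auto
  also have "(\<Oplus>\<alpha>\<in>?A. c \<alpha> \<odot> f \<alpha>) = degree_action L g c x"
    by (rule degree_action_eq[OF x f fin, symmetric]) auto
  finally show ?thesis .
qed

lemma degree_action_weight_add:
  assumes x: "x \<in> carrier L"
  shows "degree_action L g (\<lambda>\<alpha>. c \<alpha> + d \<alpha>) x = degree_action L g c x \<oplus> degree_action L g d x"
proof -
  obtain f where f: "homogeneous_decomposition L g x f" using decomposition[OF x] by auto
  have c: "f \<alpha> \<in> carrier L" for \<alpha>
    using f graded_piece_carrier by (auto simp: homogeneous_decomposition_def)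
  have fin: "finite {\<alpha>. f \<alpha> \<noteq> \<zero>}" using f by (auto simp: homogeneous_decomposition_def)
  have "(\<Oplus>\<alpha>\<in>{\<alpha>. f \<alpha> \<noteq> \<zero>}. (c \<alpha> + d \<alpha>) \<odot> f \<alpha>) = (\<Oplus>\<alpha>\<in>{\<alpha>. f \<alpha> \<noteq> \<zero>}. c \<alpha> \<odot> f \<alpha> \<oplus> d \<alpha> \<odot> f \<alpha>)"
    using c by (intro M.finsum_cong') (auto simp: csmult_rules)
  also have "\<dots> = (\<Oplus>\<alpha>\<in>{\<alpha>. f \<alpha> \<noteq> \<zero>}. c \<alpha> \<odot> f \<alpha>) \<oplus> (\<Oplus>\<alpha>\<in>{\<alpha>. f \<alpha> \<noteq> \<zero>}. d \<alpha> \<odot> f \<alpha>)"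
    using c by (intro M.finsum_addf) auto
  finally show ?thesis by (simp add: degree_action_eq[OF x f fin subset_refl])
qed

lemma degree_action_weight_smult:
  assumes x: "x \<in> carrier L"
  shows "degree_action L g (\<lambda>\<alpha>. a * c \<alpha>) x = a \<odot> degree_action L g c x"
proof -
  obtain f where f: "homogeneous_decomposition L g x f" using decomposition[OF x] by auto
  have c: "f \<alpha> \<in> carrier L" for \<alpha>
    using f graded_piece_carrier by (auto simp: homogeneous_decomposition_def)
  have fin: "finite {\<alpha>. f \<alpha> \<noteq> \<zero>}" using f by (auto simp: homogeneous_decomposition_def)
  have "(\<Oplus>\<alpha>\<in>{\<alpha>. f \<alpha> \<noteq> \<zero>}. (a * c \<alpha>) \<odot> f \<alpha>) = (\<Oplus>\<alpha>\<in>{\<alpha>. f \<alpha> \<noteq> \<zero>}. a \<odot> (c \<alpha> \<odot> f \<alpha>))"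
    using c by (intro M.finsum_cong') (auto simp: csmult_rules)
  also have "\<dots> = a \<odot> (\<Oplus>\<alpha>\<in>{\<alpha>. f \<alpha> \<noteq> \<zero>}. c \<alpha> \<odot> f \<alpha>)"
    using c fin by (intro finsum_csmult[symmetric]) auto
  finally show ?thesis by (simp add: degree_action_eq[OF x f fin subset_refl])
qed

lemma degree_action_homogeneous:
  assumes "x \<in> g \<alpha>"
  shows "degree_action L g c x = c \<alpha> \<odot> x"
proof -
  have x: "x \<in> carrier L" using assms graded_piece_carrier by auto
  have f: "homogeneous_decomposition L g x (\<lambda>\<beta>. if \<beta> = \<alpha> then x else \<zero>)"
    using homogeneous_decomposition_homogeneous[OF complex_module_axioms, of g x \<alpha>] assms graded_piece
    by simp
  have "degree_action L g c x = (\<Oplus>\<beta>\<in>{\<alpha>}. c \<beta> \<odot> (if \<beta> = \<alpha> then x else \<zero>))"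
    by (rule degree_action_eq[OF x f]) auto
  also have "\<dots> = c \<alpha> \<odot> x" using x by (simp add: M.r_zero)
  finally show ?thesis .
qed

end

section \<open>The free nonassociative algebra and the free Lie algebra\<close>

lemma lookup_map_scale [simp]:
  "Poly_Mapping.lookup (Poly_Mapping.map ((*) (c::complex)) x) k = c * Poly_Mapping.lookup x k"
  by (simp add: Poly_Mapping.map.rep_eq when_def)

lemma poly_mapping_sum_induct [case_names zero single add]:
  assumes "P 0" "\<And>k c. P (Poly_Mapping.single k c)" "\<And>x y. P x \<Longrightarrow> P y \<Longrightarrow> P (x + y)"
  shows "P (x :: 'a \<Rightarrow>\<^sub>0 'b::comm_monoid_add)"
proof (induction x rule: update_induct)
  case const
  show ?case by (rule assms(1))
next
  case (update f a b)
  have "Poly_Mapping.update a b f = f + Poly_Mapping.single a b"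
    using update.hyps by (intro poly_mapping_eqI)
      (auto simp: lookup_update lookup_add lookup_single in_keys_iff when_def)
  then show ?case using assms update.IH by simp
qed

lemma sum_keys_superset:
  assumes "finite S" "Poly_Mapping.keys x \<subseteq> S" "\<And>k. f k 0 = 0"
  shows "(\<Sum>k\<in>Poly_Mapping.keys x. f k (Poly_Mapping.lookup x k)) =
    (\<Sum>k\<in>S. f k (Poly_Mapping.lookup x k))"
  using assms by (intro sum.mono_neutral_left) (auto simp: in_keys_iff)

lemma keys_map_scale: "Poly_Mapping.keys (Poly_Mapping.map ((*) (c::complex)) x) \<subseteq> Poly_Mapping.keys x"
  by (auto simp: in_keys_iff)

lemma free_alg_simps [simp]:
  "carrier free_alg = UNIV" "\<zero>\<^bsub>free_alg\<^esub> = 0" "x \<oplus>\<^bsub>free_alg\<^esub> y = x + y"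
  "c \<odot>\<^bsub>free_alg\<^esub> x = Poly_Mapping.map ((*) c) x"
  by (simp_all add: free_alg_def)

lemma map_scale_single [simp]:
  "Poly_Mapping.map ((*) c) (Poly_Mapping.single k (a::complex)) = Poly_Mapping.single k (c * a)"
  by (intro poly_mapping_eqI) (simp add: lookup_single when_def)

lemma free_alg_mult_single [simp]:
  "Poly_Mapping.single s a \<otimes>\<^bsub>free_alg\<^esub> Poly_Mapping.single t b = Poly_Mapping.single (Br s t) (a * b)"
  by (simp add: free_alg_def)

lemma free_alg_bilinear_algebra: "bilinear_algebra free_alg"
proof (rule bilinear_algebraI)
  show "complex_module free_alg"
    by (rule complex_moduleI) (auto intro!: poly_mapping_eqI simp: lookup_add algebra_simps)
  fix x y z :: "'a bracketing \<Rightarrow>\<^sub>0 complex" and c :: complex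
  let ?f = "\<lambda>s c. \<Sum>t\<in>Poly_Mapping.keys z. Poly_Mapping.single (Br s t) (c * Poly_Mapping.lookup z t)"
  have m: "x \<otimes>\<^bsub>free_alg\<^esub> y = (\<Sum>s\<in>Poly_Mapping.keys x. \<Sum>t\<in>Poly_Mapping.keys y.
       Poly_Mapping.single (Br s t) (Poly_Mapping.lookup x s * Poly_Mapping.lookup y t))"
    for x y :: "'a bracketing \<Rightarrow>\<^sub>0 complex"
    by (simp add: free_alg_def)
  have f: "?f s (a + b) = ?f s a + ?f s b" for s a b
    by (simp add: sum.distrib[symmetric] single_add[symmetric] distrib_right)
  show "(x \<oplus>\<^bsub>free_alg\<^esub> y) \<otimes>\<^bsub>free_alg\<^esub> z = x \<otimes>\<^bsub>free_alg\<^esub> z \<oplus>\<^bsub>free_alg\<^esub> y \<otimes>\<^bsub>free_alg\<^esub> z"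
    unfolding m free_alg_simps by (rule setsum_keys_plus_distrib[of ?f]) (simp_all add: f)
  show "x \<otimes>\<^bsub>free_alg\<^esub> (y \<oplus>\<^bsub>free_alg\<^esub> z) = x \<otimes>\<^bsub>free_alg\<^esub> y \<oplus>\<^bsub>free_alg\<^esub> x \<otimes>\<^bsub>free_alg\<^esub> z"
    unfolding m free_alg_simps sum.distrib[symmetric]
    by (intro sum.cong refl
        setsum_keys_plus_distrib[of "\<lambda>t c. Poly_Mapping.single (Br _ t) (Poly_Mapping.lookup x _ * c)"])
      (simp_all add: single_add[symmetric] distrib_left)
  have scale_sum: "Poly_Mapping.map ((*) c) (sum h A) = (\<Sum>a\<in>A. Poly_Mapping.map ((*) c) (h a))"
    for h :: "'d \<Rightarrow> 'a bracketing \<Rightarrow>\<^sub>0 complex" and A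
    by (intro poly_mapping_eqI) (simp add: lookup_sum sum_distrib_left)
  have sup1: "(\<Sum>s\<in>Poly_Mapping.keys (Poly_Mapping.map ((*) c) x). ?f s (Poly_Mapping.lookup (Poly_Mapping.map ((*) c) x) s))
     = (\<Sum>s\<in>Poly_Mapping.keys x. ?f s (Poly_Mapping.lookup (Poly_Mapping.map ((*) c) x) s))" for x :: "'a bracketing \<Rightarrow>\<^sub>0 complex"
    by (rule sum_keys_superset) (simp_all add: keys_map_scale)
  show "(c \<odot>\<^bsub>free_alg\<^esub> x) \<otimes>\<^bsub>free_alg\<^esub> z = c \<odot>\<^bsub>free_alg\<^esub> (x \<otimes>\<^bsub>free_alg\<^esub> z)"
    unfolding m free_alg_simps sup1 by (simp add: scale_sum mult.assoc)
  have sup2: "(\<Sum>t\<in>Poly_Mapping.keys (Poly_Mapping.map ((*) c) x). Poly_Mapping.single (Br s t) (a * Poly_Mapping.lookup (Poly_Mapping.map ((*) c) x) t))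
     = (\<Sum>t\<in>Poly_Mapping.keys x. Poly_Mapping.single (Br s t) (a * Poly_Mapping.lookup (Poly_Mapping.map ((*) c) x) t))"
    for x :: "'a bracketing \<Rightarrow>\<^sub>0 complex" and s a
    by (rule sum_keys_superset[of _ _ "\<lambda>t b. Poly_Mapping.single (Br s t) (a * b)"]) (simp_all add: keys_map_scale)
  show "z \<otimes>\<^bsub>free_alg\<^esub> (c \<odot>\<^bsub>free_alg\<^esub> x) = c \<odot>\<^bsub>free_alg\<^esub> (z \<otimes>\<^bsub>free_alg\<^esub> x)"
    unfolding m free_alg_simps sup2 by (simp add: scale_sum mult.left_commute)
qed simp

text \<open>The homomorphism from the free nonassociative algebra that has the values \<open>v\<close> on the generators.\<close>

definition free_eval :: "(complex, 'a) module \<Rightarrow> ('g \<Rightarrow> 'a) \<Rightarrow> ('g bracketing \<Rightarrow>\<^sub>0 complex) \<Rightarrow> 'a" where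
  "free_eval M v x = (\<Oplus>\<^bsub>M\<^esub>s\<in>Poly_Mapping.keys x. Poly_Mapping.lookup x s \<odot>\<^bsub>M\<^esub> monomial_value M v s)"

lemma monomial_value_closed:
  assumes "bilinear_algebra M" "range v \<subseteq> carrier M"
  shows "monomial_value M v s \<in> carrier M"
proof -
  interpret bilinear_algebra M by fact
  show ?thesis using assms(2) by (induction s) auto
qed

lemma free_eval_superset:
  assumes "bilinear_algebra M" "range v \<subseteq> carrier M" "finite S" "Poly_Mapping.keys x \<subseteq> S"
  shows "free_eval M v x = (\<Oplus>\<^bsub>M\<^esub>s\<in>S. Poly_Mapping.lookup x s \<odot>\<^bsub>M\<^esub> monomial_value M v s)"
proof -
  interpret bilinear_algebra M by fact
  show ?thesis unfolding free_eval_def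
    using assms(3,4) monomial_value_closed[OF assms(1,2)]
    by (intro M.add.finprod_mono_neutral_cong_left) (auto simp: in_keys_iff)
qed

lemma free_eval_single:
  assumes "bilinear_algebra M" "range v \<subseteq> carrier M"
  shows "free_eval M v (Poly_Mapping.single s a) = a \<odot>\<^bsub>M\<^esub> monomial_value M v s"
proof -
  interpret bilinear_algebra M by fact
  show ?thesis using monomial_value_closed[OF assms]
    by (simp add: free_eval_superset[OF assms, of "{s}"])
qed

lemma free_eval_hom:
  assumes M: "bilinear_algebra M" "range v \<subseteq> carrier M"
  shows "alg_hom free_alg M (free_eval M v)"
proof -
  interpret bilinear_algebra M by fact
  interpret F: bilinear_algebra "free_alg :: (complex, 'b bracketing \<Rightarrow>\<^sub>0 complex) module"
    by (rule free_alg_bilinear_algebra)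
  note mc = monomial_value_closed[OF M] note sup = free_eval_superset[OF M]
  have cl: "free_eval M v x \<in> carrier M" for x
    unfolding free_eval_def using mc by (intro M.finsum_closed) auto
  have add: "free_eval M v (x + y) = free_eval M v x \<oplus>\<^bsub>M\<^esub> free_eval M v y" for x y
  proof -
    let ?S = "Poly_Mapping.keys x \<union> Poly_Mapping.keys y"
    have "free_eval M v (x + y) = (\<Oplus>\<^bsub>M\<^esub>s\<in>?S. Poly_Mapping.lookup (x + y) s \<odot>\<^bsub>M\<^esub> monomial_value M v s)"
      by (rule sup) (simp_all add: keys_add)
    also have "\<dots> = (\<Oplus>\<^bsub>M\<^esub>s\<in>?S. Poly_Mapping.lookup x s \<odot>\<^bsub>M\<^esub> monomial_value M v s \<oplus>\<^bsub>M\<^esub>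
        Poly_Mapping.lookup y s \<odot>\<^bsub>M\<^esub> monomial_value M v s)"
      using mc by (intro M.finsum_cong') (auto simp: lookup_add csmult_rules)
    also have "\<dots> = (\<Oplus>\<^bsub>M\<^esub>s\<in>?S. Poly_Mapping.lookup x s \<odot>\<^bsub>M\<^esub> monomial_value M v s) \<oplus>\<^bsub>M\<^esub>
        (\<Oplus>\<^bsub>M\<^esub>s\<in>?S. Poly_Mapping.lookup y s \<odot>\<^bsub>M\<^esub> monomial_value M v s)"
      using mc by (intro M.finsum_addf) auto
    finally show ?thesis by (simp add: sup[of ?S x] sup[of ?S y])
  qed
  have smult: "free_eval M v (Poly_Mapping.map ((*) c) x) = c \<odot>\<^bsub>M\<^esub> free_eval M v x" for c x
  proof -
    have "free_eval M v (Poly_Mapping.map ((*) c) x) =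
        (\<Oplus>\<^bsub>M\<^esub>s\<in>Poly_Mapping.keys x. (c * Poly_Mapping.lookup x s) \<odot>\<^bsub>M\<^esub> monomial_value M v s)"
      by (subst sup[OF _ keys_map_scale]) simp_all
    also have "\<dots> = (\<Oplus>\<^bsub>M\<^esub>s\<in>Poly_Mapping.keys x. c \<odot>\<^bsub>M\<^esub> (Poly_Mapping.lookup x s \<odot>\<^bsub>M\<^esub> monomial_value M v s))"
      using mc by (intro M.finsum_cong') (auto simp: csmult_rules)
    also have "\<dots> = c \<odot>\<^bsub>M\<^esub> free_eval M v x"
      unfolding free_eval_def using mc by (intro finsum_csmult[symmetric]) auto
    finally show ?thesis .
  qed
  have zero: "free_eval M v 0 = \<zero>\<^bsub>M\<^esub>" by (simp add: free_eval_def)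
  have mult: "free_eval M v (x \<otimes>\<^bsub>free_alg\<^esub> y) = free_eval M v x \<otimes>\<^bsub>M\<^esub> free_eval M v y" for x y
  proof (induction x rule: poly_mapping_sum_induct)
    case zero
    show ?case using F.prod_zero_left[of y] cl by (simp add: \<open>free_eval M v 0 = \<zero>\<^bsub>M\<^esub>\<close>)
  next
    case (add x1 x2)
    then show ?case using F.prod_add_left[of x1 x2 y] cl
      by (simp add: \<open>\<And>x y. free_eval M v (x + y) = free_eval M v x \<oplus>\<^bsub>M\<^esub> free_eval M v y\<close> prod_add_left)
  next
    case (single s a)
    show ?case
    proof (induction y rule: poly_mapping_sum_induct)
      case zero
      show ?case using F.prod_zero_right[of "Poly_Mapping.single s a"] cl
        by (simp add: \<open>free_eval M v 0 = \<zero>\<^bsub>M\<^esub>\<close>)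
    next
      case (add y1 y2)
      then show ?case using F.prod_add_right[of "Poly_Mapping.single s a" y1 y2] cl
        by (simp add: \<open>\<And>x y. free_eval M v (x + y) = free_eval M v x \<oplus>\<^bsub>M\<^esub> free_eval M v y\<close> prod_add_right)
    next
      case (single t b)
      show ?case using mc by (simp add: free_eval_single[OF M] prod_smult_left prod_smult_right csmult_rules mult.commute)
    qed
  qed
  show ?thesis unfolding alg_hom_def linear_map_def by (simp add: cl add smult mult)
qed

lemma quotient_lie_algebra:
  assumes "bilinear_algebra L" "alg_ideal L J" "\<forall>x\<in>carrier L. x \<otimes>\<^bsub>L\<^esub> x \<in> J"
    "\<forall>x\<in>carrier L. \<forall>y\<in>carrier L. \<forall>z\<in>carrier L.
      (x \<otimes>\<^bsub>L\<^esub> (y \<otimes>\<^bsub>L\<^esub> z)) \<oplus>\<^bsub>L\<^esub> (y \<otimes>\<^bsub>L\<^esub> (z \<otimes>\<^bsub>L\<^esub> x)) \<oplus>\<^bsub>L\<^esub> (z \<otimes>\<^bsub>L\<^esub> (x \<otimes>\<^bsub>L\<^esub> y)) \<in> J"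
  shows "lie_algebra (alg_quotient L J)"
proof -
  interpret L: bilinear_algebra L by fact
  note q = L.quotient_operations[OF assms(2)] note z = L.quotient_eq_zero_iff[OF assms(2)]
  show ?thesis
    by (rule lie_algebraI[OF L.quotient_bilinear_algebra[OF assms(2)]];
        unfold L.quotient_carrier; (elim imageE, hypsubst)+)
      (use assms(3,4) in \<open>simp_all add: q z\<close>)
qed

lemma quotient_lie_algebra_of_lie:
  assumes "lie_algebra L" "alg_ideal L J"
  shows "lie_algebra (alg_quotient L J)"
proof -
  interpret L: lie_algebra L by fact
  interpret L: bilinear_algebra L by (rule lie_algebra_bilinear) (rule L.lie_algebra_axioms)
  show ?thesis
    by (rule quotient_lie_algebra[OF L.bilinear_algebra_axioms assms(2)])
      (auto simp: L.bracket_alternating L.jacobi L.alg_idealD[OF assms(2)])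
qed

lemma lie_identities_ideal: "alg_ideal free_alg lie_identities"
  unfolding lie_identities_def
  by (rule bilinear_algebra.hull_alg_ideal[OF free_alg_bilinear_algebra]) simp

lemma free_lie_lie_algebra: "lie_algebra free_lie"
  unfolding free_lie_def
proof (rule quotient_lie_algebra[OF free_alg_bilinear_algebra lie_identities_ideal])
  show "\<forall>x\<in>carrier free_alg. x \<otimes>\<^bsub>free_alg\<^esub> x \<in> lie_identities"
    unfolding lie_identities_def by (auto intro: hull_inc)
  show "\<forall>x\<in>carrier free_alg. \<forall>y\<in>carrier free_alg. \<forall>z\<in>carrier free_alg.
      (x \<otimes>\<^bsub>free_alg\<^esub> (y \<otimes>\<^bsub>free_alg\<^esub> z)) \<oplus>\<^bsub>free_alg\<^esub> (y \<otimes>\<^bsub>free_alg\<^esub> (z \<otimes>\<^bsub>free_alg\<^esub> x))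
        \<oplus>\<^bsub>free_alg\<^esub> (z \<otimes>\<^bsub>free_alg\<^esub> (x \<otimes>\<^bsub>free_alg\<^esub> y)) \<in> lie_identities"
    unfolding lie_identities_def by (intro ballI hull_inc) blast
qed

lemma free_lie_gen_closed [simp]: "free_lie_gen g \<in> carrier free_lie"
  by (simp add: free_lie_gen_def free_lie_def
      bilinear_algebra.quotient_carrier[OF free_alg_bilinear_algebra])

text \<open>The elements that evaluate to zero in a Lie algebra form an ideal, and this ideal contains the
  alternating and Jacobi expressions by which the free Lie algebra is defined.\<close>

lemma free_lie_universal:
  assumes M: "lie_algebra M" and v: "range v \<subseteq> carrier M"
  obtains f where "alg_hom free_lie M f" "\<And>g. f (free_lie_gen g) = v g"
proof -
  interpret M: lie_algebra M by fact
  interpret M: bilinear_algebra M by (rule lie_algebra_bilinear) (rule M.lie_algebra_axioms)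
  note hom = free_eval_hom[OF M.bilinear_algebra_axioms v] note h = alg_homD[OF hom]
  let ?K = "{x \<in> carrier free_alg. free_eval M v x = \<zero>\<^bsub>M\<^esub>}"
  have "alg_ideal free_alg ?K"
    by (rule kernel_alg_ideal[OF free_alg_bilinear_algebra M.bilinear_algebra_axioms hom])
  moreover have "free_eval M v x \<in> carrier M" for x using h(1) by simp
  ultimately have "lie_identities \<subseteq> ?K"
    unfolding lie_identities_def
    by (intro hull_minimal) (auto simp: h[simplified] M.bracket_alternating M.jacobi)
  then obtain f where f: "alg_hom free_lie M f" "\<forall>x\<in>carrier free_alg. f (lie_identities +>\<^bsub>free_alg\<^esub> x) = free_eval M v x"
    unfolding free_lie_def
    using hom_factors_through_quotient[OF free_alg_bilinear_algebra M.bilinear_algebra_axioms hom lie_identities_ideal]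
    by blast
  have vg: "v g \<in> carrier M" for g using v by auto
  have "f (free_lie_gen g) = v g" for g
    using f(2) vg by (auto simp: free_lie_gen_def free_eval_single[OF M.bilinear_algebra_axioms v])
  with f(1) that show ?thesis by blast
qed

section \<open>The algebra given by generators and relations\<close>

definition root_gen :: "int \<Rightarrow> 'n \<Rightarrow> 'n generator" where
  "root_gen \<epsilon> i = (if \<epsilon> = 1 then Fplus i else Fminus i)"

lemma F_f_eq: "F_f \<epsilon> i = free_lie_gen (root_gen \<epsilon> i)"
  by (simp add: F_f_def root_gen_def)

text \<open>A choice \<open>v\<close> of values for the generators satisfies the defining relations of \<open>G\<close> in the algebra \<open>M\<close>.
  Stating this for arbitrary \<open>M\<close> allows one universal property to serve twice: for the map to \<open>E\<close> and for
  the automorphisms of \<open>G\<close> that rescale the generators.\<close>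

definition relations_hold ::
    "(int ^ 'n::finite \<Rightarrow> int) \<Rightarrow> (complex, 'a) module \<Rightarrow> ('n generator \<Rightarrow> 'a) \<Rightarrow> bool" where
  "relations_hold q M v \<longleftrightarrow> range v \<subseteq> carrier M \<and>
    (\<forall>i j. v (Hgen i) \<otimes>\<^bsub>M\<^esub> v (Hgen j) = \<zero>\<^bsub>M\<^esub>) \<and>
    (\<forall>i j. \<forall>\<epsilon>\<in>{1, -1}. v (Hgen i) \<otimes>\<^bsub>M\<^esub> v (root_gen \<epsilon> j) =
      of_int (\<epsilon> * form_matrix q i j) \<odot>\<^bsub>M\<^esub> v (root_gen \<epsilon> j)) \<and>
    (\<forall>i. v (Fplus i) \<otimes>\<^bsub>M\<^esub> v (Fminus i) = v (Hgen i)) \<and>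
    (\<forall>ws. ws \<noteq> [] \<and> (\<forall>(\<epsilon>, i)\<in>set ws. \<epsilon> \<in> {1, -1}) \<and> (\<Sum>(\<epsilon>, i)\<leftarrow>ws. \<epsilon> *s basis_vec i) \<notin> roots q \<longrightarrow>
      nested_bracket M (map (\<lambda>(\<epsilon>, i). v (root_gen \<epsilon> i)) ws) = \<zero>\<^bsub>M\<^esub>)"

lemma nested_bracket_closed:
  assumes "bilinear_algebra M" "set xs \<subseteq> carrier M"
  shows "nested_bracket M xs \<in> carrier M"
proof -
  interpret bilinear_algebra M by fact
  show ?thesis using assms(2) by (induction xs rule: induct_list012) auto
qed

lemma nested_bracket_hom:
  assumes "bilinear_algebra L" "bilinear_algebra M" "alg_hom L M f" "set xs \<subseteq> carrier L"
  shows "f (nested_bracket L xs) = nested_bracket M (map f xs)"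
proof -
  interpret L: bilinear_algebra L by fact
  interpret M: bilinear_algebra M by fact
  note h = alg_homD[OF assms(3)]
  have "f \<zero>\<^bsub>L\<^esub> = \<zero>\<^bsub>M\<^esub>"
    by (rule linear_map_zero[OF L.complex_module_axioms M.complex_module_axioms h(5)])
  then show ?thesis using assms(4)
  proof (induction xs rule: induct_list012)
    case (3 x y xs)
    then show ?case using nested_bracket_closed[OF assms(1), of "y # xs"] by (simp add: h)
  qed simp_all
qed

text \<open>Rescaling the entries rescales the nested bracket, so a relation that says that it vanishes is
  preserved; the value of the scalar is irrelevant.\<close>

lemma nested_bracket_scale:
  assumes "bilinear_algebra M" "\<And>w. x w \<in> carrier M"
  shows "\<exists>c. nested_bracket M (map (\<lambda>w. a w \<odot>\<^bsub>M\<^esub> x w) ws) = c \<odot>\<^bsub>M\<^esub> nested_bracket M (map x ws)"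
proof -
  interpret bilinear_algebra M by fact
  show ?thesis
  proof (induction ws)
    case Nil
    show ?case by simp
  next
    case (Cons w ws)
    show ?case
    proof (cases ws)
      case Nil
      then show ?thesis by auto
    next
      case (Cons w' ws')
      obtain c where c: "nested_bracket M (map (\<lambda>w. a w \<odot>\<^bsub>M\<^esub> x w) ws) = c \<odot>\<^bsub>M\<^esub> nested_bracket M (map x ws)"
        using Cons.IH by auto
      have cl: "nested_bracket M (map x ws) \<in> carrier M"
        using assms(2) by (intro nested_bracket_closed[OF assms(1)]) auto
      have step: "nested_bracket M (map y (w # ws)) = y w \<otimes>\<^bsub>M\<^esub> nested_bracket M (map y ws)" for y
        by (simp add: Cons)
      have "nested_bracket M (map (\<lambda>w. a w \<odot>\<^bsub>M\<^esub> x w) (w # ws)) =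
          (a w * c) \<odot>\<^bsub>M\<^esub> nested_bracket M (map x (w # ws))"
        unfolding step c using assms(2)[of w] cl
        by (simp add: prod_smult_left prod_smult_right csmult_rules mult.commute)
      then show ?thesis by blast
    qed
  qed
qed

lemma free_lie_bilinear_algebra: "bilinear_algebra free_lie"
  by (rule lie_algebra_bilinear[OF free_lie_lie_algebra])

lemma G_relations_closed: 
  fixes q :: "int ^ 'n::finite \<Rightarrow> int"
  shows "G_relations q \<subseteq> carrier free_lie"
proof -
  interpret bilinear_algebra "free_lie :: (complex, 'n free_elt) module" by (rule free_lie_bilinear_algebra)
  show ?thesis unfolding G_relations_def F_f_eq
    by (auto simp: diff_eq_smult intro!: nested_bracket_closed[OF free_lie_bilinear_algebra])
qed

lemma G_ideal_ideal: "alg_ideal free_lie (G_ideal q)"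
  unfolding G_ideal_def
  by (rule bilinear_algebra.hull_alg_ideal[OF free_lie_bilinear_algebra G_relations_closed])

lemma G_lie_algebra: "lie_algebra (G_alg q)"
  unfolding G_alg_def by (rule quotient_lie_algebra_of_lie[OF free_lie_lie_algebra G_ideal_ideal])

lemma G_bilinear_algebra: "bilinear_algebra (G_alg q)"
  by (rule lie_algebra_bilinear[OF G_lie_algebra])

lemma G_projection: "alg_hom free_lie (G_alg q) (\<lambda>x. G_ideal q +>\<^bsub>free_lie\<^esub> x)"
  unfolding G_alg_def by (rule bilinear_algebra.quotient_hom[OF free_lie_bilinear_algebra G_ideal_ideal])

lemma G_gen_closed [simp]: "G_gen q g \<in> carrier (G_alg q)"
  unfolding G_gen_def by (rule alg_homD(1)[OF G_projection]) simp

lemma G_relations_hold: 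
  fixes q :: "int ^ 'n::finite \<Rightarrow> int"
  shows "relations_hold q (G_alg q) (G_gen q)"
proof -
  interpret F: bilinear_algebra "free_lie :: (complex, 'n free_elt) module" by (rule free_lie_bilinear_algebra)
  interpret G: bilinear_algebra "G_alg q" by (rule G_bilinear_algebra)
  let ?p = "\<lambda>x. G_ideal q +>\<^bsub>free_lie\<^esub> x"
  note h = alg_homD[OF G_projection[of q]]
  have rel: "?p x = \<zero>\<^bsub>G_alg q\<^esub>" if "x \<in> G_relations q" for x
  proof -
    have "x \<in> G_ideal q" using that unfolding G_ideal_def by (rule hull_inc)
    then show ?thesis
      using F.quotient_eq_zero_iff[OF G_ideal_ideal, of x] F.alg_idealD(7)[OF G_ideal_ideal]
      by (simp add: G_alg_def)
  qed
  have eq: "?p x = ?p y" if "x \<ominus>\<^bsub>free_lie\<^esub> y \<in> G_relations q" "x \<in> carrier free_lie" "y \<in> carrier free_lie" for x y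
    using rel[OF that(1)] that(2,3) h(1)
      linear_map_minus[OF F.complex_module_axioms G.complex_module_axioms h(5) that(2,3)] by simp
  note gen = G_gen_def[of q]
  show ?thesis unfolding relations_hold_def
  proof (intro conjI allI ballI impI)
    show "range (G_gen q) \<subseteq> carrier (G_alg q)" by auto
    show "G_gen q (Hgen i) \<otimes>\<^bsub>G_alg q\<^esub> G_gen q (Hgen j) = \<zero>\<^bsub>G_alg q\<^esub>" for i j
    proof -
      have "?p (F_h i \<otimes>\<^bsub>free_lie\<^esub> F_h j) = \<zero>\<^bsub>G_alg q\<^esub>" by (rule rel) (auto simp: G_relations_def)
      then show ?thesis by (simp add: gen h)
    qed
    show "G_gen q (Hgen i) \<otimes>\<^bsub>G_alg q\<^esub> G_gen q (root_gen \<epsilon> j) =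
        of_int (\<epsilon> * form_matrix q i j) \<odot>\<^bsub>G_alg q\<^esub> G_gen q (root_gen \<epsilon> j)" if "\<epsilon> \<in> {1, -1}" for i j \<epsilon>
    proof -
      have "?p (F_h i \<otimes>\<^bsub>free_lie\<^esub> F_f \<epsilon> j) = ?p (of_int (\<epsilon> * form_matrix q i j) \<odot>\<^bsub>free_lie\<^esub> F_f \<epsilon> j)"
      proof (rule eq)
        show "F_h i \<otimes>\<^bsub>free_lie\<^esub> F_f \<epsilon> j \<ominus>\<^bsub>free_lie\<^esub> of_int (\<epsilon> * form_matrix q i j) \<odot>\<^bsub>free_lie\<^esub> F_f \<epsilon> j
            \<in> G_relations q"
          unfolding G_relations_def using that by blast
      qed (simp_all add: F_f_eq)
      then show ?thesis by (simp add: gen h F_f_eq)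
    qed
    show "G_gen q (Fplus i) \<otimes>\<^bsub>G_alg q\<^esub> G_gen q (Fminus i) = G_gen q (Hgen i)" for i
    proof -
      have "?p (F_f 1 i \<otimes>\<^bsub>free_lie\<^esub> F_f (-1) i) = ?p (F_h i)"
        by (rule eq) (auto simp: G_relations_def F_f_eq)
      then show ?thesis by (simp add: gen h F_f_eq root_gen_def)
    qed
    fix ws :: "(int \<times> 'n) list"
    assume ws: "ws \<noteq> [] \<and> (\<forall>(\<epsilon>, i)\<in>set ws. \<epsilon> \<in> {1, -1}) \<and> (\<Sum>(\<epsilon>, i)\<leftarrow>ws. \<epsilon> *s basis_vec i) \<notin> roots q"
    have A: "?p (nested_bracket free_lie (map (\<lambda>(\<epsilon>, i). F_f \<epsilon> i) ws)) = \<zero>\<^bsub>G_alg q\<^esub>"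
      by (rule rel) (use ws in \<open>unfold G_relations_def, blast\<close>)
    have B: "?p (nested_bracket free_lie (map (\<lambda>(\<epsilon>, i). F_f \<epsilon> i) ws)) =
        nested_bracket (G_alg q) (map ?p (map (\<lambda>(\<epsilon>, i). F_f \<epsilon> i) ws))"
      by (rule nested_bracket_hom[OF F.bilinear_algebra_axioms G.bilinear_algebra_axioms G_projection])
        (auto simp: F_f_eq)
    have C: "map ?p (map (\<lambda>(\<epsilon>, i). F_f \<epsilon> i) ws) = map (\<lambda>(\<epsilon>, i). G_gen q (root_gen \<epsilon> i)) ws"
      by (auto simp: F_f_eq gen)
    show "nested_bracket (G_alg q) (map (\<lambda>(\<epsilon>, i). G_gen q (root_gen \<epsilon> i)) ws) = \<zero>\<^bsub>G_alg q\<^esub>"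
      unfolding C[symmetric] B[symmetric] by (rule A)
  qed
qed

lemma G_universal:
  fixes q :: "int ^ 'n::finite \<Rightarrow> int"
  assumes M: "lie_algebra M" and rel: "relations_hold q M v"
  obtains f where "alg_hom (G_alg q) M f" "\<And>g. f (G_gen q g) = v g"
proof -
  interpret F: bilinear_algebra "free_lie :: (complex, 'n free_elt) module" by (rule free_lie_bilinear_algebra)
  interpret M: bilinear_algebra M by (rule lie_algebra_bilinear[OF M])
  have v: "range v \<subseteq> carrier M" using rel by (simp add: relations_hold_def)
  have vc: "v g \<in> carrier M" for g using v by auto
  obtain f where f: "alg_hom free_lie M f" "\<And>g. f (free_lie_gen g) = v g"
    using free_lie_universal[OF M v] by blast
  note h = alg_homD[OF f(1)]
  let ?K = "{x \<in> carrier free_lie. f x = \<zero>\<^bsub>M\<^esub>}"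
  have K: "alg_ideal free_lie ?K"
    by (rule kernel_alg_ideal[OF F.bilinear_algebra_axioms M.bilinear_algebra_axioms f(1)])
  have minus: "f (x \<ominus>\<^bsub>free_lie\<^esub> y) = f x \<ominus>\<^bsub>M\<^esub> f y" if "x \<in> carrier free_lie" "y \<in> carrier free_lie" for x y
    by (rule linear_map_minus[OF F.complex_module_axioms M.complex_module_axioms h(5) that])
  have nest: "f (nested_bracket free_lie (map (\<lambda>(\<epsilon>, i). F_f \<epsilon> i) ws)) =
      nested_bracket M (map (\<lambda>(\<epsilon>, i). v (root_gen \<epsilon> i)) ws)" for ws
  proof -
    have C: "map f (map (\<lambda>(\<epsilon>, i). F_f \<epsilon> i) ws) = map (\<lambda>(\<epsilon>, i). v (root_gen \<epsilon> i)) ws"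
      by (auto simp: F_f_eq f(2))
    have cl: "set (map (\<lambda>(\<epsilon>, i). F_f \<epsilon> i) ws) \<subseteq> carrier free_lie" by (auto simp: F_f_eq)
    show ?thesis
      unfolding nested_bracket_hom[OF F.bilinear_algebra_axioms M.bilinear_algebra_axioms f(1) cl] C ..
  qed
  have "f x = \<zero>\<^bsub>M\<^esub>" if "x \<in> G_relations q" for x
    using that unfolding G_relations_def
  proof (elim UnE)
    assume "x \<in> {nested_bracket free_lie (map (\<lambda>(\<epsilon>, i). F_f \<epsilon> i) ws)
      | ws. ws \<noteq> [] \<and> (\<forall>(\<epsilon>, i)\<in>set ws. \<epsilon> \<in> {1, -1}) \<and> (\<Sum>(\<epsilon>, i)\<leftarrow>ws. \<epsilon> *s basis_vec i) \<notin> roots q}"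
    then obtain ws where "x = nested_bracket free_lie (map (\<lambda>(\<epsilon>, i). F_f \<epsilon> i) ws)"
      "ws \<noteq> [] \<and> (\<forall>(\<epsilon>, i)\<in>set ws. \<epsilon> \<in> {1, -1}) \<and> (\<Sum>(\<epsilon>, i)\<leftarrow>ws. \<epsilon> *s basis_vec i) \<notin> roots q" by blast
    then show ?thesis using rel nest by (simp add: relations_hold_def)
  next
    assume "x \<in> {F_h i \<otimes>\<^bsub>free_lie\<^esub> F_h j | i j. True}"
    then show ?thesis using rel by (auto simp: h f(2) relations_hold_def)
  next
    assume "x \<in> {(F_f 1 i \<otimes>\<^bsub>free_lie\<^esub> F_f (-1) i) \<ominus>\<^bsub>free_lie\<^esub> F_h i | i. True}"
    then show ?thesis using rel vc
      by (auto simp: h f(2) F_f_eq root_gen_def minus relations_hold_def)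
  next
    assume "x \<in> {(F_h i \<otimes>\<^bsub>free_lie\<^esub> F_f \<epsilon> j) \<ominus>\<^bsub>free_lie\<^esub> (of_int (\<epsilon> * form_matrix q i j) \<odot>\<^bsub>free_lie\<^esub> F_f \<epsilon> j)
      | i j \<epsilon>. \<epsilon> \<in> {1, -1}}"
    then obtain i j \<epsilon> where "\<epsilon> \<in> {1, -1}"
      "x = (F_h i \<otimes>\<^bsub>free_lie\<^esub> F_f \<epsilon> j) \<ominus>\<^bsub>free_lie\<^esub> (of_int (\<epsilon> * form_matrix q i j) \<odot>\<^bsub>free_lie\<^esub> F_f \<epsilon> j)" by blast
    moreover have "v (Hgen i) \<otimes>\<^bsub>M\<^esub> v (root_gen \<epsilon> j) = of_int (\<epsilon> * form_matrix q i j) \<odot>\<^bsub>M\<^esub> v (root_gen \<epsilon> j)"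
      using rel \<open>\<epsilon> \<in> {1, -1}\<close> unfolding relations_hold_def by blast
    ultimately show ?thesis using vc by (simp add: h f(2) F_f_eq minus)
  qed
  then have "G_ideal q \<subseteq> ?K" unfolding G_ideal_def
    using G_relations_closed[of q] by (intro hull_minimal K) auto
  then obtain f' where f': "alg_hom (G_alg q) M f'" "\<forall>x\<in>carrier free_lie. f' (G_ideal q +>\<^bsub>free_lie\<^esub> x) = f x"
    unfolding G_alg_def
    using hom_factors_through_quotient[OF F.bilinear_algebra_axioms M.bilinear_algebra_axioms f(1) G_ideal_ideal] by blast
  have "f' (G_gen q g) = v g" for g by (simp add: G_gen_def f'(2) f(2))
  with f'(1) that show ?thesis by blast
qed

abbreviation G_monomial :: "(int ^ 'n::finite \<Rightarrow> int) \<Rightarrow> 'n generator bracketing \<Rightarrow> 'n free_elt set" where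
  "G_monomial q \<equiv> monomial_value (G_alg q) (G_gen q)"

lemma G_monomial_closed [simp]: "G_monomial q t \<in> carrier (G_alg q)"
  by (rule monomial_value_closed[OF G_bilinear_algebra]) auto

lemma G_spanned_by_monomials:
  fixes q :: "int ^ 'n::finite \<Rightarrow> int"
  assumes V: "submodule V complex_ring (G_alg q)" and mono: "\<And>t. G_monomial q t \<in> V"
  shows "carrier (G_alg q) \<subseteq> V"
proof
  interpret A: bilinear_algebra "free_alg :: (complex, 'n generator bracketing \<Rightarrow>\<^sub>0 complex) module"
    by (rule free_alg_bilinear_algebra)
  interpret F: bilinear_algebra "free_lie :: (complex, 'n free_elt) module" by (rule free_lie_bilinear_algebra)
  interpret G: bilinear_algebra "G_alg q" by (rule G_bilinear_algebra)
  note Vd = V[unfolded G.submodule_iff]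
  let ?p = "\<lambda>x. G_ideal q +>\<^bsub>free_lie\<^esub> (lie_identities +>\<^bsub>free_alg\<^esub> x)"
  have hom: "alg_hom free_alg (G_alg q) ?p"
    using alg_hom_compose[OF A.quotient_hom[OF lie_identities_ideal] G_projection[of q, unfolded free_lie_def]]
    by (simp add: free_lie_def)
  note h = alg_homD[OF hom, simplified]
  have gen_val: "?p (Poly_Mapping.single t 1) = G_monomial q t" for t
  proof (induction t)
    case (Gen g)
    show ?case by (simp add: G_gen_def free_lie_gen_def)
  next
    case (Br s t)
    then show ?case using h(4)[of "Poly_Mapping.single s 1" "Poly_Mapping.single t 1"] by simp
  qed
  have "?p x \<in> V" for x
  proof (induction x rule: poly_mapping_sum_induct)
    case zero
    show ?case using linear_map_zero[OF A.complex_module_axioms G.complex_module_axioms h(5)] Vd by simp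
  next
    case (single t c)
    have "Poly_Mapping.single t c = Poly_Mapping.map ((*) c) (Poly_Mapping.single t 1)" by simp
    then have "?p (Poly_Mapping.single t c) = ?p (Poly_Mapping.map ((*) c) (Poly_Mapping.single t 1))"
      by (rule arg_cong)
    also have "\<dots> = c \<odot>\<^bsub>G_alg q\<^esub> ?p (Poly_Mapping.single t 1)" by (rule h(3))
    finally have "?p (Poly_Mapping.single t c) = c \<odot>\<^bsub>G_alg q\<^esub> G_monomial q t" unfolding gen_val .
    then show ?case using Vd mono by simp
  next
    case (add x y)
    then show ?case using Vd h(2) by simp
  qed
  moreover fix x assume "x \<in> carrier (G_alg q)"
  then obtain y where "x = ?p y"
    unfolding G_alg_def F.quotient_carrier
    using A.quotient_carrier[of lie_identities] by (auto simp: free_lie_def)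
  ultimately show "x \<in> V" by simp
qed

text \<open>The torus \<open>(\<complex>\<^sup>\<times>)\<^sup>n\<close> acts on the generators by characters and this action respects the
  relations. The \<open>i\<close>-th cocharacter at 2 acts on degree \<open>\<alpha>\<close> by \<open>2 ^ \<alpha>\<^sub>i\<close>, so that degrees are
  told apart by eigenvalues.\<close>

definition degree_character :: "'n \<Rightarrow> int ^ 'n \<Rightarrow> complex" where
  "degree_character i \<alpha> = 2 powi (\<alpha> $ i)"

lemma degree_character_simps [simp]:
  "degree_character i 0 = 1"
  "degree_character i (\<alpha> + \<beta>) = degree_character i \<alpha> * degree_character i \<beta>"
  by (simp_all add: degree_character_def power_int_add)

lemma degree_character_inj: "\<alpha> \<noteq> \<beta> \<Longrightarrow> \<exists>i. degree_character i \<alpha> \<noteq> degree_character i \<beta>"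
proof -
  assume "\<alpha> \<noteq> \<beta>"
  then obtain i where i: "\<alpha> $ i \<noteq> \<beta> $ i" by (auto simp: vec_eq_iff)
  have "(2::real) powi (\<alpha> $ i) \<noteq> 2 powi (\<beta> $ i)"
    using i power_int_strict_increasing[of "\<alpha> $ i" "\<beta> $ i" "2::real"]
      power_int_strict_increasing[of "\<beta> $ i" "\<alpha> $ i" "2::real"] by (cases "\<alpha> $ i" "\<beta> $ i" rule: linorder_cases) auto
  then have "complex_of_real (2 powi (\<alpha> $ i)) \<noteq> complex_of_real (2 powi (\<beta> $ i))"
    by (simp only: of_real_eq_iff not_False_eq_True)
  moreover have "complex_of_real (2 powi n) = 2 powi n" for n by simp
  ultimately have "degree_character i \<alpha> \<noteq> degree_character i \<beta>"
    by (simp only: degree_character_def not_False_eq_True)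
  then show ?thesis by blast
qed

lemma G_character_automorphism:
  fixes q :: "int ^ 'n::finite \<Rightarrow> int"
  obtains T where "alg_hom (G_alg q) (G_alg q) T"
    "\<And>t. T (G_monomial q t) = degree_character i (monomial_degree t) \<odot>\<^bsub>G_alg q\<^esub> G_monomial q t"
proof -
  interpret G: bilinear_algebra "G_alg q" by (rule G_bilinear_algebra)
  let ?v = "\<lambda>g. degree_character i (gen_degree g) \<odot>\<^bsub>G_alg q\<^esub> G_gen q g"
  note rel = G_relations_hold[of q, unfolded relations_hold_def]
  have inv: "degree_character i (basis_vec j) * degree_character i (- basis_vec j) = 1" for j
    using degree_character_simps(2)[of i "basis_vec j" "- basis_vec j"] by simp
  have "relations_hold q (G_alg q) ?v"
    unfolding relations_hold_def
  proof (intro conjI allI ballI impI)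
    show "?v (Hgen j) \<otimes>\<^bsub>G_alg q\<^esub> ?v (Hgen k) = \<zero>\<^bsub>G_alg q\<^esub>" for j k using rel by simp
    show "?v (Hgen j) \<otimes>\<^bsub>G_alg q\<^esub> ?v (root_gen \<epsilon> k) = of_int (\<epsilon> * form_matrix q j k) \<odot>\<^bsub>G_alg q\<^esub> ?v (root_gen \<epsilon> k)"
      if "\<epsilon> \<in> {1, -1}" for j k \<epsilon>
    proof -
      have "G_gen q (Hgen j) \<otimes>\<^bsub>G_alg q\<^esub> G_gen q (root_gen \<epsilon> k) =
          of_int (\<epsilon> * form_matrix q j k) \<odot>\<^bsub>G_alg q\<^esub> G_gen q (root_gen \<epsilon> k)"
        using rel that by blast
      then show ?thesis by (simp add: G.prod_smult_right G.csmult_rules mult.commute)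
    qed
    show "?v (Fplus j) \<otimes>\<^bsub>G_alg q\<^esub> ?v (Fminus j) = ?v (Hgen j)" for j
      using rel inv[of j] by (simp add: G.prod_smult_left G.prod_smult_right G.csmult_rules mult.commute)
    fix ws :: "(int \<times> 'n) list"
    assume ws: "ws \<noteq> [] \<and> (\<forall>(\<epsilon>, i)\<in>set ws. \<epsilon> \<in> {1, -1}) \<and> (\<Sum>(\<epsilon>, i)\<leftarrow>ws. \<epsilon> *s basis_vec i) \<notin> roots q"
    define x where "x = (\<lambda>(\<epsilon>, i). G_gen q (root_gen \<epsilon> i))"
    define a where "a = (\<lambda>(\<epsilon>, j). degree_character i (gen_degree (root_gen \<epsilon> j)))"
    have xc: "x w \<in> carrier (G_alg q)" for w by (simp add: x_def split: prod.split)
    have "(\<lambda>(\<epsilon>, i). ?v (root_gen \<epsilon> i)) = (\<lambda>w. a w \<odot>\<^bsub>G_alg q\<^esub> x w)"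
      by (auto simp: x_def a_def)
    moreover obtain c where "nested_bracket (G_alg q) (map (\<lambda>w. a w \<odot>\<^bsub>G_alg q\<^esub> x w) ws) =
        c \<odot>\<^bsub>G_alg q\<^esub> nested_bracket (G_alg q) (map x ws)"
      using nested_bracket_scale[OF G.bilinear_algebra_axioms, of x a ws, OF xc] by blast
    moreover have "nested_bracket (G_alg q) (map x ws) = \<zero>\<^bsub>G_alg q\<^esub>"
      unfolding x_def using rel ws by blast
    ultimately show "nested_bracket (G_alg q) (map (\<lambda>(\<epsilon>, i). ?v (root_gen \<epsilon> i)) ws) = \<zero>\<^bsub>G_alg q\<^esub>"
      by simp
  qed auto
  then obtain T where T: "alg_hom (G_alg q) (G_alg q) T" "\<And>g. T (G_gen q g) = ?v g"
    using G_universal[OF G_lie_algebra] by blast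
  have "T (G_monomial q t) = degree_character i (monomial_degree t) \<odot>\<^bsub>G_alg q\<^esub> G_monomial q t" for t
  proof (induction t)
    case (Gen g)
    show ?case by (simp add: T(2))
  next
    case (Br s t)
    then show ?case
      by (simp add: alg_homD(4)[OF T(1)] G.prod_smult_left G.prod_smult_right G.csmult_rules mult.commute)
  qed
  with T(1) that show ?thesis by blast
qed

lemma G_grading_submodule: "submodule (G_grading q \<alpha>) complex_ring (G_alg q)"
proof -
  interpret G: bilinear_algebra "G_alg q" by (rule G_bilinear_algebra)
  show ?thesis unfolding G_grading_def by (rule G.lin_span_submodule) auto
qed

lemma G_grading_least:
  assumes "submodule V complex_ring (G_alg q)" "\<And>t. monomial_degree t = \<alpha> \<Longrightarrow> G_monomial q t \<in> V"
  shows "G_grading q \<alpha> \<subseteq> V"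
  unfolding G_grading_def lin_span_def using assms by (intro hull_minimal) auto

lemma G_monomial_grading: "G_monomial q t \<in> G_grading q (monomial_degree t)"
  unfolding G_grading_def lin_span_def by (rule hull_inc) auto

text \<open>Although \<open>G\<close> is known only through a presentation, the sum of its pieces \<open>G\<^sub>\<alpha>\<close> is direct: the rescaling
  automorphisms have distinct systems of eigenvalues on distinct pieces.\<close>

lemma G_graded_module: 
  fixes q :: "int ^ 'n::finite \<Rightarrow> int"
  shows "graded_module (G_alg q) (G_grading q)"
proof -
  interpret G: bilinear_algebra "G_alg q" by (rule G_bilinear_algebra)
  have "\<exists>T. alg_hom (G_alg q) (G_alg q) T \<and>
    (\<forall>t. T (G_monomial q t) = degree_character i (monomial_degree t) \<odot>\<^bsub>G_alg q\<^esub> G_monomial q t)" for i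
    using G_character_automorphism[of q i] by metis
  then obtain T where T: "\<And>i. alg_hom (G_alg q) (G_alg q) (T i)"
    "\<And>i t. T i (G_monomial q t) = degree_character i (monomial_degree t) \<odot>\<^bsub>G_alg q\<^esub> G_monomial q t"
    by metis
  have ev: "T i x = degree_character i \<alpha> \<odot>\<^bsub>G_alg q\<^esub> x" if "x \<in> G_grading q \<alpha>" for i \<alpha> x
  proof -
    note h = alg_homD[OF T(1)[of i]]
    have "T i \<zero>\<^bsub>G_alg q\<^esub> = \<zero>\<^bsub>G_alg q\<^esub>"
      by (rule linear_map_zero[OF G.complex_module_axioms G.complex_module_axioms h(5)])
    then have "submodule {x \<in> carrier (G_alg q). T i x = degree_character i \<alpha> \<odot>\<^bsub>G_alg q\<^esub> x} complex_ring (G_alg q)"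
      unfolding G.submodule_iff by (auto simp: h G.csmult_rules mult.commute)
    then have "G_grading q \<alpha> \<subseteq> {x \<in> carrier (G_alg q). T i x = degree_character i \<alpha> \<odot>\<^bsub>G_alg q\<^esub> x}"
      by (rule G_grading_least) (auto simp: T(2))
    then show ?thesis using that by blast
  qed
  have sub: "\<forall>\<alpha>. submodule (G_grading q \<alpha>) complex_ring (G_alg q)" by (simp add: G_grading_submodule)
  show ?thesis
  proof (rule graded_module.intro[OF G.complex_module_axioms graded_module_axioms.intro])
    show "submodule (G_grading q \<alpha>) complex_ring (G_alg q)" for \<alpha> by (rule G_grading_submodule)
    fix x assume x: "x \<in> carrier (G_alg q)"
    have "carrier (G_alg q) \<subseteq> {x. \<exists>f. homogeneous_decomposition (G_alg q) (G_grading q) x f}"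
    proof (rule G_spanned_by_monomials)
      show "submodule {x. \<exists>f. homogeneous_decomposition (G_alg q) (G_grading q) x f} complex_ring (G_alg q)"
        by (rule decomposable_submodule[OF G.complex_module_axioms sub])
      show "G_monomial q t \<in> {x. \<exists>f. homogeneous_decomposition (G_alg q) (G_grading q) x f}" for t
        using homogeneous_decomposition_homogeneous[OF G.complex_module_axioms sub G_monomial_grading] by blast
    qed
    then obtain f where f: "homogeneous_decomposition (G_alg q) (G_grading q) x f" using x by auto
    have "k = f" if "homogeneous_decomposition (G_alg q) (G_grading q) x k" for k
      by (rule homogeneous_decomposition_unique[OF G.complex_module_axioms sub, where S = UNIV and T = T and ev = degree_character])
        (use alg_homD(5)[OF T(1)] ev degree_character_inj that f in auto)
    with f show "\<exists>!f. homogeneous_decomposition (G_alg q) (G_grading q) x f" by blast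
  qed
qed

section \<open>The Cartan subalgebra and the extension by the dual of the radical\<close>

lemma (in complex_module) submodule_finsum:
  assumes "submodule V complex_ring L" "finite A" "\<forall>a\<in>A. f a \<in> V"
  shows "(\<Oplus>a\<in>A. f a) \<in> V"
  using assms(2,3)
proof (induction A rule: finite_induct)
  case empty
  then show ?case using assms(1) by (simp add: submodule_iff)
next
  case (insert a A)
  have "V \<subseteq> carrier L" using assms(1) by (simp add: submodule_iff)
  then have "(\<Oplus>a\<in>insert a A. f a) = f a \<oplus> (\<Oplus>a\<in>A. f a)"
    using insert by (intro M.finsum_insert) auto
  then show ?case using insert assms(1) by (simp add: submodule_iff)
qed

definition cartan_elt :: "(int ^ 'n::finite \<Rightarrow> int) \<Rightarrow> complex ^ 'n \<Rightarrow> 'n free_elt set" where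
  "cartan_elt q a = (\<Oplus>\<^bsub>G_alg q\<^esub>i\<in>UNIV. (a $ i) \<odot>\<^bsub>G_alg q\<^esub> G_gen q (Hgen i))"

lemma cartan_elt_closed [simp]: "cartan_elt q a \<in> carrier (G_alg q)"
proof -
  interpret G: bilinear_algebra "G_alg q" by (rule G_bilinear_algebra)
  show ?thesis unfolding cartan_elt_def by (intro G.M.finsum_closed) auto
qed

lemma cartan_elt_linear:
  "cartan_elt q (a + b) = cartan_elt q a \<oplus>\<^bsub>G_alg q\<^esub> cartan_elt q b"
  "cartan_elt q (c *s a) = c \<odot>\<^bsub>G_alg q\<^esub> cartan_elt q a"
  "cartan_elt q 0 = \<zero>\<^bsub>G_alg q\<^esub>"
proof -
  interpret G: bilinear_algebra "G_alg q" by (rule G_bilinear_algebra)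
  show "cartan_elt q (a + b) = cartan_elt q a \<oplus>\<^bsub>G_alg q\<^esub> cartan_elt q b"
    unfolding cartan_elt_def
    by (subst G.M.finsum_addf[symmetric]) (auto simp: G.csmult_rules)
  show "cartan_elt q (c *s a) = c \<odot>\<^bsub>G_alg q\<^esub> cartan_elt q a"
    unfolding cartan_elt_def
    by (subst G.finsum_csmult) (auto simp: G.csmult_rules)
  show "cartan_elt q 0 = \<zero>\<^bsub>G_alg q\<^esub>"
    unfolding cartan_elt_def by (simp add: G.M.finsum_zero)
qed

lemma cartan_elt_in_submodule:
  assumes "submodule V complex_ring (G_alg q)" "\<forall>i. G_gen q (Hgen i) \<in> V"
  shows "cartan_elt q a \<in> V"
proof -
  interpret G: bilinear_algebra "G_alg q" by (rule G_bilinear_algebra)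
  show ?thesis unfolding cartan_elt_def
    using assms by (intro G.submodule_finsum) (auto simp: G.submodule_iff)
qed

lemma cartan_elt_axis: "cartan_elt q (axis i 1) = G_gen q (Hgen i)"
proof -
  interpret G: bilinear_algebra "G_alg q" by (rule G_bilinear_algebra)
  have "cartan_elt q (axis i 1) = (\<Oplus>\<^bsub>G_alg q\<^esub>j\<in>{i}. (axis i 1 $ j :: complex) \<odot>\<^bsub>G_alg q\<^esub> G_gen q (Hgen j))"
    unfolding cartan_elt_def
    by (rule G.M.add.finprod_mono_neutral_cong_left[symmetric]) (auto simp: axis_def)
  also have "\<dots> = G_gen q (Hgen i)" by (simp add: axis_def G.M.r_zero)
  finally show ?thesis .
qed

lemma cartan_elt_commute: "cartan_elt q a \<otimes>\<^bsub>G_alg q\<^esub> cartan_elt q b = \<zero>\<^bsub>G_alg q\<^esub>"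
proof -
  interpret G: bilinear_algebra "G_alg q" by (rule G_bilinear_algebra)
  have hh: "G_gen q (Hgen i) \<otimes>\<^bsub>G_alg q\<^esub> G_gen q (Hgen j) = \<zero>\<^bsub>G_alg q\<^esub>" for i j
    using G_relations_hold[of q] by (simp add: relations_hold_def)
  have "cartan_elt q a \<in> {x \<in> carrier (G_alg q). x \<otimes>\<^bsub>G_alg q\<^esub> G_gen q (Hgen j) = \<zero>\<^bsub>G_alg q\<^esub>}" for j
    by (rule cartan_elt_in_submodule)
      (auto simp: G.submodule_iff hh G.prod_add_left G.prod_smult_left)
  then have ah: "cartan_elt q a \<otimes>\<^bsub>G_alg q\<^esub> G_gen q (Hgen j) = \<zero>\<^bsub>G_alg q\<^esub>" for j by blast
  have "cartan_elt q b \<in> {y \<in> carrier (G_alg q). cartan_elt q a \<otimes>\<^bsub>G_alg q\<^esub> y = \<zero>\<^bsub>G_alg q\<^esub>}"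
    by (rule cartan_elt_in_submodule)
      (auto simp: G.submodule_iff ah G.prod_add_right G.prod_smult_right)
  then show ?thesis by blast
qed

text \<open>The \<open>h\<^sub>i\<close> commute, hence the subalgebra that they generate is their linear span.\<close>

lemma G_H_eq: "G_H q = range (cartan_elt q)"
proof
  interpret G: bilinear_algebra "G_alg q" by (rule G_bilinear_algebra)
  have "subalg (G_alg q) (range (cartan_elt q))"
    unfolding G.subalg_iff
  proof (intro conjI ballI allI)
    show "\<zero>\<^bsub>G_alg q\<^esub> \<in> range (cartan_elt q)" using cartan_elt_linear(3)[of q] by (metis rangeI)
    show "x \<oplus>\<^bsub>G_alg q\<^esub> y \<in> range (cartan_elt q)" if "x \<in> range (cartan_elt q)" "y \<in> range (cartan_elt q)" for x y
      using that by (auto simp: cartan_elt_linear(1)[symmetric])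
    show "c \<odot>\<^bsub>G_alg q\<^esub> x \<in> range (cartan_elt q)" if "x \<in> range (cartan_elt q)" for x c
      using that by (auto simp: cartan_elt_linear(2)[symmetric])
    show "x \<otimes>\<^bsub>G_alg q\<^esub> y \<in> range (cartan_elt q)" if "x \<in> range (cartan_elt q)" "y \<in> range (cartan_elt q)" for x y
      using that by (auto simp: cartan_elt_commute cartan_elt_linear(3)[symmetric])
  qed auto
  moreover have "{G_gen q (Hgen i) | i. True} \<subseteq> range (cartan_elt q)"
    using cartan_elt_axis[of q, symmetric] by blast
  ultimately show "G_H q \<subseteq> range (cartan_elt q)" unfolding G_H_def by (intro hull_minimal)
  have H: "subalg (G_alg q) (G_H q)" unfolding G_H_def by (rule G.hull_subalg) auto
  have gen: "G_gen q (Hgen i) \<in> G_H q" for i unfolding G_H_def by (rule hull_inc) blast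
  have "cartan_elt q a \<in> G_H q" for a
    by (rule cartan_elt_in_submodule) (use H gen in \<open>auto simp: subalg_def\<close>)
  then show "range (cartan_elt q) \<subseteq> G_H q" by blast
qed

lemma radC_dual_closed:
  "0 \<in> radC_dual q" "\<xi> \<in> radC_dual q \<Longrightarrow> \<zeta> \<in> radC_dual q \<Longrightarrow> \<xi> + \<zeta> \<in> radC_dual q"
  "\<xi> \<in> radC_dual q \<Longrightarrow> (\<lambda>v. c * \<xi> v) \<in> radC_dual q"
  by (simp_all add: radC_dual_def algebra_simps)

lemma dual_action_rules:
  assumes "x \<in> carrier (G_alg q)" "y \<in> carrier (G_alg q)"
  shows "dual_action q \<rho> \<xi> x \<in> carrier (G_alg q)"
    "dual_action q \<rho> \<xi> (x \<oplus>\<^bsub>G_alg q\<^esub> y) = dual_action q \<rho> \<xi> x \<oplus>\<^bsub>G_alg q\<^esub> dual_action q \<rho> \<xi> y"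
    "dual_action q \<rho> \<xi> (c \<odot>\<^bsub>G_alg q\<^esub> x) = c \<odot>\<^bsub>G_alg q\<^esub> dual_action q \<rho> \<xi> x"
    "dual_action q \<rho> (\<xi> + \<zeta>) x = dual_action q \<rho> \<xi> x \<oplus>\<^bsub>G_alg q\<^esub> dual_action q \<rho> \<zeta> x"
    "dual_action q \<rho> (\<lambda>v. c * \<xi> v) x = c \<odot>\<^bsub>G_alg q\<^esub> dual_action q \<rho> \<xi> x"
    "dual_action q \<rho> 0 x = \<zero>\<^bsub>G_alg q\<^esub>"
proof -
  interpret G: graded_module "G_alg q" "G_grading q" by (rule G_graded_module)
  note d = dual_action_def[of q \<rho>]
  show "dual_action q \<rho> \<xi> x \<in> carrier (G_alg q)" by (simp add: d assms)
  show "dual_action q \<rho> \<xi> (x \<oplus>\<^bsub>G_alg q\<^esub> y) = dual_action q \<rho> \<xi> x \<oplus>\<^bsub>G_alg q\<^esub> dual_action q \<rho> \<xi> y"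
    by (simp add: d assms G.degree_action_add)
  show "dual_action q \<rho> \<xi> (c \<odot>\<^bsub>G_alg q\<^esub> x) = c \<odot>\<^bsub>G_alg q\<^esub> dual_action q \<rho> \<xi> x"
    by (simp add: d assms G.degree_action_smult)
  show "dual_action q \<rho> (\<xi> + \<zeta>) x = dual_action q \<rho> \<xi> x \<oplus>\<^bsub>G_alg q\<^esub> dual_action q \<rho> \<zeta> x"
    by (simp add: d assms G.degree_action_weight_add)
  show "dual_action q \<rho> (\<lambda>v. c * \<xi> v) x = c \<odot>\<^bsub>G_alg q\<^esub> dual_action q \<rho> \<xi> x"
    by (simp add: d assms G.degree_action_weight_smult)
  show "dual_action q \<rho> 0 x = \<zero>\<^bsub>G_alg q\<^esub>"
    using G.degree_action_weight_smult[OF assms(1), of 0 "\<lambda>\<alpha>. 0"] by (simp add: d assms)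
qed

lemma dual_action_homogeneous:
  assumes "x \<in> G_grading q \<alpha>"
  shows "dual_action q \<rho> \<xi> x = \<xi> (\<rho> (cvec \<alpha>)) \<odot>\<^bsub>G_alg q\<^esub> x"
  unfolding dual_action_def by (rule graded_module.degree_action_homogeneous[OF G_graded_module assms])

lemma G_tilde_simps [simp]:
  "carrier (G_tilde q \<rho>) = carrier (G_alg q) \<times> radC_dual q"
  "\<zero>\<^bsub>G_tilde q \<rho>\<^esub> = (\<zero>\<^bsub>G_alg q\<^esub>, 0)"
  "(x, \<xi>) \<oplus>\<^bsub>G_tilde q \<rho>\<^esub> (y, \<zeta>) = (x \<oplus>\<^bsub>G_alg q\<^esub> y, \<xi> + \<zeta>)"
  "c \<odot>\<^bsub>G_tilde q \<rho>\<^esub> (x, \<xi>) = (c \<odot>\<^bsub>G_alg q\<^esub> x, \<lambda>v. c * \<xi> v)"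
  "(x, \<xi>) \<otimes>\<^bsub>G_tilde q \<rho>\<^esub> (y, \<zeta>) =
    ((x \<otimes>\<^bsub>G_alg q\<^esub> y) \<oplus>\<^bsub>G_alg q\<^esub> dual_action q \<rho> \<xi> y \<ominus>\<^bsub>G_alg q\<^esub> dual_action q \<rho> \<zeta> x, 0)"
  by (simp_all add: G_tilde_def)

lemma G_tilde_bilinear_algebra: "bilinear_algebra (G_tilde q \<rho>)"
proof -
  interpret G: bilinear_algebra "G_alg q" by (rule G_bilinear_algebra)
  note d = dual_action_rules[of _ q]
  have fun_zero: "(\<lambda>v. 0) = (0 :: complex ^ 'a \<Rightarrow> complex)"
    by (simp add: fun_eq_iff)
  show ?thesis
  proof (rule bilinear_algebraI)
    show "complex_module (G_tilde q \<rho>)"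
    proof (rule complex_moduleI)
      show "\<zero>\<^bsub>G_tilde q \<rho>\<^esub> \<in> carrier (G_tilde q \<rho>)" by (simp add: radC_dual_closed)
    qed (auto simp: radC_dual_closed G.M.a_ac G.csmult_rules algebra_simps fun_eq_iff)
  qed (auto simp: radC_dual_closed d G.diff_eq_smult G.csmult_rules G.prod_add_left G.prod_add_right
      G.prod_smult_left G.prod_smult_right G.M.a_ac fun_zero mult.commute)
qed

section \<open>Non-negative unit forms and their radicals\<close>

lemma additive_int_scale:
  fixes f :: "int ^ 'n \<Rightarrow> int"
  assumes "\<And>x y. f (x + y) = f x + f y"
  shows "f (k *s x) = k * f x"
proof -
  have 0: "f 0 = 0" using assms[of 0 0] by simp
  have neg: "f (- x) = - f x" for x using assms[of x "- x"] 0 by simp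
  have nat: "f (int n *s x) = int n * f x" for n
  proof (induction n)
    case 0
    show ?case using \<open>f 0 = 0\<close> by simp
  next
    case (Suc n)
    have "int (Suc n) *s x = int n *s x + x" by (simp add: vec_eq_iff algebra_simps)
    then show ?case using Suc assms by (simp add: algebra_simps)
  qed
  show ?thesis
  proof (cases "k \<ge> 0")
    case True
    then show ?thesis using nat[of "nat k"] by simp
  next
    case False
    have "k *s x = - (int (nat (- k)) *s x)" using False by (simp add: vec_eq_iff)
    then show ?thesis using nat[of "nat (- k)"] neg False by simp
  qed
qed

lemma additive_sum:
  fixes f :: "'a::ab_group_add \<Rightarrow> 'b::ab_group_add"
  assumes "\<And>x y. f (x + y) = f x + f y"
  shows "f (sum g A) = (\<Sum>a\<in>A. f (g a))"
proof -
  have "f 0 = 0" using assms[of 0 0] by simp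
  then show ?thesis by (induction A rule: infinite_finite_induct) (simp_all add: assms)
qed

lemma cvec_simps [simp]:
  "cvec (x + y) = cvec x + cvec y" "cvec 0 = 0" "cvec (- x) = - cvec x" "cvec (x - y) = cvec x - cvec y"
  "cvec (k *s x) = of_int k *s cvec x" "cvec x = 0 \<longleftrightarrow> x = 0"
  by (simp_all add: cvec_def vec_eq_iff)

lemma polarC_rules:
  "polarC q (u + v) w = polarC q u w + polarC q v w"
  "polarC q w (u + v) = polarC q w u + polarC q w v"
  "polarC q (a *s v) w = a * polarC q v w"
  "polarC q w (a *s v) = a * polarC q w v"
  "polarC q 0 w = 0" "polarC q w 0 = 0"
  by (simp_all add: polarC_def algebra_simps sum.distrib sum_distrib_left)

lemma powi_minus_one: "(-1::complex) powi n = (if even n then 1 else -1)"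
  by (simp add: power_int_minus_left)

locale nonneg_unit_form =
  fixes c :: "'n::{finite,linorder} \<Rightarrow> 'n \<Rightarrow> int"
    and q :: "int ^ 'n::{finite,linorder} \<Rightarrow> int"
    and \<rho> :: "complex ^ 'n::{finite,linorder} \<Rightarrow> complex ^ 'n::{finite,linorder}"
    and B :: "int ^ 'n::{finite,linorder} \<Rightarrow> int ^ 'n::{finite,linorder} \<Rightarrow> int"
  assumes unit: "q = unit_form c"
    and connected: "connected_coeffs c"
    and nonneg: "nonneg_form q"
    and projection: "radC_projection q \<rho>"
    and bilinear: "admissible_bilinear q B"
begin

lemma B_rules:
  "B (x + y) z = B x z + B y z" "B x (y + z) = B x y + B x z" "B x x = q x"
  using bilinear by (auto simp: admissible_bilinear_def)

lemma B_zero [simp]: "B 0 x = 0" "B x 0 = 0"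
  using B_rules(1)[of 0 0 x] B_rules(2)[of x 0 0] by simp_all

lemma B_minus [simp]: "B (- x) y = - B x y" "B x (- y) = - B x y"
  using B_rules(1)[of x "- x" y] B_rules(2)[of x y "- y"] by simp_all

lemma B_diff: "B (x - y) z = B x z - B y z" "B z (x - y) = B z x - B z y"
  using B_rules(1)[of x "- y" z] B_rules(2)[of z x "- y"] by simp_all

text \<open>The polar form is the symmetrization of \<open>B\<close>; its bilinearity is inherited from that of \<open>B\<close>.\<close>

lemma polar_B: "polar q x y = B x y + B y x"
  unfolding polar_def B_rules(3)[symmetric] by (simp add: B_rules(1,2))

lemma polar_rules:
  "polar q (x + y) z = polar q x z + polar q y z" "polar q z (x + y) = polar q z x + polar q z y"
  "polar q (- x) y = - polar q x y" "polar q x (- y) = - polar q x y"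
  "polar q (x - y) z = polar q x z - polar q y z" "polar q z (x - y) = polar q z x - polar q z y"
  "polar q 0 y = 0" "polar q x 0 = 0" "polar q x x = 2 * q x"
  by (simp_all add: polar_B B_rules B_diff)

lemma polar_commute: "polar q x y = polar q y x"
  by (simp add: polar_B)

lemma q_rules: "q (x + y) = q x + q y + polar q x y" "q (x - y) = q x + q y - polar q x y"
  "q (- x) = q x" "q 0 = 0"
  unfolding polar_B unfolding B_rules(3)[symmetric] by (simp_all add: B_rules(1,2) B_diff)

lemma q_nonneg: "0 \<le> q x"
  using nonneg by (simp add: nonneg_form_def)

lemma q_basis: "q (basis_vec i) = 1"
proof -
  have "(\<Sum>j\<in>UNIV. (axis i 1 $ j :: int)\<^sup>2) = (\<Sum>j\<in>UNIV. if j = i then 1 else 0)"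
    by (rule sum.cong) (auto simp: axis_def)
  moreover have "(\<Sum>(j, k)\<in>{(j, k). j < k}. c j k * axis i 1 $ j * axis i 1 $ k) = 0"
    by (rule sum.neutral) (auto simp: axis_def)
  ultimately show ?thesis by (simp add: unit unit_form_def)
qed

lemma form_matrix_offdiagonal:
  assumes "i < j"
  shows "form_matrix q i j = c i j"
proof -
  let ?x = "basis_vec i" and ?y = "basis_vec j"
  have ne: "i \<noteq> j" using assms by simp
  have "(\<Sum>k\<in>UNIV. ((?x + ?y) $ k)\<^sup>2) = (\<Sum>k\<in>UNIV. (if k = i then 1 else 0) + (if k = j then 1 else 0))"
    using ne by (intro sum.cong) (auto simp: axis_def)
  then have s: "(\<Sum>k\<in>UNIV. ((?x + ?y) $ k)\<^sup>2) = 2" by (simp add: sum.distrib)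
  have "(\<Sum>(k, l)\<in>{(k, l). k < l}. c k l * (?x + ?y) $ k * (?x + ?y) $ l) =
      (\<Sum>p\<in>{(k, l). k < l}. if p = (i, j) then c i j else 0)"
    using assms by (intro sum.cong) (auto simp: axis_def split: if_splits)
  also have "\<dots> = c i j" using assms by simp
  finally have "q (?x + ?y) = 2 + c i j" using s by (simp add: unit unit_form_def)
  then show ?thesis by (simp add: form_matrix_def polar_def q_basis)
qed

lemma polar_expand: "polar q x y = (\<Sum>i\<in>UNIV. \<Sum>j\<in>UNIV. x $ i * form_matrix q i j * y $ j)"
proof -
  have l: "polar q x y = (\<Sum>i\<in>UNIV. x $ i * polar q (basis_vec i) y)" for x y
  proof -
    have "polar q x y = polar q (\<Sum>i\<in>UNIV. x $ i *s basis_vec i) y" by (simp add: basis_expansion)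
    also have "\<dots> = (\<Sum>i\<in>UNIV. polar q (x $ i *s basis_vec i) y)"
      by (rule additive_sum) (rule polar_rules)
    also have "\<dots> = (\<Sum>i\<in>UNIV. x $ i * polar q (basis_vec i) y)"
      by (intro sum.cong refl additive_int_scale) (rule polar_rules)
    finally show ?thesis .
  qed
  have "polar q (basis_vec i) y = (\<Sum>j\<in>UNIV. y $ j * form_matrix q i j)" for i
    using l[of y "basis_vec i"] by (simp add: polar_commute[of "basis_vec i"] form_matrix_def)
  then show ?thesis using l[of x y] by (simp add: sum_distrib_left mult_ac)
qed

lemma polarC_cvec: "polarC q (cvec x) (cvec y) = of_int (polar q x y)"
  by (simp add: polarC_def polar_expand cvec_def)

lemma polarC_commute: "polarC q v w = polarC q w v"
proof -
  have "form_matrix q i j = form_matrix q j i" for i j by (simp add: form_matrix_def polar_commute)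
  then show ?thesis unfolding polarC_def
    by (subst sum.swap) (simp add: mult.commute mult.left_commute)
qed

text \<open>If \<open>q x = 0\<close> then \<open>q (y + k x) = q y + k q(x, y)\<close> is non-negative for all \<open>k\<close>, which forces
  \<open>q(x, y) = 0\<close>.\<close>

lemma imag_root_polar:
  assumes "q x = 0"
  shows "polar q x y = 0"
proof (rule ccontr)
  assume p: "polar q x y \<noteq> 0"
  have k: "0 \<le> q y + k * polar q x y" for k
  proof -
    have "polar q y (k *s x) = k * polar q y x" by (rule additive_int_scale) (rule polar_rules)
    moreover have "2 * q (k *s x) = 0"
    proof -
      have "polar q (k *s x) (k *s x) = k * polar q (k *s x) x"
        by (rule additive_int_scale) (rule polar_rules)
      also have "polar q (k *s x) x = k * polar q x x"
        by (rule additive_int_scale[of "\<lambda>z. polar q z x"]) (rule polar_rules)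
      finally show ?thesis using assms by (simp add: polar_rules)
    qed
    ultimately show ?thesis using q_nonneg[of "y + k *s x"] q_rules(1)[of y "k *s x"]
      by (simp add: polar_commute)
  qed
  have eq: "q y + (- sgn (polar q x y) * (q y + 1)) * polar q x y = q y - (q y + 1) * \<bar>polar q x y\<bar>"
    by (simp add: sgn_if abs_if)
  have "(q y + 1) * 1 \<le> (q y + 1) * \<bar>polar q x y\<bar>"
    using p q_nonneg[of y] by (intro mult_left_mono) auto
  with k[of "- sgn (polar q x y) * (q y + 1)"] show False unfolding eq by simp
qed

lemma imag_root_polar': "q x = 0 \<Longrightarrow> polar q y x = 0"
  using imag_root_polar polar_commute by metis

lemma rad_eq_imag_roots: "rad q = imag_roots q"
proof (intro equalityI subsetI)
  fix x assume "x \<in> rad q"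
  then have "polar q x x = 0" by (simp add: rad_def)
  then show "x \<in> imag_roots q" by (simp add: polar_rules imag_roots_def)
qed (simp add: rad_def imag_roots_def imag_root_polar)

lemma q_add_imag: "q \<sigma> = 0 \<Longrightarrow> q (x + \<sigma>) = q x" "q \<sigma> = 0 \<Longrightarrow> q (\<sigma> + x) = q x" "q \<sigma> = 0 \<Longrightarrow> q (x - \<sigma>) = q x"
  by (simp_all add: q_rules imag_root_polar imag_root_polar')

lemma real_root_polar_bounds:
  assumes "q x = 1" "q y = 1"
  shows "- 2 \<le> polar q x y" "polar q x y \<le> 2"
  using q_nonneg[of "x + y"] q_nonneg[of "x - y"] assms by (simp_all add: q_rules)

lemma imag_root_radC: "q \<sigma> = 0 \<Longrightarrow> cvec \<sigma> \<in> radC q"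
  unfolding radC_def rad_eq_imag_roots imag_roots_def by (rule vec.span_base) auto

lemma radC_subspace:
  "0 \<in> radC q" "v \<in> radC q \<Longrightarrow> w \<in> radC q \<Longrightarrow> v + w \<in> radC q" "v \<in> radC q \<Longrightarrow> a *s v \<in> radC q"
  "v \<in> radC q \<Longrightarrow> w \<in> radC q \<Longrightarrow> v - w \<in> radC q"
  unfolding radC_def by (auto intro: vec.span_zero vec.span_add vec.span_scale vec.span_diff)

lemma radC_polarC:
  assumes "v \<in> radC q"
  shows "polarC q v w = 0" "polarC q w v = 0"
proof -
  have base: "polarC q (cvec x) w = 0" if "x \<in> rad q" for x w
  proof -
    have C: "(\<Sum>i\<in>UNIV. x $ i * form_matrix q i j) = 0" for j
    proof -
      have "polar q x (basis_vec j) = (\<Sum>i\<in>UNIV. x $ i * form_matrix q i j)"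
        unfolding polar_expand by (simp add: axis_def if_distrib cong: if_cong)
      then show ?thesis using that by (simp add: rad_def)
    qed
    have "polarC q (cvec x) w = (\<Sum>j\<in>UNIV. of_int (\<Sum>i\<in>UNIV. x $ i * form_matrix q i j) * w $ j)"
      unfolding polarC_def by (subst sum.swap) (simp add: cvec_def sum_distrib_right)
    then show ?thesis by (simp add: C)
  qed
  have "polarC q v w = 0"
  proof (rule vec.span_induct[of v "cvec ` rad q" "\<lambda>v. polarC q v w = 0"])
    show "v \<in> vec.span (cvec ` rad q)" using assms by (simp add: radC_def)
    show "vec.subspace {v. polarC q v w = 0}"
      by (simp add: vec.subspace_def polarC_rules)
  qed (use base in auto)
  then show "polarC q v w = 0" "polarC q w v = 0" by (simp_all add: polarC_commute)
qed

text \<open>The radical of the complexified form is spanned by integral vectors: expand the coordinates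
  of a vector in the kernel in a basis, over the rationals, of the space that they span.
  Each coefficient vector is then in the rational kernel, and a multiple of it is integral.\<close>

lemma radC_if_polarC_zero:
  assumes "\<And>w. polarC q v w = 0"
  shows "v \<in> radC q"
proof -
  interpret Q: vector_space "\<lambda>(r::rat) (z::complex). of_rat r * z"
    by unfold_locales (simp_all add: algebra_simps of_rat_add of_rat_mult)
  have C: "(\<Sum>i\<in>UNIV. v $ i * of_int (form_matrix q i j)) = 0" for j
  proof -
    have "polarC q v (axis j 1) = (\<Sum>i\<in>UNIV. v $ i * of_int (form_matrix q i j))"
      unfolding polarC_def by (simp add: axis_def if_distrib cong: if_cong)
    then show ?thesis using assms by simp
  qed
  obtain S where S: "S \<subseteq> range (($) v)" "Q.independent S" "range (($) v) \<subseteq> Q.span S"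
    by (rule Q.maximal_independent_subset)
  have fin: "finite S" by (rule finite_subset[OF S(1)]) simp
  define r where "r i b = Q.representation S (v $ i) b" for i b
  have v: "v $ i = (\<Sum>b\<in>S. of_rat (r i b) * b)" for i
    unfolding r_def by (rule Q.sum_representation_eq[symmetric]) (use S fin in auto)
  have ker: "(\<Sum>i\<in>UNIV. r i b * of_int (form_matrix q i j)) = 0" if "b \<in> S" for b j
  proof -
    have "(\<Sum>b\<in>S. of_rat (\<Sum>i\<in>UNIV. r i b * of_int (form_matrix q i j)) * b) =
        (\<Sum>b\<in>S. \<Sum>i\<in>UNIV. of_rat (r i b) * of_int (form_matrix q i j) * b)"
      by (simp add: of_rat_sum of_rat_mult sum_distrib_right)
    also have "\<dots> = (\<Sum>i\<in>UNIV. \<Sum>b\<in>S. of_rat (r i b) * of_int (form_matrix q i j) * b)"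
      by (rule sum.swap)
    also have "\<dots> = (\<Sum>i\<in>UNIV. (\<Sum>b\<in>S. of_rat (r i b) * b) * of_int (form_matrix q i j))"
      unfolding sum_distrib_right by (intro sum.cong refl) (simp add: mult_ac)
    also have "\<dots> = 0" using C[of j] by (simp add: v)
    finally show ?thesis
      by (rule Q.independentD[OF S(2) fin subset_refl _ that,
          of "\<lambda>b. \<Sum>i\<in>UNIV. r i b * of_int (form_matrix q i j)"])
  qed
  have "\<exists>d z. d \<noteq> 0 \<and> (\<forall>i. of_int d * r i b = of_int (z i))" for b
  proof -
    define d where "d = (\<Prod>i\<in>UNIV. snd (quotient_of (r i b)))"
    have pos: "snd (quotient_of (r i b)) > 0" for i by (rule quotient_of_denom_pos')
    have "\<exists>z. of_int d * r i b = of_int z" for i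
    proof -
      have "d = snd (quotient_of (r i b)) * (\<Prod>i\<in>UNIV - {i}. snd (quotient_of (r i b)))"
        unfolding d_def by (simp add: prod.remove)
      moreover have "r i b = of_int (fst (quotient_of (r i b))) / of_int (snd (quotient_of (r i b)))"
        by (rule quotient_of_div) simp
      ultimately have "of_int d * r i b =
          of_int ((\<Prod>i\<in>UNIV - {i}. snd (quotient_of (r i b))) * fst (quotient_of (r i b)))"
        using pos[of i] by (simp add: field_simps)
      then show ?thesis by blast
    qed
    moreover have "d \<noteq> 0" using pos by (simp add: d_def less_imp_neq[symmetric])
    ultimately show ?thesis by metis
  qed
  then obtain d z where dz: "\<And>b. d b \<noteq> 0" "\<And>b i. of_int (d b) * r i b = of_int (z b i)" by metis
  define x where "x b = (\<chi> i. z b i)" for b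
  have rad: "x b \<in> rad q" if "b \<in> S" for b
  proof -
    have "of_int (\<Sum>i\<in>UNIV. z b i * form_matrix q i j) = (0::rat)" for j
    proof -
      have "of_int (\<Sum>i\<in>UNIV. z b i * form_matrix q i j) =
          of_int (d b) * (\<Sum>i\<in>UNIV. r i b * of_int (form_matrix q i j))"
        by (simp add: sum_distrib_left dz(2)[symmetric] mult.assoc)
      then show ?thesis using ker[OF that] by simp
    qed
    then have z: "(\<Sum>i\<in>UNIV. z b i * form_matrix q i j) = 0" for j by (simp only: of_int_eq_0_iff)
    have "polar q (x b) y = (\<Sum>j\<in>UNIV. (\<Sum>i\<in>UNIV. z b i * form_matrix q i j) * y $ j)" for y
      unfolding polar_expand by (subst sum.swap) (simp add: x_def sum_distrib_right)
    then show ?thesis by (simp add: rad_def z)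
  qed
  have "v = (\<Sum>b\<in>S. (b / of_int (d b)) *s cvec (x b))"
  proof -
    have r: "of_rat (r i b) = (of_int (z b i) / of_int (d b) :: complex)" for i b
    proof -
      have "r i b = of_int (z b i) / of_int (d b)" using dz(1)[of b] dz(2)[of b i] by (simp add: field_simps)
      then show ?thesis by (simp add: of_rat_divide)
    qed
    show ?thesis by (simp add: vec_eq_iff v r x_def cvec_def mult.commute)
  qed
  also have "\<dots> \<in> radC q"
    unfolding radC_def by (intro vec.span_sum vec.span_scale vec.span_base) (use rad in auto)
  finally show ?thesis .
qed

abbreviation sgn_coc ("\<epsilon>") where "\<epsilon> \<equiv> sgn_cocycle B"

lemma sgn_cocycle_parity: "\<epsilon> \<alpha> \<beta> = (if even (B \<alpha> \<beta>) then 1 else -1)"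
  by (simp add: sgn_cocycle_def powi_minus_one)

lemma sgn_cocycle_rules:
  "\<epsilon> (\<alpha> + \<beta>) \<gamma> = \<epsilon> \<alpha> \<gamma> * \<epsilon> \<beta> \<gamma>" "\<epsilon> \<alpha> (\<beta> + \<gamma>) = \<epsilon> \<alpha> \<beta> * \<epsilon> \<alpha> \<gamma>" "\<epsilon> 0 \<alpha> = 1" "\<epsilon> \<alpha> 0 = 1"
  "\<epsilon> \<alpha> \<beta> * \<epsilon> \<alpha> \<beta> = 1" "\<epsilon> \<alpha> \<beta> \<noteq> 0"
  by (simp_all add: sgn_cocycle_parity B_rules)

text \<open>The cocycle is bimultiplicative but not symmetric. Its failure to be symmetric is the parity of the
  polar form, which is the source of all signs in the verification of the Lie identities.\<close>

lemma sgn_cocycle_swap: "\<epsilon> \<beta> \<alpha> = \<epsilon> \<alpha> \<beta> * (if even (polar q \<alpha> \<beta>) then 1 else -1)"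
  by (simp add: sgn_cocycle_parity polar_B)

lemma rho_rules: "\<rho> (v + w) = \<rho> v + \<rho> w" "\<rho> (a *s v) = a *s \<rho> v" "\<rho> 0 = 0" "\<rho> v \<in> radC q"
  "v \<in> radC q \<Longrightarrow> \<rho> v = v"
proof -
  interpret l: Vector_Spaces.linear "(*s)" "(*s)" \<rho>
    using projection by (simp add: radC_projection_def)
  show "\<rho> (v + w) = \<rho> v + \<rho> w" "\<rho> (a *s v) = a *s \<rho> v" "\<rho> 0 = 0"
    by (rule l.add l.scale l.zero)+
  show "\<rho> v \<in> radC q" "v \<in> radC q \<Longrightarrow> \<rho> v = v"
    using projection by (auto simp: radC_projection_def)
qed

definition dual_weight :: "(complex ^ 'n::{finite,linorder} \<Rightarrow> complex) \<Rightarrow> int ^ 'n::{finite,linorder} \<Rightarrow> complex" where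
  "dual_weight \<xi> \<alpha> = \<xi> (\<rho> (cvec \<alpha>))"

lemma dual_weight_rules:
  assumes "\<xi> \<in> radC_dual q"
  shows "dual_weight \<xi> (\<alpha> + \<beta>) = dual_weight \<xi> \<alpha> + dual_weight \<xi> \<beta>" "dual_weight \<xi> 0 = 0"
    "dual_weight \<xi> (- \<alpha>) = - dual_weight \<xi> \<alpha>"
proof -
  show add: "dual_weight \<xi> (\<alpha> + \<beta>) = dual_weight \<xi> \<alpha> + dual_weight \<xi> \<beta>" for \<alpha> \<beta>
    using assms by (simp add: dual_weight_def rho_rules radC_dual_def)
  show 0: "dual_weight \<xi> 0 = 0" using add[of 0 0] by simp
  show "dual_weight \<xi> (- \<alpha>) = - dual_weight \<xi> \<alpha>" using add[of \<alpha> "- \<alpha>"] 0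
    by (simp add: eq_neg_iff_add_eq_0 add.commute)
qed

text \<open>The scalar by which the element of degree zero with components \<open>v\<close> and \<open>\<xi>\<close> acts on degree \<open>\<alpha>\<close>.\<close>

definition cartan_weight :: "complex ^ 'n::{finite,linorder} \<Rightarrow> (complex ^ 'n::{finite,linorder} \<Rightarrow> complex) \<Rightarrow> int ^ 'n::{finite,linorder} \<Rightarrow> complex" where
  "cartan_weight v \<xi> \<alpha> = polarC q v (cvec \<alpha>) + dual_weight \<xi> \<alpha>"

text \<open>If \<open>\<alpha> - \<beta>\<close> is not in the radical then it has a nonzero product with some integral vector. Otherwise the
  projection \<open>\<rho>\<close> fixes it, and a coordinate functional on the radical is nonzero on it.\<close>

lemma cartan_weights_separate:
  assumes "\<alpha> \<noteq> \<beta>"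
  shows "\<exists>v \<xi>. \<xi> \<in> radC_dual q \<and> cartan_weight v \<xi> \<alpha> \<noteq> cartan_weight v \<xi> \<beta>"
proof (cases "\<alpha> - \<beta> \<in> rad q")
  case False
  then obtain y where "polar q (\<alpha> - \<beta>) y \<noteq> 0" by (auto simp: rad_def)
  then have "polarC q (cvec y) (cvec \<alpha>) \<noteq> polarC q (cvec y) (cvec \<beta>)"
    by (simp add: polarC_cvec polar_rules polar_commute)
  then show ?thesis using radC_dual_closed(1)[of q]
    by (intro exI[of _ "cvec y"] exI[of _ 0]) (simp add: cartan_weight_def dual_weight_def)
next
  case True
  then have rad: "cvec (\<alpha> - \<beta>) \<in> radC q" unfolding radC_def by (intro vec.span_base imageI)
  obtain i where i: "cvec (\<alpha> - \<beta>) $ i \<noteq> 0"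
    using assms by (auto simp: cvec_def vec_eq_iff)
  define \<xi> where "\<xi> v = (if v \<in> radC q then v $ i else 0)" for v :: "complex ^ 'n::{finite,linorder}"
  have \<xi>: "\<xi> \<in> radC_dual q" by (simp add: radC_dual_def \<xi>_def radC_subspace)
  have "dual_weight \<xi> (\<alpha> - \<beta>) \<noteq> 0" using i rad by (simp only: dual_weight_def rho_rules \<xi>_def if_True not_False_eq_True)
  moreover have "dual_weight \<xi> \<alpha> = dual_weight \<xi> (\<alpha> - \<beta>) + dual_weight \<xi> \<beta>"
    using dual_weight_rules(1)[OF \<xi>, of "\<alpha> - \<beta>" \<beta>] by simp
  ultimately show ?thesis using \<xi>
    by (intro exI[of _ 0] exI[of _ \<xi>]) (simp add: cartan_weight_def polarC_rules)
qed

end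

section \<open>The bracket of the root algebra\<close>

lemma lookup_map_scale_vec [simp]:
  "Poly_Mapping.lookup (Poly_Mapping.map ((*s) (c::complex)) u) k = c *s Poly_Mapping.lookup u k"
  by (simp add: Poly_Mapping.map.rep_eq when_def)

text \<open>All parts of the bracket are sums over the support of a finitely supported function; writing them
  in one form makes their additivity a single lemma.\<close>

definition key_sum :: "('k \<Rightarrow> 'a::zero \<Rightarrow> 'c::comm_monoid_add) \<Rightarrow> ('k \<Rightarrow>\<^sub>0 'a) \<Rightarrow> 'c" where
  "key_sum f x = (\<Sum>k\<in>Poly_Mapping.keys x. f k (Poly_Mapping.lookup x k))"

lemma key_sum_add:
  assumes "\<And>k v w. f k (v + w) = f k v + f k w"
  shows "key_sum f (x + y) = key_sum f x + key_sum (f :: 'k \<Rightarrow> 'a::monoid_add \<Rightarrow> 'c::ab_group_add) y"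
proof -
  have "f k 0 = 0" for k using assms[of k 0 0] by simp
  then show ?thesis unfolding key_sum_def by (rule setsum_keys_plus_distrib) (simp add: assms)
qed

lemma key_sum_single: "f k 0 = 0 \<Longrightarrow> key_sum f (Poly_Mapping.single k v) = f k v"
  by (simp add: key_sum_def)

lemma key_sum_fun_add:
  "key_sum (\<lambda>k v. f k v + g k v) x = key_sum f x + key_sum (g :: 'k \<Rightarrow> 'a::zero \<Rightarrow> 'c::comm_monoid_add) x"
  by (simp add: key_sum_def sum.distrib)

lemma key_sum_map:
  assumes "g 0 = 0" "\<And>k. f k 0 = 0"
  shows "key_sum f (Poly_Mapping.map g x) = key_sum (\<lambda>k v. f k (g v)) x"
proof -
  have l: "Poly_Mapping.lookup (Poly_Mapping.map g x) k = g (Poly_Mapping.lookup x k)" for k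
    using assms(1) by (simp add: Poly_Mapping.map.rep_eq when_def)
  have "Poly_Mapping.keys (Poly_Mapping.map g x) \<subseteq> Poly_Mapping.keys x"
    using assms(1) by (auto simp: in_keys_iff l)
  then show ?thesis unfolding key_sum_def
    by (subst sum_keys_superset[where f = f, of "Poly_Mapping.keys x"]) (simp_all add: assms l)
qed

lemma scale_elt_simp [simp]: "scale_elt c (a, u, \<xi>) =
    (Poly_Mapping.map ((*) c) a, Poly_Mapping.map ((*s) c) u, \<lambda>v. c * \<xi> v)"
  by (simp add: scale_elt_def)

lemma scale_elt_rules:
  "scale_elt c (x + y) = scale_elt c x + scale_elt c y"
  "scale_elt (a + b) x = scale_elt a x + scale_elt b x"
  "scale_elt a (scale_elt b x) = scale_elt (a * b) x"
  "scale_elt 1 x = x" "scale_elt 0 x = 0" "scale_elt c 0 = 0"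
  "scale_elt (- c) x = - scale_elt c x" "scale_elt c (- x) = - scale_elt c x"
  "scale_elt c (x - y) = scale_elt c x - scale_elt c y"
  by (cases x; cases y; auto simp: zero_prod_def fun_eq_iff lookup_add lookup_minus algebra_simps
      vec.scale_left_distrib vec.scale_right_distrib vec.scale_right_diff_distrib
      intro!: poly_mapping_eqI)+

lemma scale_elt_sum: "scale_elt c (sum f A) = (\<Sum>a\<in>A. scale_elt c (f a))"
  by (rule additive_sum) (rule scale_elt_rules)

lemma pi_elt_rules:
  "pi_elt \<sigma> (v + w) = pi_elt \<sigma> v + pi_elt \<sigma> w" "scale_elt c (pi_elt \<sigma> v) = pi_elt \<sigma> (c *s v)"
  "pi_elt \<sigma> 0 = 0" "pi_elt \<sigma> (- v) = - pi_elt \<sigma> v"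
  by (auto simp: pi_elt_def zero_prod_def fun_eq_iff lookup_single single_add single_uminus when_def
      intro!: poly_mapping_eqI)

definition dual_elt :: "(complex ^ 'n \<Rightarrow> complex) \<Rightarrow> 'n::finite root_elt" where
  "dual_elt \<xi> = (0, 0, \<xi>)"

lemma dual_elt_rules:
  "dual_elt (\<xi> + \<zeta>) = dual_elt \<xi> + dual_elt \<zeta>" "scale_elt c (dual_elt \<xi>) = dual_elt (\<lambda>v. c * \<xi> v)"
  by (auto simp: dual_elt_def intro!: poly_mapping_eqI)

context nonneg_unit_form
begin

abbreviation bracket ("\<lbrakk>_,_\<rbrakk>") where "bracket x y \<equiv> root_bracket q B \<rho> x y"

lemma bracket_key_sums:
  "root_bracket q B \<rho> (a, u, \<xi>) (b, w, \<zeta>) =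
    key_sum (\<lambda>\<sigma> v. key_sum (\<lambda>\<tau> w. bracket_pi_pi q B \<sigma> v \<tau> w) w) u +
    key_sum (\<lambda>\<sigma> v. key_sum (\<lambda>\<beta> t. scale_elt t (bracket_pi_e q B \<sigma> v \<beta>)) b) u -
    key_sum (\<lambda>\<tau> w. key_sum (\<lambda>\<alpha> s. scale_elt s (bracket_pi_e q B \<tau> w \<alpha>)) a) w +
    key_sum (\<lambda>\<alpha> s. key_sum (\<lambda>\<beta> t. scale_elt (s * t) (bracket_e_e q B \<alpha> \<beta>)) b) a +
    (key_sum (\<lambda>\<beta> t. scale_elt t (scale_elt (dual_weight \<xi> \<beta>) (e_elt \<beta>))) b +
     key_sum (\<lambda>\<tau> w. scale_elt (dual_weight \<xi> \<tau>) (pi_elt \<tau> w)) w) -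
    (key_sum (\<lambda>\<beta> t. scale_elt t (scale_elt (dual_weight \<zeta> \<beta>) (e_elt \<beta>))) a +
     key_sum (\<lambda>\<tau> w. scale_elt (dual_weight \<zeta> \<tau>) (pi_elt \<tau> w)) u)"
  by (simp add: root_bracket_def bracket_dual_def key_sum_def dual_weight_def)

lemma bracket_pi_pi_rules:
  "bracket_pi_pi q B \<sigma> (v + v') \<tau> w = bracket_pi_pi q B \<sigma> v \<tau> w + bracket_pi_pi q B \<sigma> v' \<tau> w"
  "bracket_pi_pi q B \<sigma> v \<tau> (w + w') = bracket_pi_pi q B \<sigma> v \<tau> w + bracket_pi_pi q B \<sigma> v \<tau> w'"
  "bracket_pi_pi q B \<sigma> (r *s v) \<tau> w = scale_elt r (bracket_pi_pi q B \<sigma> v \<tau> w)"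
  "bracket_pi_pi q B \<sigma> v \<tau> (r *s w) = scale_elt r (bracket_pi_pi q B \<sigma> v \<tau> w)"
  by (simp_all add: bracket_pi_pi_def polarC_rules scale_elt_rules algebra_simps)

lemma bracket_pi_e_rules:
  "bracket_pi_e q B \<sigma> (v + v') \<beta> = bracket_pi_e q B \<sigma> v \<beta> + bracket_pi_e q B \<sigma> v' \<beta>"
  "bracket_pi_e q B \<sigma> (r *s v) \<beta> = scale_elt r (bracket_pi_e q B \<sigma> v \<beta>)"
  by (simp_all add: bracket_pi_e_def polarC_rules scale_elt_rules algebra_simps)

lemma bracket_pi_pi_fun_rules:
  "bracket_pi_pi q B \<sigma> (v + v') = (\<lambda>\<tau> w. bracket_pi_pi q B \<sigma> v \<tau> w + bracket_pi_pi q B \<sigma> v' \<tau> w)"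
  "bracket_pi_pi q B \<sigma> (r *s v) = (\<lambda>\<tau> w. scale_elt r (bracket_pi_pi q B \<sigma> v \<tau> w))"
  "bracket_pi_pi q B \<sigma> 0 = (\<lambda>\<tau> w. 0)"
    by (simp_all add: fun_eq_iff bracket_pi_pi_rules)
      (simp add: bracket_pi_pi_def polarC_rules scale_elt_rules)

lemma bracket_add:
  "\<lbrakk>x + x', y\<rbrakk> = \<lbrakk>x, y\<rbrakk> + \<lbrakk>x', y\<rbrakk>" "\<lbrakk>y, x + x'\<rbrakk> = \<lbrakk>y, x\<rbrakk> + \<lbrakk>y, x'\<rbrakk>"
proof -
  have dw: "dual_weight (\<xi> + \<zeta>) \<alpha> = dual_weight \<xi> \<alpha> + dual_weight \<zeta> \<alpha>" for \<xi> \<zeta> \<alpha>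
    by (simp add: dual_weight_def)
  note rules = key_sum_add key_sum_fun_add bracket_pi_pi_fun_rules bracket_pi_pi_rules bracket_pi_e_rules scale_elt_rules(1,2)
    dw distrib_left distrib_right pi_elt_rules(1)
  show "\<lbrakk>x + x', y\<rbrakk> = \<lbrakk>x, y\<rbrakk> + \<lbrakk>x', y\<rbrakk>"
    by (cases x; cases x'; cases y; simp only: bracket_key_sums add_Pair rules; simp add: algebra_simps)
  show "\<lbrakk>y, x + x'\<rbrakk> = \<lbrakk>y, x\<rbrakk> + \<lbrakk>y, x'\<rbrakk>"
    by (cases x; cases x'; cases y; simp only: bracket_key_sums add_Pair rules; simp add: algebra_simps)
qed

lemma bracket_scale: "\<lbrakk>scale_elt r x, y\<rbrakk> = scale_elt r \<lbrakk>x, y\<rbrakk>" "\<lbrakk>y, scale_elt r x\<rbrakk> = scale_elt r \<lbrakk>y, x\<rbrakk>"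
proof -
  have dw: "dual_weight (\<lambda>v. r * \<xi> v) \<alpha> = r * dual_weight \<xi> \<alpha>" for \<xi> \<alpha>
    by (simp add: dual_weight_def)
  have z: "bracket_pi_pi q B \<sigma> 0 \<tau> w = 0" "bracket_pi_pi q B \<sigma> v \<tau> 0 = 0" "bracket_pi_e q B \<sigma> 0 \<beta> = 0" for \<sigma> v \<tau> w \<beta>
    by (simp_all add: bracket_pi_pi_def bracket_pi_e_def polarC_rules scale_elt_rules)
  have ks: "scale_elt r (key_sum f k) = key_sum (\<lambda>k v. scale_elt r (f k v)) k" for f :: "'k \<Rightarrow> 'v::zero \<Rightarrow> _" and k
    by (simp add: key_sum_def scale_elt_sum)
  have kz: "key_sum (\<lambda>k v. 0) k = (0 :: 'n root_elt)" for k :: "'k \<Rightarrow>\<^sub>0 'v::zero" by (simp add: key_sum_def)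
  note rules = key_sum_map z kz ks dw bracket_pi_pi_fun_rules bracket_pi_pi_rules bracket_pi_e_rules scale_elt_rules pi_elt_rules
  show "\<lbrakk>scale_elt r x, y\<rbrakk> = scale_elt r \<lbrakk>x, y\<rbrakk>"
    by (cases x; cases y) (simp add: bracket_key_sums rules mult_ac)
  show "\<lbrakk>y, scale_elt r x\<rbrakk> = scale_elt r \<lbrakk>y, x\<rbrakk>"
    by (cases x; cases y) (simp add: bracket_key_sums rules mult_ac)
qed

lemma bracket_zero [simp]: "\<lbrakk>0, y\<rbrakk> = 0" "\<lbrakk>y, 0\<rbrakk> = 0"
  using bracket_scale(1)[of 0 0 y] bracket_scale(2)[of y 0 0] by (simp_all only: scale_elt_rules)

lemma bracket_minus [simp]: "\<lbrakk>- x, y\<rbrakk> = - \<lbrakk>x, y\<rbrakk>" "\<lbrakk>y, - x\<rbrakk> = - \<lbrakk>y, x\<rbrakk>"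
  using bracket_scale(1)[of "-1" x y] bracket_scale(2)[of y "-1" x] by (simp_all only: scale_elt_rules)

lemma bracket_generators:
  "\<lbrakk>pi_elt \<sigma> v, pi_elt \<tau> w\<rbrakk> = pi_elt (\<sigma> + \<tau>) ((\<epsilon> \<sigma> \<tau> * polarC q v w) *s cvec \<sigma>)"
  "\<lbrakk>pi_elt \<sigma> v, e_elt \<beta>\<rbrakk> = scale_elt (\<epsilon> \<sigma> \<beta> * polarC q v (cvec \<beta>)) (e_elt (\<beta> + \<sigma>))"
  "\<lbrakk>e_elt \<beta>, pi_elt \<sigma> v\<rbrakk> = - scale_elt (\<epsilon> \<sigma> \<beta> * polarC q v (cvec \<beta>)) (e_elt (\<beta> + \<sigma>))"
  "\<lbrakk>e_elt \<alpha>, e_elt \<beta>\<rbrakk> = bracket_e_e q B \<alpha> \<beta>"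
  "\<lbrakk>dual_elt \<xi>, e_elt \<beta>\<rbrakk> = scale_elt (dual_weight \<xi> \<beta>) (e_elt \<beta>)"
  "\<lbrakk>e_elt \<beta>, dual_elt \<xi>\<rbrakk> = - scale_elt (dual_weight \<xi> \<beta>) (e_elt \<beta>)"
  "\<lbrakk>dual_elt \<xi>, pi_elt \<tau> w\<rbrakk> = scale_elt (dual_weight \<xi> \<tau>) (pi_elt \<tau> w)"
  "\<lbrakk>pi_elt \<tau> w, dual_elt \<xi>\<rbrakk> = - scale_elt (dual_weight \<xi> \<tau>) (pi_elt \<tau> w)"
  "\<lbrakk>dual_elt \<xi>, dual_elt \<zeta>\<rbrakk> = 0"
proof -
  have dw: "dual_weight 0 \<alpha> = 0" for \<alpha> by (simp add: dual_weight_def)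
  have kz: "key_sum f 0 = (0 :: 'n root_elt)" for f :: "'k \<Rightarrow> 'v::zero \<Rightarrow> _" by (simp add: key_sum_def)
  have kz': "key_sum (\<lambda>k v. 0) k = (0 :: 'n root_elt)" for k :: "'k \<Rightarrow>\<^sub>0 'v::zero" by (simp add: key_sum_def)
  have z: "bracket_pi_pi q B \<sigma> 0 \<tau> w = 0" "bracket_pi_pi q B \<sigma> v \<tau> 0 = 0" "bracket_pi_e q B \<sigma> 0 \<beta> = 0" for \<sigma> v \<tau> w \<beta>
    by (simp_all add: bracket_pi_pi_def bracket_pi_e_def polarC_rules scale_elt_rules)
  note rules = bracket_key_sums dw kz kz' z polarC_rules key_sum_single scale_elt_rules bracket_pi_pi_def bracket_pi_e_def
  show "\<lbrakk>pi_elt \<sigma> v, pi_elt \<tau> w\<rbrakk> = pi_elt (\<sigma> + \<tau>) ((\<epsilon> \<sigma> \<tau> * polarC q v w) *s cvec \<sigma>)"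
    unfolding pi_elt_rules(2)[symmetric] pi_elt_def[of \<sigma> v] pi_elt_def[of \<tau> w] by (simp add: rules pi_elt_rules del: scale_elt_simp)
  show "\<lbrakk>pi_elt \<sigma> v, e_elt \<beta>\<rbrakk> = scale_elt (\<epsilon> \<sigma> \<beta> * polarC q v (cvec \<beta>)) (e_elt (\<beta> + \<sigma>))"
    unfolding pi_elt_def[of \<sigma> v] e_elt_def[of \<beta>] by (simp add: rules pi_elt_rules del: scale_elt_simp)
  show "\<lbrakk>e_elt \<beta>, pi_elt \<sigma> v\<rbrakk> = - scale_elt (\<epsilon> \<sigma> \<beta> * polarC q v (cvec \<beta>)) (e_elt (\<beta> + \<sigma>))"
    unfolding pi_elt_def[of \<sigma> v] e_elt_def[of \<beta>] by (simp add: rules pi_elt_rules del: scale_elt_simp)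
  show "\<lbrakk>e_elt \<alpha>, e_elt \<beta>\<rbrakk> = bracket_e_e q B \<alpha> \<beta>"
    unfolding e_elt_def[of \<alpha>] e_elt_def[of \<beta>] by (simp add: rules del: scale_elt_simp)
  show "\<lbrakk>dual_elt \<xi>, e_elt \<beta>\<rbrakk> = scale_elt (dual_weight \<xi> \<beta>) (e_elt \<beta>)"
    unfolding dual_elt_def[of \<xi>] e_elt_def[of \<beta>, abs_def] by (simp add: rules e_elt_def del: scale_elt_simp)
  show "\<lbrakk>e_elt \<beta>, dual_elt \<xi>\<rbrakk> = - scale_elt (dual_weight \<xi> \<beta>) (e_elt \<beta>)"
    unfolding dual_elt_def[of \<xi>] e_elt_def[of \<beta>, abs_def] by (simp add: rules e_elt_def del: scale_elt_simp)
  show "\<lbrakk>dual_elt \<xi>, pi_elt \<tau> w\<rbrakk> = scale_elt (dual_weight \<xi> \<tau>) (pi_elt \<tau> w)"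
    unfolding dual_elt_def[of \<xi>] pi_elt_def[of \<tau> w] by (simp add: rules pi_elt_rules del: scale_elt_simp)
      (auto simp: pi_elt_def fun_eq_iff intro!: poly_mapping_eqI)
  show "\<lbrakk>pi_elt \<tau> w, dual_elt \<xi>\<rbrakk> = - scale_elt (dual_weight \<xi> \<tau>) (pi_elt \<tau> w)"
    unfolding dual_elt_def[of \<xi>] pi_elt_def[of \<tau> w] by (simp add: rules pi_elt_rules del: scale_elt_simp)
      (auto simp: pi_elt_def fun_eq_iff intro!: poly_mapping_eqI)
  show "\<lbrakk>dual_elt \<xi>, dual_elt \<zeta>\<rbrakk> = 0"
    unfolding dual_elt_def[of \<xi>] dual_elt_def[of \<zeta>] by (simp add: rules del: scale_elt_simp)
qed

end

section \<open>The quotients N and E of the algebra of triples\<close>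

lemma sum_single_lookup: "(\<Sum>k\<in>Poly_Mapping.keys x. Poly_Mapping.single k (Poly_Mapping.lookup x k)) = x"
proof (rule poly_mapping_eqI)
  fix k
  have "Poly_Mapping.lookup (\<Sum>k\<in>Poly_Mapping.keys x. Poly_Mapping.single k (Poly_Mapping.lookup x k)) k =
      (\<Sum>j\<in>Poly_Mapping.keys x. if j = k then Poly_Mapping.lookup x j else 0)"
    by (auto simp: lookup_sum lookup_single when_def intro!: sum.cong)
  then show "Poly_Mapping.lookup (\<Sum>k\<in>Poly_Mapping.keys x. Poly_Mapping.single k (Poly_Mapping.lookup x k)) k =
      Poly_Mapping.lookup x k"
    by (simp add: in_keys_iff)
qed

lemma root_elt_expand:
  "(a, u, \<xi>) = (\<Sum>\<alpha>\<in>Poly_Mapping.keys a. scale_elt (Poly_Mapping.lookup a \<alpha>) (e_elt \<alpha>)) +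
    (\<Sum>\<sigma>\<in>Poly_Mapping.keys u. pi_elt \<sigma> (Poly_Mapping.lookup u \<sigma>)) + dual_elt \<xi>"
proof -
  have "(\<Sum>\<alpha>\<in>Poly_Mapping.keys a. scale_elt (Poly_Mapping.lookup a \<alpha>) (e_elt \<alpha>)) =
      (\<Sum>\<alpha>\<in>Poly_Mapping.keys a. (Poly_Mapping.single \<alpha> (Poly_Mapping.lookup a \<alpha>), 0, 0))"
    by (auto simp: e_elt_def fun_eq_iff intro!: sum.cong poly_mapping_eqI)
  also have "\<dots> = (\<Sum>\<alpha>\<in>Poly_Mapping.keys a. Poly_Mapping.single \<alpha> (Poly_Mapping.lookup a \<alpha>), 0, 0)"
    by (rule additive_sum[of "\<lambda>a. (a, 0, 0)", symmetric]) simp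
  finally have A: "(\<Sum>\<alpha>\<in>Poly_Mapping.keys a. scale_elt (Poly_Mapping.lookup a \<alpha>) (e_elt \<alpha>)) = (a, 0, 0)"
    by (simp add: sum_single_lookup)
  have "(\<Sum>\<sigma>\<in>Poly_Mapping.keys u. pi_elt \<sigma> (Poly_Mapping.lookup u \<sigma>)) =
      (0, \<Sum>\<sigma>\<in>Poly_Mapping.keys u. Poly_Mapping.single \<sigma> (Poly_Mapping.lookup u \<sigma>), 0)"
    unfolding pi_elt_def by (rule additive_sum[of "\<lambda>a. (0, a, 0)", symmetric]) simp
  then have U: "(\<Sum>\<sigma>\<in>Poly_Mapping.keys u. pi_elt \<sigma> (Poly_Mapping.lookup u \<sigma>)) = (0, u, 0)"
    by (simp add: sum_single_lookup)
  show ?thesis unfolding A U by (simp add: dual_elt_def)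
qed

context nonneg_unit_form
begin

abbreviation "RA \<equiv> root_alg q B \<rho>"

lemma RA_simps [simp]:
  "x \<otimes>\<^bsub>RA\<^esub> y = \<lbrakk>x, y\<rbrakk>" "x \<oplus>\<^bsub>RA\<^esub> y = x + y" "\<zero>\<^bsub>RA\<^esub> = 0" "r \<odot>\<^bsub>RA\<^esub> x = scale_elt r x"
  by (simp_all add: root_alg_def)

lemma RA_carrier: "(a, u, \<xi>) \<in> carrier RA \<longleftrightarrow> Poly_Mapping.keys a \<subseteq> real_roots q \<and>
    Poly_Mapping.keys u \<subseteq> imag_roots q \<and> \<xi> \<in> radC_dual q"
  by (simp add: root_alg_def)

lemma RA_closed [simp]:
  "0 \<in> carrier RA" "x \<in> carrier RA \<Longrightarrow> y \<in> carrier RA \<Longrightarrow> x + y \<in> carrier RA"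
  "x \<in> carrier RA \<Longrightarrow> scale_elt r x \<in> carrier RA"
proof -
  show "0 \<in> carrier RA" by (simp add: zero_prod_def RA_carrier radC_dual_closed)
  show "x \<in> carrier RA \<Longrightarrow> y \<in> carrier RA \<Longrightarrow> x + y \<in> carrier RA"
    by (cases x; cases y)
      (auto simp: RA_carrier radC_dual_closed in_keys_iff lookup_add subset_iff; metis add_0)
  show "x \<in> carrier RA \<Longrightarrow> scale_elt r x \<in> carrier RA"
    by (cases x) (auto simp: RA_carrier radC_dual_closed in_keys_iff subset_iff)
qed

lemma RA_minus_closed [simp]: "x \<in> carrier RA \<Longrightarrow> - x \<in> carrier RA"
  using RA_closed(3)[of x "-1"] by (simp only: scale_elt_rules)

lemma RA_generators_closed [simp]:
  "q \<alpha> = 1 \<Longrightarrow> e_elt \<alpha> \<in> carrier RA" "q \<sigma> = 0 \<Longrightarrow> pi_elt \<sigma> v \<in> carrier RA"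
  "\<xi> \<in> radC_dual q \<Longrightarrow> dual_elt \<xi> \<in> carrier RA"
  by (simp_all add: e_elt_def pi_elt_def dual_elt_def RA_carrier radC_dual_closed real_roots_def imag_roots_def)

lemma RA_induct [consumes 1, case_names e pi dual add scale]:
  assumes "x \<in> carrier RA"
    and e: "\<And>\<alpha>. q \<alpha> = 1 \<Longrightarrow> P (e_elt \<alpha>)" and pi: "\<And>\<sigma> v. q \<sigma> = 0 \<Longrightarrow> P (pi_elt \<sigma> v)"
    and dual: "\<And>\<xi>. \<xi> \<in> radC_dual q \<Longrightarrow> P (dual_elt \<xi>)"
    and add: "\<And>x y. x \<in> carrier RA \<Longrightarrow> y \<in> carrier RA \<Longrightarrow> P x \<Longrightarrow> P y \<Longrightarrow> P (x + y)"
    and scale: "\<And>r x. x \<in> carrier RA \<Longrightarrow> P x \<Longrightarrow> P (scale_elt r x)"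
  shows "P x"
proof -
  obtain a u \<xi> where x: "x = (a, u, \<xi>)" by (cases x)
  have k: "q \<alpha> = 1" if "\<alpha> \<in> Poly_Mapping.keys a" for \<alpha>
    using assms(1) that by (auto simp: x RA_carrier real_roots_def)
  have l: "q \<sigma> = 0" if "\<sigma> \<in> Poly_Mapping.keys u" for \<sigma>
    using assms(1) that by (auto simp: x RA_carrier imag_roots_def)
  have \<xi>: "\<xi> \<in> radC_dual q" using assms(1) by (simp add: x RA_carrier)
  have 0: "P 0" using scale[OF RA_generators_closed(3)[OF \<xi>] dual[OF \<xi>], of 0] by (simp only: scale_elt_rules)
  have s: "P (sum f A) \<and> sum f A \<in> carrier RA" if "finite A" "\<And>a. a \<in> A \<Longrightarrow> P (f a) \<and> f a \<in> carrier RA"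
    for f :: "'z \<Rightarrow> _" and A
    using that by (induction A rule: finite_induct) (simp_all add: 0 add)
  have 1: "P (\<Sum>\<alpha>\<in>Poly_Mapping.keys a. scale_elt (Poly_Mapping.lookup a \<alpha>) (e_elt \<alpha>)) \<and>
      (\<Sum>\<alpha>\<in>Poly_Mapping.keys a. scale_elt (Poly_Mapping.lookup a \<alpha>) (e_elt \<alpha>)) \<in> carrier RA"
    by (rule s) (use k e scale in auto)
  have 2: "P (\<Sum>\<sigma>\<in>Poly_Mapping.keys u. pi_elt \<sigma> (Poly_Mapping.lookup u \<sigma>)) \<and>
      (\<Sum>\<sigma>\<in>Poly_Mapping.keys u. pi_elt \<sigma> (Poly_Mapping.lookup u \<sigma>)) \<in> carrier RA"
    by (rule s) (use l pi in auto)
  show ?thesis unfolding x root_elt_expand[of a u \<xi>]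
    by (intro add RA_closed RA_generators_closed dual) (use 1 2 \<xi> in auto)
qed

lemma bracket_e_e_cases:
  assumes "q \<alpha> = 1" "q \<beta> = 1"
  shows "\<lbrakk>e_elt \<alpha>, e_elt \<beta>\<rbrakk> = (if polar q \<alpha> \<beta> = -1 then scale_elt (\<epsilon> \<alpha> \<beta>) (e_elt (\<alpha> + \<beta>))
     else if polar q \<alpha> \<beta> = -2 then pi_elt (\<alpha> + \<beta>) (\<epsilon> \<alpha> \<beta> *s cvec \<alpha>) else 0)"
  using assms by (auto simp: bracket_generators bracket_e_e_def real_roots_def imag_roots_def q_rules pi_elt_rules)

lemma bracket_closed: "x \<in> carrier RA \<Longrightarrow> y \<in> carrier RA \<Longrightarrow> \<lbrakk>x, y\<rbrakk> \<in> carrier RA"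
proof (induction x rule: RA_induct)
  case (e \<alpha>)
  from e(2) show ?case
  proof (induction y rule: RA_induct)
    case (e \<beta>)
    then show ?case using \<open>q \<alpha> = 1\<close> by (auto simp: bracket_e_e_cases q_rules)
  qed (use \<open>q \<alpha> = 1\<close> in \<open>simp_all add: bracket_generators(1-3,5-) bracket_add bracket_scale q_add_imag\<close>)
next
  case (pi \<sigma> v)
  from pi(2) show ?case
    by (induction y rule: RA_induct)
      (use \<open>q \<sigma> = 0\<close> in \<open>simp_all add: bracket_generators(1-3,5-) bracket_add bracket_scale q_add_imag\<close>)
next
  case (dual \<xi>)
  from dual(2) show ?case
    by (induction y rule: RA_induct)
      (simp_all add: bracket_generators(1-3,5-) bracket_add bracket_scale)
qed (simp_all add: bracket_add bracket_scale)

lemma RA_bilinear_algebra: "bilinear_algebra RA"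
proof (rule bilinear_algebraI)
  show "complex_module RA"
    by (rule complex_moduleI) (simp_all add: scale_elt_rules add.assoc add.commute)
qed (simp_all add: bracket_closed bracket_add bracket_scale)

text \<open>The kernels of the passages from triples to \<open>N\<close> and on to \<open>E\<close> consist of families of
  vectors in the radical, one for each imaginary root. The bracket with such a family is zero
  except for the action of the functionals, which rescales it degree by degree.\<close>

definition radical_families :: "(int ^ 'n::{finite,linorder} \<Rightarrow> (complex ^ 'n::{finite,linorder}) set) \<Rightarrow> 'n::{finite,linorder} root_elt set" where
  "radical_families S = {(a, u, \<xi>). a = 0 \<and> \<xi> = 0 \<and> Poly_Mapping.keys u \<subseteq> imag_roots q \<and>
     (\<forall>\<sigma>. Poly_Mapping.lookup u \<sigma> \<in> S \<sigma>)}"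

lemma bracket_radical_family:
  assumes "\<And>\<sigma>. Poly_Mapping.lookup u \<sigma> \<in> radC q"
  shows "\<exists>u'. (\<forall>\<tau>. Poly_Mapping.lookup u' \<tau> = dual_weight (snd (snd x)) \<tau> *s Poly_Mapping.lookup u \<tau>) \<and>
    \<lbrakk>x, (0, u, 0)\<rbrakk> = (0, u', 0) \<and> \<lbrakk>(0, u, 0), x\<rbrakk> = (0, - u', 0)"
proof -
  obtain a w \<xi> where x: "x = (a, w, \<xi>)" by (cases x)
  define u' where "u' = (\<Sum>\<tau>\<in>Poly_Mapping.keys u. Poly_Mapping.single \<tau> (dual_weight \<xi> \<tau> *s Poly_Mapping.lookup u \<tau>))"
  have dw: "dual_weight 0 \<alpha> = 0" for \<alpha> by (simp add: dual_weight_def)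
  have kz: "key_sum f 0 = (0 :: 'n::{finite,linorder} root_elt)" for f :: "'k \<Rightarrow> 'v::zero \<Rightarrow> _" by (simp add: key_sum_def)
  have kz': "key_sum (\<lambda>k v. 0) k = (0 :: 'n::{finite,linorder} root_elt)" for k :: "'k \<Rightarrow>\<^sub>0 'v::zero" by (simp add: key_sum_def)
  have pp: "bracket_pi_pi q B \<sigma> v \<tau> (Poly_Mapping.lookup u \<tau>) = 0" "bracket_pi_pi q B \<tau> (Poly_Mapping.lookup u \<tau>) \<sigma> v = 0"
    "bracket_pi_e q B \<tau> (Poly_Mapping.lookup u \<tau>) \<beta> = 0" for \<sigma> v \<tau> \<beta>
    using radC_polarC[OF assms] by (simp_all add: bracket_pi_pi_def bracket_pi_e_def scale_elt_rules)
  have 1: "key_sum (\<lambda>\<tau> w. bracket_pi_pi q B \<sigma> v \<tau> w) u = 0" for \<sigma> v by (simp add: key_sum_def pp)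
  have 2: "key_sum (\<lambda>\<sigma> v. key_sum (\<lambda>\<tau> w. bracket_pi_pi q B \<sigma> v \<tau> w) w) u = 0"
    by (simp add: key_sum_def pp)
  have 3: "key_sum (\<lambda>\<sigma> v. key_sum (\<lambda>\<beta> t. scale_elt t (bracket_pi_e q B \<sigma> v \<beta>)) a) u = 0"
    by (simp add: key_sum_def pp scale_elt_rules)
  have 4: "key_sum (\<lambda>\<tau> w. scale_elt (dual_weight \<xi> \<tau>) (pi_elt \<tau> w)) u = (0, u', 0)"
  proof -
    have "key_sum (\<lambda>\<tau> w. scale_elt (dual_weight \<xi> \<tau>) (pi_elt \<tau> w)) u =
      (\<Sum>\<tau>\<in>Poly_Mapping.keys u. (0, Poly_Mapping.single \<tau> (dual_weight \<xi> \<tau> *s Poly_Mapping.lookup u \<tau>), 0))"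
      unfolding key_sum_def pi_elt_rules by (simp add: pi_elt_def)
    also have "\<dots> = (0, u', 0)" unfolding u'_def
      by (rule additive_sum[of "\<lambda>a. (0, a, 0)", symmetric]) simp
    finally show ?thesis .
  qed
  have "Poly_Mapping.lookup u' \<tau> = dual_weight \<xi> \<tau> *s Poly_Mapping.lookup u \<tau>" for \<tau>
  proof -
    have "Poly_Mapping.lookup u' \<tau> =
        (\<Sum>\<sigma>\<in>Poly_Mapping.keys u. if \<sigma> = \<tau> then dual_weight \<xi> \<sigma> *s Poly_Mapping.lookup u \<sigma> else 0)"
      unfolding u'_def by (auto simp: lookup_sum lookup_single when_def intro!: sum.cong)
    then show ?thesis by (simp add: in_keys_iff)
  qed
  moreover have "\<lbrakk>x, (0, u, 0)\<rbrakk> = (0, u', 0)" "\<lbrakk>(0, u, 0), x\<rbrakk> = (0, - u', 0)"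
    unfolding x bracket_key_sums 1 2 3 4
    by (simp_all add: kz kz' dw scale_elt_rules del: scale_elt_simp)
  ultimately show ?thesis by (auto simp: x)
qed

lemma radical_families_ideal:
  assumes sub: "\<And>\<sigma>. vec.subspace (S \<sigma>)" and rad: "\<And>\<sigma>. q \<sigma> = 0 \<Longrightarrow> S \<sigma> \<subseteq> radC q"
  shows "alg_ideal RA (radical_families S)"
proof -
  interpret bilinear_algebra RA by (rule RA_bilinear_algebra)
  have s: "0 \<in> S \<sigma>" "v \<in> S \<sigma> \<Longrightarrow> w \<in> S \<sigma> \<Longrightarrow> v + w \<in> S \<sigma>" "v \<in> S \<sigma> \<Longrightarrow> r *s v \<in> S \<sigma>" "v \<in> S \<sigma> \<Longrightarrow> - v \<in> S \<sigma>" for \<sigma> v w r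
    using sub[of \<sigma>] by (auto simp: vec.subspace_def vec.subspace_neg)
  have b: "\<lbrakk>x, y\<rbrakk> \<in> radical_families S \<and> \<lbrakk>y, x\<rbrakk> \<in> radical_families S" if y: "y \<in> radical_families S" for x y
  proof -
    obtain u where u: "y = (0, u, 0)" "Poly_Mapping.keys u \<subseteq> imag_roots q" "\<forall>\<sigma>. Poly_Mapping.lookup u \<sigma> \<in> S \<sigma>"
      using y by (auto simp: radical_families_def)
    have "Poly_Mapping.lookup u \<sigma> \<in> radC q" for \<sigma>
    proof (cases "q \<sigma> = 0")
      case True
      then show ?thesis using rad u(3) by blast
    next
      case False
      then have "\<sigma> \<notin> Poly_Mapping.keys u" using u(2) by (auto simp: imag_roots_def)
      then show ?thesis by (simp add: in_keys_iff radC_subspace)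
    qed
    then obtain u' where u': "\<forall>\<tau>. Poly_Mapping.lookup u' \<tau> = dual_weight (snd (snd x)) \<tau> *s Poly_Mapping.lookup u \<tau>"
      "\<lbrakk>x, (0, u, 0)\<rbrakk> = (0, u', 0)" "\<lbrakk>(0, u, 0), x\<rbrakk> = (0, - u', 0)"
      using bracket_radical_family by blast
    then have "Poly_Mapping.keys u' \<subseteq> imag_roots q" using u(2) by (auto simp: in_keys_iff)
    moreover have "Poly_Mapping.keys (- u') = Poly_Mapping.keys u'" by (auto simp: in_keys_iff)
    ultimately show ?thesis unfolding u(1) u'(2,3) using u(3) by (simp add: radical_families_def u'(1) s)
  qed
  show ?thesis unfolding alg_ideal_iff
  proof (intro conjI ballI allI)
    show "radical_families S \<subseteq> carrier RA"
      by (auto simp: radical_families_def RA_carrier radC_dual_closed)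
    show "\<zero>\<^bsub>RA\<^esub> \<in> radical_families S" by (simp add: radical_families_def zero_prod_def s)
    show "x \<oplus>\<^bsub>RA\<^esub> y \<in> radical_families S" if "x \<in> radical_families S" "y \<in> radical_families S" for x y
      using that by (auto simp: radical_families_def lookup_add s in_keys_iff subset_iff; metis add_0)
    show "r \<odot>\<^bsub>RA\<^esub> x \<in> radical_families S" if "x \<in> radical_families S" for r x
      using that by (auto simp: radical_families_def s in_keys_iff fun_eq_iff subset_iff intro!: poly_mapping_eqI)
  qed (use b in simp_all)
qed

text \<open>The kernel of the composite projection from triples to \<open>E\<close>. In degree zero it is zero because \<open>N\<^sub>0\<close>
  maps isomorphically to \<open>E\<^sub>0\<close>.\<close>

definition E_null :: "'n::{finite,linorder} root_elt set" where
  "E_null = radical_families (\<lambda>\<sigma>. if \<sigma> = 0 then {0} else radC q)"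

lemma N_kernel_eq: "N_kernel q = radical_families (\<lambda>\<sigma>. vec.span {cvec \<sigma>})"
  by (simp add: N_kernel_def radical_families_def)

lemma N_kernel_ideal: "alg_ideal RA (N_kernel q)"
  unfolding N_kernel_eq
proof (rule radical_families_ideal)
  show "vec.span {cvec \<sigma>} \<subseteq> radC q" if "q \<sigma> = 0" for \<sigma>
    using imag_root_radC[OF that] vec.span_minimal[of "{cvec \<sigma>}" "radC q"]
    by (simp add: vec.subspace_def radC_subspace)
qed simp

lemma E_null_ideal: "alg_ideal RA E_null"
  unfolding E_null_def
  by (rule radical_families_ideal) (auto simp: vec.subspace_def radC_subspace)

lemma N_kernel_subset: "N_kernel q \<subseteq> E_null"
proof -
  have "Poly_Mapping.lookup u \<sigma> \<in> (if \<sigma> = 0 then {0} else radC q)"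
    if "Poly_Mapping.keys u \<subseteq> imag_roots q" "\<forall>\<sigma>. Poly_Mapping.lookup u \<sigma> \<in> vec.span {cvec \<sigma>}" for u \<sigma>
  proof (cases "q \<sigma> = 0 \<and> \<sigma> \<noteq> 0")
    case True
    have "vec.span {cvec \<sigma>} \<subseteq> radC q"
      using True imag_root_radC[of \<sigma>] vec.span_minimal[of "{cvec \<sigma>}" "radC q"]
      by (simp add: vec.subspace_def radC_subspace)
    then show ?thesis using True that(2) by auto
  next
    case False
    have "Poly_Mapping.lookup u \<sigma> = 0"
    proof (cases "\<sigma> = 0")
      case True
      then show ?thesis using that(2)[rule_format, of 0] by simp
    next
      case False
      then have "\<sigma> \<notin> Poly_Mapping.keys u" using \<open>\<not> (q \<sigma> = 0 \<and> \<sigma> \<noteq> 0)\<close> that(1) by (auto simp: imag_roots_def)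
      then show ?thesis by (simp add: in_keys_iff)
    qed
    then show ?thesis by (simp add: radC_subspace)
  qed
  then have "(0, u, 0) \<in> E_null" if "Poly_Mapping.keys u \<subseteq> imag_roots q"
    "\<forall>\<sigma>. Poly_Mapping.lookup u \<sigma> \<in> vec.span {cvec \<sigma>}" for u
    using that unfolding E_null_def radical_families_def by blast
  then show ?thesis unfolding N_kernel_eq by (auto simp: radical_families_def)
qed

abbreviation "EA \<equiv> E_alg q B \<rho>"

definition E_proj :: "'n::{finite,linorder} root_elt \<Rightarrow> 'n::{finite,linorder} root_elt set set" where
  "E_proj x = E_kernel q B \<rho> +>\<^bsub>N_alg q B \<rho>\<^esub> (N_kernel q +>\<^bsub>RA\<^esub> x)"

lemma E_kernel_eq: "E_kernel q B \<rho> = (\<lambda>x. N_kernel q +>\<^bsub>RA\<^esub> x) ` E_null"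
proof -
  have "{(a, u, \<xi>). a = 0 \<and> \<xi> = 0 \<and> Poly_Mapping.keys u \<subseteq> imag_roots q - {0} \<and>
       (\<forall>\<sigma>. Poly_Mapping.lookup u \<sigma> \<in> radC q)} = E_null"
    unfolding E_null_def radical_families_def
    by (auto simp: in_keys_iff subset_iff radC_subspace split: if_splits)
  then show ?thesis unfolding E_kernel_def by (rule arg_cong)
qed

lemma N_bilinear_algebra: "bilinear_algebra (N_alg q B \<rho>)"
  unfolding N_alg_def by (rule bilinear_algebra.quotient_bilinear_algebra[OF RA_bilinear_algebra N_kernel_ideal])

lemma N_projection: "alg_hom RA (N_alg q B \<rho>) (\<lambda>x. N_kernel q +>\<^bsub>RA\<^esub> x)"
  unfolding N_alg_def by (rule bilinear_algebra.quotient_hom[OF RA_bilinear_algebra N_kernel_ideal])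

lemma N_carrier: "carrier (N_alg q B \<rho>) = (\<lambda>x. N_kernel q +>\<^bsub>RA\<^esub> x) ` carrier RA"
  unfolding N_alg_def by (rule bilinear_algebra.quotient_carrier[OF RA_bilinear_algebra])

lemma E_kernel_ideal: "alg_ideal (N_alg q B \<rho>) (E_kernel q B \<rho>)"
  unfolding E_kernel_eq
  by (rule image_alg_ideal[OF RA_bilinear_algebra N_bilinear_algebra N_projection N_carrier[symmetric] E_null_ideal])

lemma E_bilinear_algebra: "bilinear_algebra EA"
  unfolding E_alg_def by (rule bilinear_algebra.quotient_bilinear_algebra[OF N_bilinear_algebra E_kernel_ideal])

lemma E_proj_hom: "alg_hom RA EA E_proj"
  unfolding E_proj_def E_alg_def
  by (rule alg_hom_compose[OF N_projection bilinear_algebra.quotient_hom[OF N_bilinear_algebra E_kernel_ideal]])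

lemma E_carrier: "carrier EA = E_proj ` carrier RA"
  unfolding E_alg_def bilinear_algebra.quotient_carrier[OF N_bilinear_algebra] N_carrier
  by (simp add: image_image E_proj_def)

lemma E_proj_rules:
  "x \<in> carrier RA \<Longrightarrow> E_proj x \<in> carrier EA"
  "x \<in> carrier RA \<Longrightarrow> y \<in> carrier RA \<Longrightarrow> E_proj (x + y) = E_proj x \<oplus>\<^bsub>EA\<^esub> E_proj y"
  "x \<in> carrier RA \<Longrightarrow> E_proj (scale_elt r x) = r \<odot>\<^bsub>EA\<^esub> E_proj x"
  "x \<in> carrier RA \<Longrightarrow> y \<in> carrier RA \<Longrightarrow> E_proj \<lbrakk>x, y\<rbrakk> = E_proj x \<otimes>\<^bsub>EA\<^esub> E_proj y"
  "E_proj 0 = \<zero>\<^bsub>EA\<^esub>"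
  using alg_homD[OF E_proj_hom] linear_map_zero[OF _ _ alg_homD(5)[OF E_proj_hom]]
    RA_bilinear_algebra E_bilinear_algebra by (simp_all add: bilinear_algebra_def)

lemma E_proj_eq_zero_iff:
  assumes x: "x \<in> carrier RA"
  shows "E_proj x = \<zero>\<^bsub>EA\<^esub> \<longleftrightarrow> x \<in> E_null"
proof -
  interpret R: bilinear_algebra RA by (rule RA_bilinear_algebra)
  interpret N: bilinear_algebra "N_alg q B \<rho>" by (rule N_bilinear_algebra)
  have c: "N_kernel q +>\<^bsub>RA\<^esub> x \<in> carrier (N_alg q B \<rho>)" using x by (simp add: N_carrier)
  have "E_proj x = \<zero>\<^bsub>EA\<^esub> \<longleftrightarrow> N_kernel q +>\<^bsub>RA\<^esub> x \<in> E_kernel q B \<rho>"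
    unfolding E_proj_def E_alg_def by (rule N.quotient_eq_zero_iff[OF E_kernel_ideal c])
  also have "\<dots> \<longleftrightarrow> (\<exists>y\<in>E_null. x \<ominus>\<^bsub>RA\<^esub> y \<in> N_kernel q)"
    using R.ideal_coset_eq_iff[OF N_kernel_ideal x] R.alg_idealD(7)[OF E_null_ideal]
    unfolding E_kernel_eq by (auto simp: image_iff)
  also have "\<dots> \<longleftrightarrow> x \<in> E_null"
  proof
    assume "\<exists>y\<in>E_null. x \<ominus>\<^bsub>RA\<^esub> y \<in> N_kernel q"
    then obtain y where y: "y \<in> E_null" "x \<ominus>\<^bsub>RA\<^esub> y \<in> E_null" using N_kernel_subset by blast
    then have yc: "y \<in> carrier RA" using R.alg_idealD(7)[OF E_null_ideal] by blast
    have "(x \<ominus>\<^bsub>RA\<^esub> y) \<oplus>\<^bsub>RA\<^esub> y \<in> E_null" using y R.alg_idealD(3)[OF E_null_ideal] by blast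
    moreover have "(x \<ominus>\<^bsub>RA\<^esub> y) \<oplus>\<^bsub>RA\<^esub> y = x" using x yc by (simp add: R.diff_eq_smult scale_elt_rules del: scale_elt_simp)
    ultimately show "x \<in> E_null" by simp
  next
    assume "x \<in> E_null"
    then show "\<exists>y\<in>E_null. x \<ominus>\<^bsub>RA\<^esub> y \<in> N_kernel q"
      using R.alg_idealD(2)[OF N_kernel_ideal] x by (intro bexI[of _ x]) (simp_all add: R.diff_eq_smult scale_elt_rules)
  qed
  finally show ?thesis .
qed

lemma E_null_closed:
  "0 \<in> E_null" "x \<in> E_null \<Longrightarrow> y \<in> E_null \<Longrightarrow> x + y \<in> E_null" "x \<in> E_null \<Longrightarrow> scale_elt r x \<in> E_null"
  using bilinear_algebra.alg_idealD(2-4)[OF RA_bilinear_algebra E_null_ideal] by simp_all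

text \<open>The relation \<open>\<pi>\<^sub>\<sigma>(\<sigma>) = 0\<close>, to which every failure of antisymmetry and of the Jacobi identity on
  triples reduces.\<close>

lemma pi_elt_in_E_null: "q \<sigma> = 0 \<Longrightarrow> pi_elt \<sigma> (r *s cvec \<sigma>) \<in> E_null"
  using imag_root_radC[of \<sigma>]
  by (auto simp: E_null_def radical_families_def pi_elt_def imag_roots_def lookup_single when_def radC_subspace)

end

section \<open>The Lie identities in E\<close>

context nonneg_unit_form
begin

definition RA_generators :: "'n::{finite,linorder} root_elt set" where
  "RA_generators = {e_elt \<alpha> | \<alpha>. q \<alpha> = 1} \<union> {pi_elt \<sigma> v | \<sigma> v. q \<sigma> = 0} \<union>
    {dual_elt \<xi> | \<xi>. \<xi> \<in> radC_dual q}"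

lemma RA_generators_induct [consumes 1, case_names gen add scale]:
  assumes "x \<in> carrier RA" "\<And>x. x \<in> RA_generators \<Longrightarrow> P x"
    and "\<And>x y. P x \<Longrightarrow> P y \<Longrightarrow> P (x + y)" "\<And>r x. P x \<Longrightarrow> P (scale_elt r x)"
  shows "P x"
  using assms(1)
  by (rule RA_induct[of x P]) (blast intro: assms(2)[unfolded RA_generators_def], blast intro: assms(2)[unfolded RA_generators_def],
      blast intro: assms(2)[unfolded RA_generators_def], rule assms(3), assumption+, rule assms(4), assumption)

lemma RA_generators_cases:
  assumes "x \<in> RA_generators"
  obtains \<alpha> where "x = e_elt \<alpha>" "q \<alpha> = 1" | \<sigma> v where "x = pi_elt \<sigma> v" "q \<sigma> = 0"
    | \<xi> where "x = dual_elt \<xi>" "\<xi> \<in> radC_dual q"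
  using assms unfolding RA_generators_def by blast

lemma bracket_symmetric_part_e_e:
  assumes "q \<alpha> = 1" "q \<beta> = 1"
  shows "\<lbrakk>e_elt \<alpha>, e_elt \<beta>\<rbrakk> + \<lbrakk>e_elt \<beta>, e_elt \<alpha>\<rbrakk> \<in> E_null"
proof -
  have p: "polar q \<beta> \<alpha> = polar q \<alpha> \<beta>" by (rule polar_commute)
  consider "polar q \<alpha> \<beta> = -1" | "polar q \<alpha> \<beta> = -2" | "polar q \<alpha> \<beta> \<noteq> -1" "polar q \<alpha> \<beta> \<noteq> -2" by blast
  then show ?thesis
  proof cases
    case 1
    then show ?thesis using assms
      by (simp add: bracket_e_e_cases p sgn_cocycle_swap[of \<beta> \<alpha>] add.commute scale_elt_rules E_null_closed)
  next
    case 2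
    have "\<lbrakk>e_elt \<alpha>, e_elt \<beta>\<rbrakk> + \<lbrakk>e_elt \<beta>, e_elt \<alpha>\<rbrakk> = pi_elt (\<alpha> + \<beta>) (\<epsilon> \<alpha> \<beta> *s cvec (\<alpha> + \<beta>))"
      using 2 assms
      by (simp add: bracket_e_e_cases p sgn_cocycle_swap[of \<beta> \<alpha>] add.commute pi_elt_rules(1)[symmetric]
          vec.scale_right_distrib)
    moreover have "q (\<alpha> + \<beta>) = 0" using 2 assms by (simp add: q_rules)
    ultimately show ?thesis by (simp add: pi_elt_in_E_null del: cvec_simps)
  qed (use assms in \<open>simp add: bracket_e_e_cases p E_null_closed\<close>)
qed

lemma bracket_symmetric_part_pi_pi:
  assumes "q \<sigma> = 0" "q \<tau> = 0"
  shows "\<lbrakk>pi_elt \<sigma> v, pi_elt \<tau> w\<rbrakk> + \<lbrakk>pi_elt \<tau> w, pi_elt \<sigma> v\<rbrakk> \<in> E_null"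
proof -
  have p: "polar q \<sigma> \<tau> = 0" using assms(1) by (rule imag_root_polar)
  have "\<lbrakk>pi_elt \<sigma> v, pi_elt \<tau> w\<rbrakk> + \<lbrakk>pi_elt \<tau> w, pi_elt \<sigma> v\<rbrakk> =
      pi_elt (\<sigma> + \<tau>) ((\<epsilon> \<sigma> \<tau> * polarC q v w) *s cvec (\<sigma> + \<tau>))"
    by (simp add: bracket_generators p sgn_cocycle_swap[of \<tau> \<sigma>] polarC_commute[of w v] add.commute
        pi_elt_rules(1)[symmetric] vec.scale_right_distrib)
  moreover have "q (\<sigma> + \<tau>) = 0" using assms by (simp add: q_add_imag)
  ultimately show ?thesis by (simp add: pi_elt_in_E_null del: cvec_simps)
qed

text \<open>On triples the bracket is antisymmetric only modulo the kernel: exchanging two root vectors with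
  imaginary sum \<open>\<sigma>\<close>, or two elements of imaginary degrees with sum \<open>\<sigma>\<close>, leaves a multiple of \<open>\<pi>\<^sub>\<sigma>(\<sigma>)\<close>.\<close>

lemma bracket_symmetric_part:
  assumes "x \<in> carrier RA" "y \<in> carrier RA"
  shows "\<lbrakk>x, y\<rbrakk> + \<lbrakk>y, x\<rbrakk> \<in> E_null"
  using assms(1)
proof (induction x rule: RA_generators_induct)
  case (gen x)
  from assms(2) show ?case
  proof (induction y rule: RA_generators_induct)
    case (gen y)
    then show ?case using \<open>x \<in> RA_generators\<close>
      by (elim RA_generators_cases; hypsubst)
        (simp_all add: bracket_symmetric_part_e_e bracket_symmetric_part_pi_pi,
         simp_all add: bracket_generators E_null_closed)
  next
    case (add y z)
    then show ?case using E_null_closed(2)[OF add] by (simp add: bracket_add algebra_simps)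
  next
    case (scale r y)
    then show ?case using E_null_closed(3)[OF scale, of r] by (simp add: bracket_scale scale_elt_rules)
  qed
next
  case (add x z)
  then show ?case using E_null_closed(2)[OF add] by (simp add: bracket_add algebra_simps)
next
  case (scale r x)
  then show ?case using E_null_closed(3)[OF scale, of r] by (simp add: bracket_scale scale_elt_rules)
qed

lemma dual_bracket_antisymmetric:
  assumes "\<xi> \<in> radC_dual q" "y \<in> carrier RA"
  shows "\<lbrakk>y, dual_elt \<xi>\<rbrakk> = - \<lbrakk>dual_elt \<xi>, y\<rbrakk>"
  using assms(2)
  by (induction y rule: RA_induct) (simp_all add: bracket_generators bracket_add bracket_scale scale_elt_rules)

lemma dual_bracket_derivation:
  assumes \<xi>: "\<xi> \<in> radC_dual q"
  shows "y \<in> carrier RA \<Longrightarrow> z \<in> carrier RA \<Longrightarrow>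
    \<lbrakk>dual_elt \<xi>, \<lbrakk>y, z\<rbrakk>\<rbrakk> = \<lbrakk>\<lbrakk>dual_elt \<xi>, y\<rbrakk>, z\<rbrakk> + \<lbrakk>y, \<lbrakk>dual_elt \<xi>, z\<rbrakk>\<rbrakk>"
proof (induction y arbitrary: z rule: RA_induct)
  case (e \<alpha>)
  from e(2) show ?case
  proof (induction z rule: RA_induct)
    case (e \<beta>)
    then show ?case using \<open>q \<alpha> = 1\<close>
      by (simp add: bracket_e_e_cases bracket_generators(5,7) bracket_scale scale_elt_rules(1-3,6)
          dual_weight_rules(1)[OF \<xi>] algebra_simps)
  qed (simp_all add: bracket_generators(1-3,5-) bracket_add bracket_scale scale_elt_rules
      dual_weight_rules(1)[OF \<xi>] algebra_simps)
next
  case (pi \<sigma> v)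
  from pi(2) show ?case
  proof (induction z rule: RA_induct)
    case (pi \<tau> w)
    show ?case
      by (simp add: bracket_generators(1,7) bracket_scale dual_weight_rules(1)[OF \<xi>] scale_elt_rules(2))
  qed (simp_all add: bracket_generators(1-3,5-) bracket_add bracket_scale scale_elt_rules
      dual_weight_rules(1)[OF \<xi>] algebra_simps)
next
  case (dual \<zeta>)
  from dual(2) show ?case
    by (induction z rule: RA_induct)
      (simp_all add: bracket_generators(1-3,5-) bracket_add bracket_scale scale_elt_rules
      dual_weight_rules(1)[OF \<xi>] algebra_simps)
qed (simp_all add: bracket_add bracket_scale scale_elt_rules algebra_simps)

definition jacobiator :: "'n::{finite,linorder} root_elt \<Rightarrow> 'n::{finite,linorder} root_elt \<Rightarrow> 'n::{finite,linorder} root_elt \<Rightarrow> 'n::{finite,linorder} root_elt" where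
  "jacobiator x y z = \<lbrakk>x, \<lbrakk>y, z\<rbrakk>\<rbrakk> + \<lbrakk>y, \<lbrakk>z, x\<rbrakk>\<rbrakk> + \<lbrakk>z, \<lbrakk>x, y\<rbrakk>\<rbrakk>"

lemma jacobiator_rotate: "jacobiator x y z = jacobiator y z x"
  by (simp add: jacobiator_def algebra_simps)

lemma jacobiator_linear:
  "jacobiator (x + x') y z = jacobiator x y z + jacobiator x' y z"
  "jacobiator x (y + y') z = jacobiator x y z + jacobiator x y' z"
  "jacobiator x y (z + z') = jacobiator x y z + jacobiator x y z'"
  "jacobiator (scale_elt r x) y z = scale_elt r (jacobiator x y z)"
  "jacobiator x (scale_elt r y) z = scale_elt r (jacobiator x y z)"
  "jacobiator x y (scale_elt r z) = scale_elt r (jacobiator x y z)"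
  by (simp_all add: jacobiator_def bracket_add bracket_scale scale_elt_rules algebra_simps)

lemma jacobiator_dual:
  assumes "\<xi> \<in> radC_dual q" "y \<in> carrier RA" "z \<in> carrier RA"
  shows "jacobiator (dual_elt \<xi>) y z \<in> E_null"
proof -
  have "\<lbrakk>dual_elt \<xi>, y\<rbrakk> \<in> carrier RA" using assms by (simp add: bracket_closed)
  moreover have "jacobiator (dual_elt \<xi>) y z = \<lbrakk>\<lbrakk>dual_elt \<xi>, y\<rbrakk>, z\<rbrakk> + \<lbrakk>z, \<lbrakk>dual_elt \<xi>, y\<rbrakk>\<rbrakk>"
    by (simp add: jacobiator_def dual_bracket_derivation[OF assms] dual_bracket_antisymmetric[OF assms(1,3)])
  ultimately show ?thesis using bracket_symmetric_part assms(3) by simp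
qed

lemma jacobiator_pi_pi:
  assumes "q \<sigma> = 0" "q \<tau> = 0"
  shows "q \<omega> = 0 \<Longrightarrow> jacobiator (pi_elt \<sigma> u) (pi_elt \<tau> v) (pi_elt \<omega> w) = 0"
    and "jacobiator (pi_elt \<sigma> u) (pi_elt \<tau> v) (e_elt \<beta>) = 0"
proof -
  have p: "polarC q v (cvec \<sigma>) = 0" if "q \<sigma> = 0" for \<sigma> v
    using radC_polarC[OF imag_root_radC[OF that]] by simp
  have p': "polarC q (cvec \<sigma>) v = 0" if "q \<sigma> = 0" for \<sigma> v
    using radC_polarC[OF imag_root_radC[OF that]] by simp
  show "q \<omega> = 0 \<Longrightarrow> jacobiator (pi_elt \<sigma> u) (pi_elt \<tau> v) (pi_elt \<omega> w) = 0"
    using assms by (simp add: jacobiator_def bracket_generators polarC_rules p pi_elt_rules)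
  have s: "\<epsilon> \<tau> \<sigma> = \<epsilon> \<sigma> \<tau>" using assms by (simp add: sgn_cocycle_swap[of \<tau> \<sigma>] imag_root_polar)
  show "jacobiator (pi_elt \<sigma> u) (pi_elt \<tau> v) (e_elt \<beta>) = 0"
    using assms by (simp add: jacobiator_def bracket_generators bracket_scale polarC_rules p p' s
        sgn_cocycle_rules scale_elt_rules algebra_simps)
qed

text \<open>If \<open>\<alpha> + \<beta>\<close> is real then the three terms cancel because \<open>q(v, -)\<close> is additive. If it is imaginary then
  \<open>q(v, \<beta>) = - q(v, \<alpha>)\<close>, and the terms are the same multiple of \<open>\<sigma>\<close>, \<open>\<alpha>\<close> and \<open>\<beta>\<close> in degree \<open>\<alpha> + \<beta> + \<sigma>\<close>.\<close>

lemma jacobiator_pi_e_e: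
  assumes "q \<sigma> = 0" "q \<alpha> = 1" "q \<beta> = 1"
  shows "jacobiator (pi_elt \<sigma> v) (e_elt \<alpha>) (e_elt \<beta>) \<in> E_null"
proof -
  let ?A = "polarC q v (cvec \<alpha>)" and ?B = "polarC q v (cvec \<beta>)"
  have s: "\<epsilon> \<alpha> \<sigma> = \<epsilon> \<sigma> \<alpha>" "\<epsilon> \<beta> \<sigma> = \<epsilon> \<sigma> \<beta>" using assms
    by (simp_all add: sgn_cocycle_swap[of _ \<sigma>] imag_root_polar)
  have pol: "polar q \<alpha> (\<beta> + \<sigma>) = polar q \<alpha> \<beta>" "polar q \<beta> (\<alpha> + \<sigma>) = polar q \<alpha> \<beta>"
    using assms(1) by (simp_all add: polar_rules imag_root_polar' polar_commute)
  have real: "q (\<alpha> + \<sigma>) = 1" "q (\<beta> + \<sigma>) = 1" using assms by (simp_all add: q_add_imag)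
  have J: "jacobiator (pi_elt \<sigma> v) (e_elt \<alpha>) (e_elt \<beta>) =
     \<lbrakk>pi_elt \<sigma> v, \<lbrakk>e_elt \<alpha>, e_elt \<beta>\<rbrakk>\<rbrakk> - scale_elt (\<epsilon> \<sigma> \<beta> * ?B) \<lbrakk>e_elt \<alpha>, e_elt (\<beta> + \<sigma>)\<rbrakk>
     + scale_elt (\<epsilon> \<sigma> \<alpha> * ?A) \<lbrakk>e_elt \<beta>, e_elt (\<alpha> + \<sigma>)\<rbrakk>"
    by (simp add: jacobiator_def bracket_generators(2,3) bracket_scale)
  consider "polar q \<alpha> \<beta> = -1" | "polar q \<alpha> \<beta> = -2" | "polar q \<alpha> \<beta> \<noteq> -1" "polar q \<alpha> \<beta> \<noteq> -2" by blast
  then show ?thesis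
  proof cases
    case 1
    have sw: "\<epsilon> \<beta> \<alpha> = - \<epsilon> \<alpha> \<beta>" using 1 by (simp add: sgn_cocycle_swap[of \<beta> \<alpha>])
    have "jacobiator (pi_elt \<sigma> v) (e_elt \<alpha>) (e_elt \<beta>) =
      scale_elt (\<epsilon> \<alpha> \<beta> * (\<epsilon> \<sigma> (\<alpha> + \<beta>) * (?A + ?B))) (e_elt (\<alpha> + \<beta> + \<sigma>))
      - scale_elt (\<epsilon> \<sigma> \<beta> * ?B * (\<epsilon> \<alpha> (\<beta> + \<sigma>))) (e_elt (\<alpha> + \<beta> + \<sigma>))
      + scale_elt (\<epsilon> \<sigma> \<alpha> * ?A * (\<epsilon> \<beta> (\<alpha> + \<sigma>))) (e_elt (\<alpha> + \<beta> + \<sigma>))"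
      using 1 assms real pol
      by (simp add: J bracket_e_e_cases bracket_scale bracket_generators(2) scale_elt_rules polarC_rules add_ac)
    also have "\<dots> = scale_elt (\<epsilon> \<alpha> \<beta> * (\<epsilon> \<sigma> (\<alpha> + \<beta>) * (?A + ?B)) - \<epsilon> \<sigma> \<beta> * ?B * (\<epsilon> \<alpha> (\<beta> + \<sigma>))
        + \<epsilon> \<sigma> \<alpha> * ?A * (\<epsilon> \<beta> (\<alpha> + \<sigma>))) (e_elt (\<alpha> + \<beta> + \<sigma>))"
      by (simp add: scale_elt_rules(2) scale_elt_rules(7)[symmetric] diff_conv_add_uminus del: add_uminus_conv_diff)
    also have "\<epsilon> \<alpha> \<beta> * (\<epsilon> \<sigma> (\<alpha> + \<beta>) * (?A + ?B)) - \<epsilon> \<sigma> \<beta> * ?B * (\<epsilon> \<alpha> (\<beta> + \<sigma>))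
        + \<epsilon> \<sigma> \<alpha> * ?A * (\<epsilon> \<beta> (\<alpha> + \<sigma>)) = 0"
      by (simp add: sgn_cocycle_rules s sw algebra_simps)
    finally show ?thesis by (simp add: scale_elt_rules E_null_closed)
  next
    case 2
    have q0: "q (\<alpha> + \<beta>) = 0" using 2 assms by (simp add: q_rules)
    have "polarC q v (cvec (\<alpha> + \<beta>)) = 0"
      using radC_polarC[OF imag_root_radC[OF q0]] by blast
    then have AB: "?B = - ?A" by (simp add: polarC_rules eq_neg_iff_add_eq_0 add.commute)
    have sw: "\<epsilon> \<beta> \<alpha> = \<epsilon> \<alpha> \<beta>" using 2 by (simp add: sgn_cocycle_swap[of \<beta> \<alpha>])
    let ?k = "\<epsilon> \<alpha> \<beta> * \<epsilon> \<sigma> \<alpha> * \<epsilon> \<sigma> \<beta> * ?A"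
    have "jacobiator (pi_elt \<sigma> v) (e_elt \<alpha>) (e_elt \<beta>) =
      pi_elt (\<alpha> + \<beta> + \<sigma>) ((\<epsilon> \<sigma> (\<alpha> + \<beta>) * (\<epsilon> \<alpha> \<beta> * ?A)) *s cvec \<sigma>)
      - pi_elt (\<alpha> + \<beta> + \<sigma>) ((\<epsilon> \<sigma> \<beta> * ?B * \<epsilon> \<alpha> (\<beta> + \<sigma>)) *s cvec \<alpha>)
      + pi_elt (\<alpha> + \<beta> + \<sigma>) ((\<epsilon> \<sigma> \<alpha> * ?A * \<epsilon> \<beta> (\<alpha> + \<sigma>)) *s cvec \<beta>)"
      using 2 assms real pol
      by (simp add: J bracket_e_e_cases bracket_generators(1) pi_elt_rules polarC_rules add_ac mult_ac
          vec.scale_scale)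
    also have "\<dots> = pi_elt (\<alpha> + \<beta> + \<sigma>) (?k *s cvec (\<alpha> + \<beta> + \<sigma>))"
      by (simp add: sgn_cocycle_rules s sw AB pi_elt_rules(1)[symmetric] vec.scale_right_distrib
          pi_elt_rules(4)[symmetric] diff_conv_add_uminus mult_ac add_ac del: add_uminus_conv_diff)
    finally show ?thesis using pi_elt_in_E_null[of "\<alpha> + \<beta> + \<sigma>"] q0 assms(1) by (simp add: q_add_imag del: cvec_simps)
  next
    case 3
    then show ?thesis using assms real pol
      by (simp add: J bracket_e_e_cases scale_elt_rules E_null_closed polar_commute[of \<beta>])
  qed
qed

text \<open>Write \<open>a\<close>, \<open>b\<close>, \<open>c\<close> for \<open>q(\<alpha>, \<beta>)\<close>, \<open>q(\<beta>, \<gamma>)\<close>, \<open>q(\<gamma>, \<alpha>)\<close>. If the sum \<open>\<delta>\<close> of the roots is real then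
  \<open>a + b + c = - 2\<close>; for \<open>b = - 1\<close> the inner bracket is a real root vector, and for \<open>b = - 2\<close> it has imaginary
  degree and acts by the factor \<open>- a\<close>. If \<open>\<delta>\<close> is imaginary then \<open>a + b + c = - 3\<close> and \<open>b = - 2\<close> is impossible,
  because then \<open>\<delta>\<close> would be the sum of a real root and an imaginary one.\<close>

lemma bracket_e_e_e:
  assumes "q \<alpha> = 1" "q \<beta> = 1" "q \<gamma> = 1" and \<delta>: "\<alpha> + \<beta> + \<gamma> = \<delta>"
  shows "\<lbrakk>e_elt \<alpha>, \<lbrakk>e_elt \<beta>, e_elt \<gamma>\<rbrakk>\<rbrakk> =
    (if q \<delta> = 1 then scale_elt (\<epsilon> \<alpha> \<beta> * \<epsilon> \<alpha> \<gamma> * \<epsilon> \<beta> \<gamma> *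
        of_int (if polar q \<beta> \<gamma> = -1 then 1 else if polar q \<beta> \<gamma> = -2 then - polar q \<alpha> \<beta> else 0)) (e_elt \<delta>)
     else if q \<delta> = 0 \<and> polar q \<beta> \<gamma> = -1 then pi_elt \<delta> ((\<epsilon> \<alpha> \<beta> * \<epsilon> \<alpha> \<gamma> * \<epsilon> \<beta> \<gamma>) *s cvec \<alpha>) else 0)"
proof -
  have qd: "q \<delta> = 3 + polar q \<alpha> \<beta> + polar q \<beta> \<gamma> + polar q \<alpha> \<gamma>"
    using assms by (auto simp: q_rules polar_rules)
  have d: "\<alpha> + (\<beta> + \<gamma>) = \<delta>" "\<beta> + \<gamma> + \<alpha> = \<delta>" using \<delta> by (simp_all add: add_ac)
  consider "polar q \<beta> \<gamma> = -1" | "polar q \<beta> \<gamma> = -2" | "polar q \<beta> \<gamma> \<noteq> -1" "polar q \<beta> \<gamma> \<noteq> -2" by blast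
  then show ?thesis
  proof cases
    case 1
    have r: "q (\<beta> + \<gamma>) = 1" using 1 assms by (simp add: q_rules)
    have pl: "polar q \<alpha> (\<beta> + \<gamma>) = q \<delta> - 2" using qd 1 by (simp add: polar_rules)
    show ?thesis using 1 assms(1-3) r
      by (simp add: bracket_e_e_cases bracket_scale pl d scale_elt_rules pi_elt_rules sgn_cocycle_rules mult_ac)
  next
    case 2
    have q0: "q (\<beta> + \<gamma>) = 0" using 2 assms by (simp add: q_rules)
    have "polar q (\<beta> + \<gamma>) \<alpha> = 0" using q0 by (rule imag_root_polar)
    then have "polar q \<alpha> \<gamma> = - polar q \<alpha> \<beta>" by (simp add: polar_rules polar_commute)
    then have q1: "q \<delta> = 1" using qd 2 by simp
    have pb: "polarC q (cvec \<beta>) (cvec \<alpha>) = of_int (polar q \<alpha> \<beta>)"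
      by (simp add: polarC_cvec polar_commute)
    have sw: "\<epsilon> (\<beta> + \<gamma>) \<alpha> = \<epsilon> \<alpha> (\<beta> + \<gamma>)"
      using \<open>polar q (\<beta> + \<gamma>) \<alpha> = 0\<close> by (simp add: sgn_cocycle_swap[of "\<beta> + \<gamma>" \<alpha>] polar_commute)
    have "\<lbrakk>e_elt \<alpha>, \<lbrakk>e_elt \<beta>, e_elt \<gamma>\<rbrakk>\<rbrakk> = - scale_elt (\<epsilon> \<alpha> (\<beta> + \<gamma>) * (\<epsilon> \<beta> \<gamma> * of_int (polar q \<alpha> \<beta>))) (e_elt \<delta>)"
      using 2 assms(1-3) by (simp add: bracket_e_e_cases bracket_generators(3) polarC_rules pb d sw)
    then show ?thesis using 2 q1
      by (simp add: sgn_cocycle_rules(1,2) scale_elt_rules(7)[symmetric] mult_ac)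
  next
    case 3
    then show ?thesis using assms(1-3) by (simp add: bracket_e_e_cases scale_elt_rules)
  qed
qed

text \<open>The three coefficients of the Jacobi identity for real root vectors whose sum is a real root; \<open>s\<close> gives
  the signs that rotating the roots introduces. Non-negativity bounds the products by 2 in absolute
  value, which leaves finitely many cases.\<close>

lemma jacobi_coefficients:
  fixes a b d :: int
  assumes "a \<in> {-2..2}" "b \<in> {-2..2}" "d \<in> {-2..2}" "a + b + d = -2"
  defines "k x y \<equiv> (if y = -1 then 1 else if y = -2 then - x else 0 :: int)"
    and "s x \<equiv> (if even x then 1 else -1 :: int)"
  shows "k a b + s a * s d * k b d + s d * s b * k d a = 0"
proof -
  have "a = -2 \<or> a = -1 \<or> a = 0 \<or> a = 1 \<or> a = 2" "b = -2 \<or> b = -1 \<or> b = 0 \<or> b = 1 \<or> b = 2"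
    using assms(1,2) by auto
  moreover have "d = -2 - a - b" using assms(4) by simp
  ultimately show ?thesis using assms(3) unfolding k_def s_def by (elim disjE) simp_all
qed

lemma jacobiator_e_e_e:
  assumes "q \<alpha> = 1" "q \<beta> = 1" "q \<gamma> = 1"
  shows "jacobiator (e_elt \<alpha>) (e_elt \<beta>) (e_elt \<gamma>) \<in> E_null"
proof -
  define \<delta> where "\<delta> = \<alpha> + \<beta> + \<gamma>"
  let ?a = "polar q \<alpha> \<beta>" and ?b = "polar q \<beta> \<gamma>" and ?c = "polar q \<gamma> \<alpha>"
  let ?S = "\<epsilon> \<alpha> \<beta> * \<epsilon> \<alpha> \<gamma> * \<epsilon> \<beta> \<gamma>"
  let ?k = "\<lambda>x y. if y = -1 then 1 else if y = -2 then - x else 0 :: int"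
  let ?s = "\<lambda>x. if even x then 1 else -1 :: int"
  have d: "\<alpha> + \<beta> + \<gamma> = \<delta>" "\<beta> + \<gamma> + \<alpha> = \<delta>" "\<gamma> + \<alpha> + \<beta> = \<delta>" by (simp_all add: \<delta>_def add_ac)
  have qd: "q \<delta> = 3 + ?a + ?b + ?c"
    using assms by (simp add: \<delta>_def q_rules polar_rules polar_commute[of \<gamma> \<alpha>])
  have S2: "\<epsilon> \<beta> \<gamma> * \<epsilon> \<beta> \<alpha> * \<epsilon> \<gamma> \<alpha> = ?S * of_int (?s ?a * ?s ?c)"
    and S3: "\<epsilon> \<gamma> \<alpha> * \<epsilon> \<gamma> \<beta> * \<epsilon> \<alpha> \<beta> = ?S * of_int (?s ?c * ?s ?b)"
    by (simp_all add: sgn_cocycle_swap[of \<beta> \<alpha>] sgn_cocycle_swap[of \<gamma> \<alpha>] sgn_cocycle_swap[of \<gamma> \<beta>]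
        polar_commute[of \<gamma> \<alpha>] mult_ac)
  note T = bracket_e_e_e[OF assms(1,2,3) d(1)] bracket_e_e_e[OF assms(2,3,1) d(2)]
    bracket_e_e_e[OF assms(3,1,2) d(3)]
  consider "q \<delta> = 1" | "q \<delta> = 0" | "q \<delta> \<noteq> 0" "q \<delta> \<noteq> 1" by blast
  then show ?thesis
  proof cases
    case 1
    have "jacobiator (e_elt \<alpha>) (e_elt \<beta>) (e_elt \<gamma>) =
      scale_elt (?S * of_int (?k ?a ?b) + \<epsilon> \<beta> \<gamma> * \<epsilon> \<beta> \<alpha> * \<epsilon> \<gamma> \<alpha> * of_int (?k ?b ?c)
        + \<epsilon> \<gamma> \<alpha> * \<epsilon> \<gamma> \<beta> * \<epsilon> \<alpha> \<beta> * of_int (?k ?c ?a)) (e_elt \<delta>)"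
      unfolding jacobiator_def T using 1 by (simp only: simp_thms if_True scale_elt_rules(2))
    also have "?S * of_int (?k ?a ?b) + \<epsilon> \<beta> \<gamma> * \<epsilon> \<beta> \<alpha> * \<epsilon> \<gamma> \<alpha> * of_int (?k ?b ?c)
        + \<epsilon> \<gamma> \<alpha> * \<epsilon> \<gamma> \<beta> * \<epsilon> \<alpha> \<beta> * of_int (?k ?c ?a) =
        ?S * of_int (?k ?a ?b + ?s ?a * ?s ?c * ?k ?b ?c + ?s ?c * ?s ?b * ?k ?c ?a)"
      unfolding S2 S3 by (simp only: of_int_add of_int_mult distrib_left mult.assoc)
    also have "?k ?a ?b + ?s ?a * ?s ?c * ?k ?b ?c + ?s ?c * ?s ?b * ?k ?c ?a = 0"
      by (rule jacobi_coefficients) (use qd 1 real_root_polar_bounds assms in auto)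
    finally show ?thesis by (simp only: of_int_0 mult_zero_right scale_elt_rules E_null_closed)
  next
    case 2
    have abc: "?a \<ge> -2" "?b \<ge> -2" "?c \<ge> -2" "?a + ?b + ?c = -3"
      using qd 2 real_root_polar_bounds assms by auto
    have no: "polar q x y \<noteq> -2" if "x + y + z = \<delta>" "q x = 1" "q y = 1" "q z = 1" for x y z
    proof
      assume "polar q x y = -2"
      then have "q (x + y) = 0" using that by (simp add: q_rules)
      then have "q \<delta> = 1" using that q_add_imag(2)[of "x + y" z] by simp
      with 2 show False by simp
    qed
    \<comment> \<open>none of the products is \<open>-2\<close> and they add up to \<open>-3\<close>, so the terms add up to a multiple of \<open>\<pi>\<^sub>\<delta>(\<delta>)\<close>\<close>
    have all: "?a = -1" "?b = -1" "?c = -1"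
      using abc no[OF d(1) assms] no[OF d(2) assms(2,3,1)] no[OF d(3) assms(3,1,2)] by linarith+
    have "jacobiator (e_elt \<alpha>) (e_elt \<beta>) (e_elt \<gamma>) = pi_elt \<delta> (?S *s cvec \<delta>)"
      unfolding jacobiator_def T S2 S3 using 2 all
      by (simp add: pi_elt_rules(1)[symmetric] vec.scale_right_distrib[symmetric] \<delta>_def)
    then show ?thesis using pi_elt_in_E_null[OF 2] by simp
  next
    case 3
    then show ?thesis unfolding jacobiator_def T by (simp add: E_null_closed)
  qed
qed

lemma jacobiator_generators:
  assumes "x \<in> RA_generators" "y \<in> RA_generators" "z \<in> RA_generators"
  shows "jacobiator x y z \<in> E_null"
proof -
  have r: "jacobiator y z x \<in> E_null \<Longrightarrow> jacobiator x y z \<in> E_null"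
    "jacobiator z x y \<in> E_null \<Longrightarrow> jacobiator x y z \<in> E_null" for x y z
    using jacobiator_rotate by metis+
  have pp: "jacobiator (pi_elt \<sigma> u) (pi_elt \<tau> v) (e_elt \<beta>) \<in> E_null"
    "q \<omega> = 0 \<Longrightarrow> jacobiator (pi_elt \<sigma> u) (pi_elt \<tau> v) (pi_elt \<omega> w) \<in> E_null"
    if "q \<sigma> = 0" "q \<tau> = 0" for \<sigma> \<tau> \<omega> u v w \<beta>
    using jacobiator_pi_pi[OF that] E_null_closed(1) by simp_all
  note base = jacobiator_dual jacobiator_e_e_e jacobiator_pi_e_e pp
  show ?thesis using assms
    by (elim RA_generators_cases, simp_all only:)
      ((((rule base | (rule r(1), rule base) | (rule r(2), rule base));
        (assumption | (rule RA_generators_closed, assumption)))[1])+)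
qed

lemma jacobiator_in_E_null:
  assumes "x \<in> carrier RA" "y \<in> carrier RA" "z \<in> carrier RA"
  shows "jacobiator x y z \<in> E_null"
  using assms(1)
proof (induction x rule: RA_generators_induct)
  case (gen x)
  from assms(2) show ?case
  proof (induction y rule: RA_generators_induct)
    case (gen y)
    from assms(3) show ?case
      by (induction z rule: RA_generators_induct)
        (simp_all add: jacobiator_generators \<open>x \<in> RA_generators\<close> gen jacobiator_linear E_null_closed)
  qed (simp_all add: jacobiator_linear E_null_closed)
qed (simp_all add: jacobiator_linear E_null_closed)

lemma E_lie_algebra: "lie_algebra EA"
proof (rule lie_algebraI[OF E_bilinear_algebra])
  fix x assume "x \<in> carrier EA"
  then obtain a where a: "a \<in> carrier RA" "x = E_proj a" by (auto simp: E_carrier)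
  have "scale_elt (1/2) (\<lbrakk>a, a\<rbrakk> + \<lbrakk>a, a\<rbrakk>) \<in> E_null"
    by (intro E_null_closed bracket_symmetric_part a)
  moreover have "scale_elt (1/2) (\<lbrakk>a, a\<rbrakk> + \<lbrakk>a, a\<rbrakk>) = \<lbrakk>a, a\<rbrakk>"
    by (simp add: scale_elt_rules(1) scale_elt_rules(2)[symmetric] scale_elt_rules(4))
  ultimately have "E_proj \<lbrakk>a, a\<rbrakk> = \<zero>\<^bsub>EA\<^esub>" using a by (simp add: E_proj_eq_zero_iff bracket_closed)
  then show "x \<otimes>\<^bsub>EA\<^esub> x = \<zero>\<^bsub>EA\<^esub>" using a by (simp add: E_proj_rules)
next
  fix x y z assume "x \<in> carrier EA" "y \<in> carrier EA" "z \<in> carrier EA"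
  then obtain a b d where a: "a \<in> carrier RA" "x = E_proj a" "b \<in> carrier RA" "y = E_proj b"
    "d \<in> carrier RA" "z = E_proj d" by (auto simp: E_carrier)
  have "E_proj (jacobiator a b d) = \<zero>\<^bsub>EA\<^esub>"
    using a by (subst E_proj_eq_zero_iff) (simp_all add: jacobiator_in_E_null, simp add: jacobiator_def bracket_closed)
  then show "x \<otimes>\<^bsub>EA\<^esub> (y \<otimes>\<^bsub>EA\<^esub> z) \<oplus>\<^bsub>EA\<^esub> y \<otimes>\<^bsub>EA\<^esub> (z \<otimes>\<^bsub>EA\<^esub> x) \<oplus>\<^bsub>EA\<^esub> z \<otimes>\<^bsub>EA\<^esub> (x \<otimes>\<^bsub>EA\<^esub> y) = \<zero>\<^bsub>EA\<^esub>"
    using a by (simp add: jacobiator_def E_proj_rules(2-4)[symmetric] bracket_closed)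
qed

end

section \<open>The grading of the root algebra and its ideals\<close>

context nonneg_unit_form
begin

lemma dual_elt_zero [simp]: "dual_elt 0 = 0"
  by (simp add: dual_elt_def zero_prod_def)

lemma root_grading_generators:
  "q \<alpha> = 1 \<Longrightarrow> e_elt \<alpha> \<in> root_grading q \<alpha>" "q \<sigma> = 0 \<Longrightarrow> pi_elt \<sigma> v \<in> root_grading q \<sigma>"
  "\<xi> \<in> radC_dual q \<Longrightarrow> dual_elt \<xi> \<in> root_grading q 0"
  by (simp_all add: root_grading_def e_elt_def pi_elt_def dual_elt_def real_roots_def imag_roots_def radC_dual_closed)

lemma root_grading_closed:
  "0 \<in> root_grading q \<alpha>" "x \<in> root_grading q \<alpha> \<Longrightarrow> y \<in> root_grading q \<alpha> \<Longrightarrow> x + y \<in> root_grading q \<alpha>"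
  "x \<in> root_grading q \<alpha> \<Longrightarrow> scale_elt r x \<in> root_grading q \<alpha>"
proof -
  show "0 \<in> root_grading q \<alpha>" by (simp add: root_grading_def zero_prod_def radC_dual_closed)
  show "x \<in> root_grading q \<alpha> \<Longrightarrow> y \<in> root_grading q \<alpha> \<Longrightarrow> x + y \<in> root_grading q \<alpha>"
    by (cases x; cases y) (auto simp: root_grading_def radC_dual_closed dest!: subsetD[OF keys_add])
  show "x \<in> root_grading q \<alpha> \<Longrightarrow> scale_elt r x \<in> root_grading q \<alpha>"
    by (cases x) (auto simp: root_grading_def radC_dual_closed in_keys_iff fun_eq_iff subset_iff)
qed

lemma root_grading_carrier: "root_grading q \<alpha> \<subseteq> carrier RA"
  by (auto simp: root_grading_def RA_carrier radC_dual_closed split: if_splits)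

lemma root_grading_elim:
  assumes "x \<in> root_grading q \<alpha>"
  obtains s v \<zeta> where "x = scale_elt s (e_elt \<alpha>) + pi_elt \<alpha> v + dual_elt \<zeta>" "q \<alpha> = 1 \<or> s = 0"
    "q \<alpha> = 0 \<or> v = 0" "\<zeta> \<in> radC_dual q" "\<alpha> = 0 \<or> \<zeta> = 0"
proof -
  obtain a u \<zeta> where x: "x = (a, u, \<zeta>)" by (cases x)
  have k: "Poly_Mapping.keys a \<subseteq> real_roots q \<inter> {\<alpha>}" "Poly_Mapping.keys u \<subseteq> imag_roots q \<inter> {\<alpha>}"
    and \<zeta>: "\<zeta> \<in> radC_dual q" "\<alpha> = 0 \<or> \<zeta> = 0"
    using assms by (auto simp: x root_grading_def radC_dual_closed split: if_splits)
  define s where "s = Poly_Mapping.lookup a \<alpha>"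
  define v where "v = Poly_Mapping.lookup u \<alpha>"
  have "a = Poly_Mapping.single \<alpha> s" "u = Poly_Mapping.single \<alpha> v"
    using k by (auto simp: s_def v_def lookup_single when_def in_keys_iff subset_iff intro!: poly_mapping_eqI)
  then have "x = scale_elt s (e_elt \<alpha>) + pi_elt \<alpha> v + dual_elt \<zeta>"
    by (auto simp: x e_elt_def pi_elt_def dual_elt_def fun_eq_iff lookup_add intro!: poly_mapping_eqI)
  moreover have "q \<alpha> = 1 \<or> s = 0" "q \<alpha> = 0 \<or> v = 0"
    using k by (auto simp: s_def v_def real_roots_def imag_roots_def in_keys_iff)
  ultimately show ?thesis using that \<zeta> by blast
qed

lemma root_grading_induct [consumes 1, case_names e pi dual add scale]:
  assumes "x \<in> root_grading q \<alpha>"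
    and e: "q \<alpha> = 1 \<Longrightarrow> P (e_elt \<alpha>)" and pi: "\<And>v. q \<alpha> = 0 \<Longrightarrow> P (pi_elt \<alpha> v)"
    and dual: "\<And>\<xi>. \<xi> \<in> radC_dual q \<Longrightarrow> \<alpha> = 0 \<or> \<xi> = 0 \<Longrightarrow> P (dual_elt \<xi>)"
    and add: "\<And>x y. P x \<Longrightarrow> P y \<Longrightarrow> P (x + y)" and scale: "\<And>r x. P x \<Longrightarrow> P (scale_elt r x)"
  shows "P x"
proof -
  obtain s v \<zeta> where x: "x = scale_elt s (e_elt \<alpha>) + pi_elt \<alpha> v + dual_elt \<zeta>" "q \<alpha> = 1 \<or> s = 0"
    "q \<alpha> = 0 \<or> v = 0" "\<zeta> \<in> radC_dual q" "\<alpha> = 0 \<or> \<zeta> = 0"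
    by (rule root_grading_elim[OF assms(1)])
  have 0: "P 0" using scale[OF dual[OF radC_dual_closed(1)], of 0] by (simp add: scale_elt_rules)
  have "P (scale_elt s (e_elt \<alpha>))"
  proof (cases "s = 0")
    case True
    then show ?thesis using 0 by (simp only: scale_elt_rules)
  next
    case False
    then show ?thesis using x(2) by (intro scale e) simp
  qed
  moreover have "P (pi_elt \<alpha> v)"
  proof (cases "v = 0")
    case True
    then show ?thesis using 0 by (simp only: pi_elt_rules)
  next
    case False
    then show ?thesis using x(3) by (intro pi) simp
  qed
  moreover have "P (dual_elt \<zeta>)" using x(4,5) by (rule dual)
  ultimately show ?thesis unfolding x(1) by (intro add)
qed

lemma root_grading_bracket:
  "x \<in> root_grading q \<alpha> \<Longrightarrow> y \<in> root_grading q \<beta> \<Longrightarrow> \<lbrakk>x, y\<rbrakk> \<in> root_grading q (\<alpha> + \<beta>)"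
proof (induction x rule: root_grading_induct)
  case e
  have neg: "- z \<in> root_grading q \<gamma>" if "z \<in> root_grading q \<gamma>" for z \<gamma>
    using root_grading_closed(3)[OF that, of "-1"] by (simp only: scale_elt_rules)
  from e(2) show ?case
  proof (induction y rule: root_grading_induct)
    case e
    then show ?case using \<open>q \<alpha> = 1\<close>
      by (auto simp: bracket_e_e_cases q_rules intro!: root_grading_closed root_grading_generators)
  next
    case (pi v)
    then show ?case using \<open>q \<alpha> = 1\<close>
      by (auto simp: bracket_generators(3) q_add_imag intro!: neg root_grading_closed root_grading_generators)
  next
    case (dual \<xi>)
    from dual(2) show ?case
    proof
      assume "\<beta> = 0"
      then show ?thesis using \<open>q \<alpha> = 1\<close>
        by (auto simp: bracket_generators(6) intro!: neg root_grading_closed root_grading_generators)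
    qed (simp add: bracket_generators(6) dual_weight_def scale_elt_rules root_grading_closed)
  qed (simp_all add: bracket_add bracket_scale root_grading_closed)
next
  case (pi v)
  have neg: "- z \<in> root_grading q \<gamma>" if "z \<in> root_grading q \<gamma>" for z \<gamma>
    using root_grading_closed(3)[OF that, of "-1"] by (simp only: scale_elt_rules)
  from pi(2) show ?case
  proof (induction y rule: root_grading_induct)
    case e
    then show ?case using \<open>q \<alpha> = 0\<close>
      by (auto simp: bracket_generators(2) q_add_imag add.commute[of \<alpha>] intro!: root_grading_closed root_grading_generators)
  next
    case (pi v)
    then show ?case using \<open>q \<alpha> = 0\<close>
      by (auto simp: bracket_generators(1) q_add_imag intro!: neg root_grading_closed root_grading_generators)
  next
    case (dual \<xi>)
    from dual(2) show ?case
    proof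
      assume "\<beta> = 0"
      then show ?thesis using \<open>q \<alpha> = 0\<close>
        by (auto simp: bracket_generators(8) intro!: neg root_grading_closed root_grading_generators)
    qed (simp add: bracket_generators(8) dual_weight_def scale_elt_rules root_grading_closed)
  qed (simp_all add: bracket_add bracket_scale root_grading_closed)
next
  case (dual \<xi>)
  from dual(2) show ?case
  proof
    assume "\<alpha> = 0"
    from dual(3) show ?case
      by (induction y rule: root_grading_induct)
        (simp_all add: \<open>\<alpha> = 0\<close> bracket_generators(5,7,9) bracket_add bracket_scale root_grading_closed root_grading_generators)
  next
    assume "\<xi> = 0"
    then show ?case by (simp add: root_grading_closed)
  qed
qed (simp_all add: bracket_add bracket_scale root_grading_closed)

lemma cartan_action:
  assumes "\<xi> \<in> radC_dual q" "x \<in> root_grading q \<alpha>"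
  shows "\<lbrakk>pi_elt 0 v + dual_elt \<xi>, x\<rbrakk> = scale_elt (cartan_weight v \<xi> \<alpha>) x"
  using assms(2)
proof (induction x rule: root_grading_induct)
  case e
  then show ?case
    by (simp add: bracket_add bracket_generators(2,5) sgn_cocycle_rules cartan_weight_def scale_elt_rules)
next
  case (pi w)
  have "polarC q v (cvec \<alpha>) = 0" using radC_polarC[OF imag_root_radC[OF pi]] by blast
  then show ?case
    by (simp add: bracket_add bracket_generators(1,7) cartan_weight_def pi_elt_rules)
next
  case (dual \<zeta>)
  have "\<lbrakk>pi_elt 0 v + dual_elt \<xi>, dual_elt \<zeta>\<rbrakk> = 0"
    using dual(1) by (simp add: bracket_add bracket_generators(8,9) dual_weight_rules(2) scale_elt_rules)
  moreover have "scale_elt (cartan_weight v \<xi> \<alpha>) (dual_elt \<zeta>) = 0"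
  proof (cases "\<alpha> = 0")
    case True
    then show ?thesis by (simp add: cartan_weight_def polarC_rules dual_weight_rules(2)[OF assms(1)] scale_elt_rules del: scale_elt_simp)
  next
    case False
    then have "dual_elt \<zeta> = 0" using dual(2) by simp
    then show ?thesis by (simp add: scale_elt_rules)
  qed
  ultimately show ?case by simp
qed (simp_all add: bracket_add bracket_scale scale_elt_rules mult.commute)

lemma E_grading_eq: "E_grading q B \<rho> \<alpha> = E_proj ` root_grading q \<alpha>"
  by (simp add: E_grading_def N_grading_def quotient_grading_def image_image E_proj_def)

lemma E_grading_submodule: "submodule (E_grading q B \<rho> \<alpha>) complex_ring EA"
proof -
  interpret E: bilinear_algebra EA by (rule E_bilinear_algebra)
  have c: "x \<in> carrier RA" if "x \<in> root_grading q \<alpha>" for x using that root_grading_carrier by blast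
  show ?thesis unfolding E.submodule_iff E_grading_eq
  proof (intro conjI ballI allI)
    show "E_proj ` root_grading q \<alpha> \<subseteq> carrier EA" using c E_proj_rules(1) by blast
    show "\<zero>\<^bsub>EA\<^esub> \<in> E_proj ` root_grading q \<alpha>" using root_grading_closed(1) E_proj_rules(5) by (metis imageI)
  next
    fix x y assume "x \<in> E_proj ` root_grading q \<alpha>" "y \<in> E_proj ` root_grading q \<alpha>"
    then obtain a b where "a \<in> root_grading q \<alpha>" "x = E_proj a" "b \<in> root_grading q \<alpha>" "y = E_proj b" by blast
    then show "x \<oplus>\<^bsub>EA\<^esub> y \<in> E_proj ` root_grading q \<alpha>"
      using E_proj_rules(2)[OF c c, of a b] root_grading_closed(2)[of a \<alpha> b] by (metis imageI)
  next
    fix r x assume "x \<in> E_proj ` root_grading q \<alpha>"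
    then obtain a where "a \<in> root_grading q \<alpha>" "x = E_proj a" by blast
    then show "r \<odot>\<^bsub>EA\<^esub> x \<in> E_proj ` root_grading q \<alpha>"
      using E_proj_rules(3)[OF c, of a r] root_grading_closed(3)[of a \<alpha> r] by (metis imageI)
  qed
qed

text \<open>The adjoint action of the degree-zero element that is given by a vector and a functional; it is
  diagonal with eigenvalues \<open>cartan_weight\<close>.\<close>

definition cartan_operator :: "(complex ^ 'n::{finite,linorder}) \<times> (complex ^ 'n::{finite,linorder} \<Rightarrow> complex) \<Rightarrow>
    'n::{finite,linorder} root_elt set set \<Rightarrow> 'n::{finite,linorder} root_elt set set" where
  "cartan_operator t x = E_proj (pi_elt 0 (fst t) + dual_elt (snd t)) \<otimes>\<^bsub>EA\<^esub> x"

lemma cartan_element_carrier: "\<xi> \<in> radC_dual q \<Longrightarrow> pi_elt 0 v + dual_elt \<xi> \<in> carrier RA"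
  by (simp add: q_rules)

lemma cartan_operator_linear:
  assumes "snd t \<in> radC_dual q"
  shows "linear_map EA EA (cartan_operator t)"
proof -
  interpret E: bilinear_algebra EA by (rule E_bilinear_algebra)
  have "E_proj (pi_elt 0 (fst t) + dual_elt (snd t)) \<in> carrier EA"
    by (rule E_proj_rules(1)[OF cartan_element_carrier[OF assms]])
  then show ?thesis
    by (simp add: linear_map_def cartan_operator_def E.prod_add_right E.prod_smult_right)
qed

lemma cartan_operator_eigen:
  assumes "snd t \<in> radC_dual q" "x \<in> E_grading q B \<rho> \<alpha>"
  shows "cartan_operator t x = cartan_weight (fst t) (snd t) \<alpha> \<odot>\<^bsub>EA\<^esub> x"
proof -
  obtain y where y: "y \<in> root_grading q \<alpha>" "x = E_proj y" using assms(2) by (auto simp: E_grading_eq)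
  then have "y \<in> carrier RA" using root_grading_carrier by blast
  then have "cartan_operator t x = E_proj \<lbrakk>pi_elt 0 (fst t) + dual_elt (snd t), y\<rbrakk>"
    using cartan_element_carrier[OF assms(1)] by (simp add: cartan_operator_def y(2) E_proj_rules(4))
  then show ?thesis using \<open>y \<in> carrier RA\<close>
    by (simp add: cartan_action[OF assms(1) y(1)] y(2) E_proj_rules(3))
qed

lemma cartan_operators_separate:
  "\<alpha> \<noteq> \<beta> \<Longrightarrow> \<exists>t\<in>{t. snd t \<in> radC_dual q}. cartan_weight (fst t) (snd t) \<alpha> \<noteq> cartan_weight (fst t) (snd t) \<beta>"
  using cartan_weights_separate[of \<alpha> \<beta>] by auto

lemma E_decomposition:
  assumes "x \<in> carrier EA"
  shows "\<exists>!f. homogeneous_decomposition EA (E_grading q B \<rho>) x f"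
proof -
  interpret E: bilinear_algebra EA by (rule E_bilinear_algebra)
  let ?D = "{x. \<exists>f. homogeneous_decomposition EA (E_grading q B \<rho>) x f}"
  have sub: "\<forall>\<alpha>. submodule (E_grading q B \<rho> \<alpha>) complex_ring EA" by (simp add: E_grading_submodule)
  have D: "submodule ?D complex_ring EA" by (rule decomposable_submodule[OF E.complex_module_axioms sub])
  note D' = D[unfolded E.submodule_iff]
  have h: "E_proj y \<in> ?D" if "y \<in> root_grading q \<alpha>" for y \<alpha>
  proof -
    have "E_proj y \<in> E_grading q B \<rho> \<alpha>" using that by (simp add: E_grading_eq)
    then show ?thesis using homogeneous_decomposition_homogeneous[OF E.complex_module_axioms sub] by blast
  qed
  have "E_proj y \<in> ?D" if "y \<in> carrier RA" for y
    using that
  proof (induction y rule: RA_induct)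
    case (add x y)
    then show ?case unfolding E_proj_rules(2)[OF add(1,2)] using D' by blast
  next
    case (scale r x)
    then show ?case unfolding E_proj_rules(3)[OF scale(1)] using D' by blast
  qed (use h root_grading_generators in blast)+
  moreover obtain y where "y \<in> carrier RA" "x = E_proj y" using assms unfolding E_carrier by blast
  ultimately obtain f where f: "homogeneous_decomposition EA (E_grading q B \<rho>) x f" by blast
  moreover have "k = f" if "homogeneous_decomposition EA (E_grading q B \<rho>) x k" for k
    by (rule homogeneous_decomposition_unique[OF E.complex_module_axioms sub,
        where S = "{t. snd t \<in> radC_dual q}" and T = cartan_operator
          and ev = "\<lambda>t. cartan_weight (fst t) (snd t)", OF _ _ _ that f])
      (simp_all add: cartan_operator_linear cartan_operator_eigen cartan_operators_separate[simplified])
  ultimately show ?thesis by blast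
qed

lemma E_graded_lie_algebra: "graded_lie_algebra EA (E_grading q B \<rho>)"
  unfolding graded_lie_algebra_def
proof (intro conjI allI ballI)
  show "x \<otimes>\<^bsub>EA\<^esub> y \<in> E_grading q B \<rho> (\<alpha> + \<beta>)" if xy: "x \<in> E_grading q B \<rho> \<alpha>" "y \<in> E_grading q B \<rho> \<beta>" for \<alpha> \<beta> x y
  proof -
    obtain a b where ab: "a \<in> root_grading q \<alpha>" "x = E_proj a" "b \<in> root_grading q \<beta>" "y = E_proj b"
      using xy by (auto simp: E_grading_eq)
    then have "a \<in> carrier RA" "b \<in> carrier RA" using root_grading_carrier by blast+
    then have "x \<otimes>\<^bsub>EA\<^esub> y = E_proj \<lbrakk>a, b\<rbrakk>" by (simp add: ab E_proj_rules(4))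
    then show ?thesis using root_grading_bracket[OF ab(1,3)] by (simp add: E_grading_eq)
  qed
qed (simp_all add: E_lie_algebra E_grading_submodule E_decomposition)

text \<open>A nonzero homogeneous element of an ideal can be moved to degree zero by a bracket with an
  element of opposite degree: for a real root \<open>\<alpha>\<close> because \<open>[e\<^sub>\<alpha>, e\<^sub>-\<^sub>\<alpha>]\<close> is a nonzero multiple of \<open>\<pi>\<^sub>0(\<alpha>)\<close>, and for an
  imaginary root because the form on \<open>\<complex>\<^sup>n / radC q\<close> is non-degenerate.\<close>

lemma homogeneous_ideal_element_zero:
  assumes J: "alg_ideal EA J" "J \<inter> E_grading q B \<rho> 0 = {\<zero>\<^bsub>EA\<^esub>}"
    and x: "x \<in> root_grading q \<alpha>" "E_proj x \<in> J"
  shows "E_proj x = \<zero>\<^bsub>EA\<^esub>"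
proof (cases "\<alpha> = 0")
  case True
  then show ?thesis using J(2) x by (auto simp: E_grading_eq)
next
  case False
  interpret E: bilinear_algebra EA by (rule E_bilinear_algebra)
  obtain s v \<zeta> where x': "x = scale_elt s (e_elt \<alpha>) + pi_elt \<alpha> v + dual_elt \<zeta>" "q \<alpha> = 1 \<or> s = 0"
    "q \<alpha> = 0 \<or> v = 0" "\<zeta> \<in> radC_dual q" "\<alpha> = 0 \<or> \<zeta> = 0"
    by (rule root_grading_elim[OF x(1)])
  have xc: "x \<in> carrier RA" using x(1) root_grading_carrier by blast
  have "\<zeta> = 0" using x'(5) False by simp
  then have \<zeta>: "dual_elt \<zeta> = 0" by simp
  have degree0: "w = 0" if "\<lbrakk>x, y\<rbrakk> = pi_elt 0 w" "y \<in> carrier RA" for y w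
  proof -
    have "E_proj x \<otimes>\<^bsub>EA\<^esub> E_proj y \<in> J"
      using E.alg_idealD(6)[OF J(1) E_proj_rules(1)[OF that(2)] x(2)] .
    then have "E_proj (pi_elt 0 w) \<in> J" using that xc by (simp add: E_proj_rules(4)[symmetric])
    moreover have "E_proj (pi_elt 0 w) \<in> E_grading q B \<rho> 0"
      by (simp add: E_grading_eq root_grading_generators q_rules)
    ultimately have "E_proj (pi_elt 0 w) = \<zero>\<^bsub>EA\<^esub>" using J(2) by blast
    then have "pi_elt 0 w \<in> E_null" by (simp add: E_proj_eq_zero_iff q_rules)
    then show "w = 0" by (auto simp: E_null_def radical_families_def pi_elt_def split: if_splits dest: spec[of _ 0])
  qed
  consider "q \<alpha> = 1" | "q \<alpha> = 0" | "q \<alpha> \<noteq> 0" "q \<alpha> \<noteq> 1" by blast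
  then show ?thesis
  proof cases
    case 1
    have x1: "x = scale_elt s (e_elt \<alpha>)" using x' \<zeta> 1 by (simp add: pi_elt_rules)
    have "\<lbrakk>x, e_elt (- \<alpha>)\<rbrakk> = pi_elt 0 ((s * \<epsilon> \<alpha> (- \<alpha>)) *s cvec \<alpha>)"
      using 1 by (simp add: x1 bracket_scale bracket_e_e_cases q_rules polar_rules pi_elt_rules)
    moreover have "e_elt (- \<alpha>) \<in> carrier RA" by (rule RA_generators_closed) (simp add: q_rules 1)
    ultimately have "(s * \<epsilon> \<alpha> (- \<alpha>)) *s cvec \<alpha> = 0" by (rule degree0)
    moreover have "cvec \<alpha> \<noteq> 0" using False by simp
    ultimately have "s = 0" by (auto simp: sgn_cocycle_rules vec_eq_iff) 
    then show ?thesis by (simp add: x1 scale_elt_rules E_proj_rules)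
  next
    case 2
    have x2: "x = pi_elt \<alpha> v" using x' \<zeta> 2 by (simp add: scale_elt_rules)
    have "polarC q v w = 0" for w
    proof -
      have "\<lbrakk>x, pi_elt (- \<alpha>) w\<rbrakk> = pi_elt 0 ((\<epsilon> \<alpha> (- \<alpha>) * polarC q v w) *s cvec \<alpha>)"
        by (simp add: x2 bracket_generators(1))
      moreover have "pi_elt (- \<alpha>) w \<in> carrier RA" by (rule RA_generators_closed) (simp add: q_rules 2)
      ultimately have "(\<epsilon> \<alpha> (- \<alpha>) * polarC q v w) *s cvec \<alpha> = 0" by (rule degree0)
      moreover have "cvec \<alpha> \<noteq> 0" using False by simp
      ultimately show ?thesis by (auto simp: sgn_cocycle_rules vec_eq_iff)
    qed
    then have "v \<in> radC q" by (rule radC_if_polarC_zero)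
    then have "x \<in> E_null" using False 2
      by (auto simp: x2 E_null_def radical_families_def pi_elt_def imag_roots_def lookup_single when_def radC_subspace)
    then show ?thesis using xc by (simp add: E_proj_eq_zero_iff)
  next
    case 3
    then show ?thesis using x' \<zeta> by (simp add: scale_elt_rules pi_elt_rules E_proj_rules)
  qed
qed

text \<open>An ideal is stable under the Cartan operators, which separate the degrees, so it contains the
  homogeneous components of its elements.\<close>

lemma E_ideal_avoiding_degree_zero:
  assumes J: "alg_ideal EA J" "J \<inter> E_grading q B \<rho> 0 = {\<zero>\<^bsub>EA\<^esub>}"
  shows "J = {\<zero>\<^bsub>EA\<^esub>}"
proof -
  interpret E: bilinear_algebra EA by (rule E_bilinear_algebra)
  note Jd = E.alg_idealD[OF J(1)]
  have "x = \<zero>\<^bsub>EA\<^esub>" if x: "x \<in> J" for x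
  proof -
    obtain f where f: "homogeneous_decomposition EA (E_grading q B \<rho>) x f"
      using E_decomposition[OF Jd(7)[OF x]] by blast
    let ?A = "{\<alpha>. f \<alpha> \<noteq> \<zero>\<^bsub>EA\<^esub>}"
    have fA: "finite ?A" "x = (\<Oplus>\<^bsub>EA\<^esub>\<alpha>\<in>?A. f \<alpha>)" "\<And>\<alpha>. f \<alpha> \<in> E_grading q B \<rho> \<alpha>"
      using f by (auto simp: homogeneous_decomposition_def)
    have fc: "f \<alpha> \<in> carrier EA" for \<alpha>
      using fA(3)[of \<alpha>] E_grading_submodule[of \<alpha>] by (auto simp: E.submodule_iff)
    have "\<forall>\<alpha>\<in>?A. f \<alpha> \<in> J"
    proof (rule eigen_components[OF E.complex_module_axioms, where S = "{t. snd t \<in> radC_dual q}"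
          and T = cartan_operator and ev = "\<lambda>t. cartan_weight (fst t) (snd t)"])
      show "submodule J complex_ring EA" using J(1) by (simp add: alg_ideal_def)
      show "cartan_operator t y \<in> J" if "t \<in> {t. snd t \<in> radC_dual q}" "y \<in> J" for t y
        unfolding cartan_operator_def using that
        by (intro Jd(5) E_proj_rules(1) cartan_element_carrier) auto
      show "(\<Oplus>\<^bsub>EA\<^esub>\<alpha>\<in>?A. f \<alpha>) \<in> J" using x fA(2) by simp
    qed (use fA fc cartan_operator_linear cartan_operator_eigen cartan_operators_separate in auto)
    then have "f \<alpha> = \<zero>\<^bsub>EA\<^esub>" if "\<alpha> \<in> ?A" for \<alpha>
      using that fA(3)[of \<alpha>] homogeneous_ideal_element_zero[OF J] by (auto simp: E_grading_eq)
    then have "?A = {}" by blast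
    then show ?thesis using fA(2) by (simp add: E.M.finsum_empty)
  qed
  then show ?thesis using Jd(2) by blast
qed

section \<open>Generation by simple root vectors\<close>

definition l1_norm :: "int ^ 'n::{finite,linorder} \<Rightarrow> nat" where
  "l1_norm x = nat (\<Sum>i\<in>UNIV. \<bar>x $ i\<bar>)"

lemma l1_norm_decreases:
  fixes x :: "int ^ 'n::{finite,linorder}"
  assumes "s = sgn (x $ i)" "x $ i \<noteq> 0"
  shows "l1_norm (x - s *s basis_vec i) < l1_norm x"
proof -
  have "(\<Sum>j\<in>UNIV. \<bar>(x - s *s basis_vec i) $ j\<bar>) = (\<Sum>j\<in>UNIV. \<bar>x $ j\<bar> - (if j = i then 1 else 0))"
    using assms by (intro sum.cong refl) (auto simp: axis_def sgn_if)
  also have "\<dots> = (\<Sum>j\<in>UNIV. \<bar>x $ j\<bar>) - 1" by (simp add: sum_subtractf)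
  finally show ?thesis using sum_nonneg[of UNIV "\<lambda>j. \<bar>(x - s *s basis_vec i) $ j\<bar>"]
    by (simp add: l1_norm_def)
qed

lemma form_matrix_nonzero_if_edge:
  assumes "i < j \<and> c i j \<noteq> 0 \<or> j < i \<and> c j i \<noteq> 0"
  shows "form_matrix q i j \<noteq> 0"
  using assms form_matrix_offdiagonal[of i j] form_matrix_offdiagonal[of j i]
  by (auto simp: form_matrix_def polar_commute)

text \<open>Induction on the \<open>l\<^sub>1\<close>-norm of the degree. From a root \<open>\<alpha>\<close> one subtracts a suitable \<open>\<plusminus> c\<^sub>i\<close>. For real \<open>\<alpha>\<close> the
  difference is either a real root, whose root vector is bracketed with the one of \<open>\<plusminus> c\<^sub>i\<close>, or an imaginary
  root \<open>\<sigma>\<close>, and then \<open>\<pi>\<^sub>\<sigma>(c\<^sub>i)\<close> is used instead. For imaginary \<open>\<sigma> \<noteq> 0\<close> the difference is a real root and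
  the bracket yields \<open>\<pi>\<^sub>\<sigma>(c\<^sub>i)\<close> for one \<open>i\<close> in the support of \<open>\<sigma>\<close>. Bracketing with the root vectors of \<open>c\<^sub>j\<close> and
  \<open>- c\<^sub>j\<close> passes from \<open>i\<close> to any \<open>j\<close> with \<open>q(c\<^sub>i, c\<^sub>j) \<noteq> 0\<close>, so connectedness gives all of degree \<open>\<sigma>\<close>.\<close>

lemma generated_by_simple_root_vectors:
  assumes T: "E_null \<subseteq> T" "\<And>x y. x \<in> T \<Longrightarrow> y \<in> T \<Longrightarrow> x + y \<in> T" "\<And>r x. x \<in> T \<Longrightarrow> scale_elt r x \<in> T"
    "\<And>x y. x \<in> T \<Longrightarrow> y \<in> T \<Longrightarrow> \<lbrakk>x, y\<rbrakk> \<in> T"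
    and gen: "\<And>i. e_elt (basis_vec i) \<in> T" "\<And>i. e_elt (- basis_vec i) \<in> T" "\<And>v. pi_elt 0 v \<in> T"
    "\<And>\<xi>. \<xi> \<in> radC_dual q \<Longrightarrow> dual_elt \<xi> \<in> T"
  shows "carrier RA \<subseteq> T"
proof -
  have unscale: "x \<in> T" if "scale_elt r x \<in> T" "r \<noteq> 0" for r x
    using T(3)[OF that(1), of "inverse r"] that(2) by (simp add: scale_elt_rules)
  have simple: "e_elt (s *s basis_vec i) \<in> T" "q (s *s basis_vec i) = 1" if "s = 1 \<or> s = -1" for s i
  proof -
    have "(- 1 :: int) *s basis_vec i = - basis_vec i" by (simp add: vec_eq_iff)
    then show "e_elt (s *s basis_vec i) \<in> T" "q (s *s basis_vec i) = 1"
      using that gen(1,2) by (auto simp: q_rules q_basis)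
  qed
  have main: "(q \<alpha> = 1 \<longrightarrow> e_elt \<alpha> \<in> T) \<and> (q \<alpha> = 0 \<longrightarrow> (\<forall>v. pi_elt \<alpha> v \<in> T))" for \<alpha>
  proof (induction "l1_norm \<alpha>" arbitrary: \<alpha> rule: less_induct)
    case less
    show ?case
    proof (intro conjI impI allI)
      assume q1: "q \<alpha> = 1"
      have "(\<Sum>i\<in>UNIV. \<alpha> $ i * polar q \<alpha> (basis_vec i)) = polar q \<alpha> \<alpha>"
      proof -
        have "polar q \<alpha> \<alpha> = polar q \<alpha> (\<Sum>i\<in>UNIV. \<alpha> $ i *s basis_vec i)" by (simp add: basis_expansion)
        also have "\<dots> = (\<Sum>i\<in>UNIV. polar q \<alpha> (\<alpha> $ i *s basis_vec i))"
          by (rule additive_sum) (rule polar_rules)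
        also have "\<dots> = (\<Sum>i\<in>UNIV. \<alpha> $ i * polar q \<alpha> (basis_vec i))"
          by (intro sum.cong refl additive_int_scale) (rule polar_rules)
        finally show ?thesis by simp
      qed
      \<comment> \<open>the sum is \<open>q(\<alpha>, \<alpha>) = 2\<close>, so one of its terms is positive\<close>
      then have "(\<Sum>i\<in>UNIV. \<alpha> $ i * polar q \<alpha> (basis_vec i)) > 0" using q1 by (simp add: polar_rules)
      then obtain i where i: "\<alpha> $ i * polar q \<alpha> (basis_vec i) > 0"
        by (meson not_less sum_nonpos)
      define s where "s = sgn (\<alpha> $ i)"
      have s: "s = 1 \<or> s = -1" "\<alpha> $ i \<noteq> 0" using i by (auto simp: s_def sgn_if)
      let ?b = "s *s basis_vec i" and ?\<beta> = "\<alpha> - s *s basis_vec i"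
      have pb: "polar q \<alpha> ?b = s * polar q \<alpha> (basis_vec i)"
        by (rule additive_int_scale) (rule polar_rules)
      have "polar q \<alpha> ?b > 0" unfolding pb using i by (auto simp: s_def sgn_if zero_less_mult_iff)
      moreover have "polar q \<alpha> ?b \<le> 2" using real_root_polar_bounds(2) q1 simple(2)[OF s(1)] by blast
      ultimately have p: "polar q \<alpha> ?b = 1 \<or> polar q \<alpha> ?b = 2" by linarith
      have q\<beta>: "q ?\<beta> = 2 - polar q \<alpha> ?b" using q1 simple(2)[OF s(1)] by (simp add: q_rules(2))
      have IH: "(q ?\<beta> = 1 \<longrightarrow> e_elt ?\<beta> \<in> T) \<and> (q ?\<beta> = 0 \<longrightarrow> (\<forall>v. pi_elt ?\<beta> v \<in> T))"
        using less l1_norm_decreases[OF s_def s(2)] by blast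
      from p show "e_elt \<alpha> \<in> T"
      proof
        assume p1: "polar q \<alpha> ?b = 1"
        then have \<beta>: "q ?\<beta> = 1" "e_elt ?\<beta> \<in> T" using q\<beta> IH by simp_all
        have "polar q ?\<beta> ?b = -1" using p1 simple(2)[OF s(1)] by (simp add: polar_rules(5,9))
        then have "\<lbrakk>e_elt ?\<beta>, e_elt ?b\<rbrakk> = scale_elt (\<epsilon> ?\<beta> ?b) (e_elt \<alpha>)"
          using \<beta>(1) simple(2)[OF s(1)] by (simp add: bracket_e_e_cases)
        then show ?thesis using T(4)[OF \<beta>(2) simple(1)[OF s(1)]] unscale sgn_cocycle_rules(6) by metis
      next
        assume p2: "polar q \<alpha> ?b = 2"
        then have \<beta>: "pi_elt ?\<beta> (cvec ?b) \<in> T" using q\<beta> IH by simp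
        have "polarC q (cvec ?b) (cvec ?b) = 2"
          unfolding polarC_cvec using simple(2)[OF s(1)] by (simp add: polar_rules(9))
        then have "\<lbrakk>pi_elt ?\<beta> (cvec ?b), e_elt ?b\<rbrakk> = scale_elt (\<epsilon> ?\<beta> ?b * 2) (e_elt \<alpha>)"
          by (simp only: bracket_generators(2)) simp
        then have "scale_elt (\<epsilon> ?\<beta> ?b * 2) (e_elt \<alpha>) \<in> T"
          using T(4)[OF \<beta> simple(1)[OF s(1), of i]] by (simp only:)
        then show ?thesis by (rule unscale) (simp add: sgn_cocycle_rules(6))
      qed
    next
      fix v assume q0: "q \<alpha> = 0"
      show "pi_elt \<alpha> v \<in> T"
      proof (cases "\<alpha> = 0")
        case True
        then show ?thesis using gen(3) by simp
      next
        case False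
        then obtain i where i: "\<alpha> $ i \<noteq> 0" by (auto simp: vec_eq_iff)
        define s where "s = sgn (\<alpha> $ i)"
        have s: "s = 1 \<or> s = -1" using i by (auto simp: s_def sgn_if)
        let ?b = "s *s basis_vec i" and ?\<beta> = "\<alpha> - s *s basis_vec i"
        have q\<beta>: "q ?\<beta> = 1" using q0 simple(2)[OF s] by (simp add: q_rules(2) imag_root_polar)
        then have \<beta>: "e_elt ?\<beta> \<in> T" using less[of ?\<beta>] l1_norm_decreases[OF s_def i] by blast
        have "polar q ?b ?\<beta> = -2"
          using q0 simple(2)[OF s] by (simp add: polar_rules(6,9) imag_root_polar')
        then have "\<lbrakk>e_elt ?b, e_elt ?\<beta>\<rbrakk> = scale_elt (\<epsilon> ?b ?\<beta> * of_int s) (pi_elt \<alpha> (cvec (basis_vec i)))"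
          using q\<beta> simple(2)[OF s] by (simp add: bracket_e_e_cases pi_elt_rules(2) vec.scale_scale)
        then have "scale_elt (\<epsilon> ?b ?\<beta> * of_int s) (pi_elt \<alpha> (cvec (basis_vec i))) \<in> T"
          using T(4)[OF simple(1)[OF s, of i] \<beta>] by (simp only:)
        then have start: "pi_elt \<alpha> (cvec (basis_vec i)) \<in> T"
          by (rule unscale) (use s sgn_cocycle_rules(6)[of ?b ?\<beta>] in auto)
        have all: "pi_elt \<alpha> (cvec (basis_vec j)) \<in> T" for j
        proof -
          have "(i, j) \<in> {(i, j). i < j \<and> c i j \<noteq> 0 \<or> j < i \<and> c j i \<noteq> 0}\<^sup>*"
            using connected by (simp add: connected_coeffs_def)
          then show ?thesis
          proof (induction rule: rtrancl_induct)
            case base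
            show ?case by (rule start)
          next
            case (step j k)
            let ?k = "basis_vec k"
            have C: "form_matrix q j k \<noteq> 0" using step(2) by (intro form_matrix_nonzero_if_edge) simp
            have "\<lbrakk>pi_elt \<alpha> (cvec (basis_vec j)), e_elt ?k\<rbrakk> =
                scale_elt (\<epsilon> \<alpha> ?k * of_int (form_matrix q j k)) (e_elt (?k + \<alpha>))"
              by (simp add: bracket_generators(2) polarC_cvec form_matrix_def)
            then have "scale_elt (\<epsilon> \<alpha> ?k * of_int (form_matrix q j k)) (e_elt (?k + \<alpha>)) \<in> T"
              using T(4)[OF step(3) gen(1)[of k]] by (simp only:)
            then have e: "e_elt (?k + \<alpha>) \<in> T"
              by (rule unscale) (use C sgn_cocycle_rules(6)[of \<alpha> ?k] in simp)
            have "polar q (?k + \<alpha>) (- ?k) = -2"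
              using q0 by (simp add: polar_rules imag_root_polar q_basis)
            then have b: "\<lbrakk>e_elt (?k + \<alpha>), e_elt (- ?k)\<rbrakk> = scale_elt (\<epsilon> (?k + \<alpha>) (- ?k)) (pi_elt \<alpha> (cvec ?k) + pi_elt \<alpha> (cvec \<alpha>))"
              using q0 by (simp add: bracket_e_e_cases q_add_imag q_basis q_rules(3) pi_elt_rules(1)[symmetric] pi_elt_rules(2))
            have "pi_elt \<alpha> (cvec ?k) + pi_elt \<alpha> (cvec \<alpha>) \<in> T"
              using T(4)[OF e gen(2)[of k]] unscale b sgn_cocycle_rules(6) by metis
            moreover have "pi_elt \<alpha> ((-1) *s cvec \<alpha>) \<in> T" using pi_elt_in_E_null[OF q0] T(1) by blast
            ultimately have "pi_elt \<alpha> (cvec ?k) + pi_elt \<alpha> (cvec \<alpha>) + pi_elt \<alpha> ((-1) *s cvec \<alpha>) \<in> T"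
              by (rule T(2))
            then show ?case by (simp add: pi_elt_rules(1)[symmetric])
          qed
        qed
        have v: "v = (\<Sum>j\<in>UNIV. v $ j *s cvec (basis_vec j))"
          by (simp add: vec_eq_iff cvec_def axis_def if_distrib cong: if_cong)
        have "pi_elt \<alpha> v = (\<Sum>j\<in>UNIV. scale_elt (v $ j) (pi_elt \<alpha> (cvec (basis_vec j))))"
          by (subst v, subst additive_sum[of "pi_elt \<alpha>"]) (simp_all add: pi_elt_rules)
        moreover have "sum f A \<in> T" if "finite A" "\<And>a. a \<in> A \<Longrightarrow> f a \<in> T" for f and A :: "'n::{finite,linorder} set"
          using that E_null_closed(1) T(1,2) by (induction A rule: finite_induct) auto
        ultimately show ?thesis using all T(3) by simp
      qed
    qed
  qed
  show ?thesis
  proof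
    fix x assume "x \<in> carrier RA"
    then show "x \<in> T" by (induction x rule: RA_induct) (use main gen(4) T(2,3) in auto)
  qed
qed

end

section \<open>The comparison homomorphism\<close>

lemma (in lie_algebra) bracket_antisymmetric:
  assumes "x \<in> carrier L" "y \<in> carrier L"
  shows "x \<otimes> y = \<ominus> (y \<otimes> x)"
proof -
  have "(x \<oplus> y) \<otimes> (x \<oplus> y) = (x \<otimes> x \<oplus> y \<otimes> x) \<oplus> (x \<otimes> y \<oplus> y \<otimes> y)"
    using assms by (simp add: bracket_add_left bracket_add_right)
  then have "\<zero> = y \<otimes> x \<oplus> x \<otimes> y"
    using assms by (simp add: bracket_alternating bracket_closed)
  then show ?thesis
    using assms M.minus_equality[of "x \<otimes> y" "y \<otimes> x"] by (simp add: bracket_closed M.a_comm)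
qed

lemma vector_expansion_induct:
  fixes a :: "complex ^ 'n::finite"
  assumes "P 0" "\<And>v w. P v \<Longrightarrow> P w \<Longrightarrow> P (v + w)" "\<And>r v. P v \<Longrightarrow> P (r *s v)" "\<And>i. P (axis i 1)"
  shows "P a"
proof -
  have "P (sum f A)" if "finite A" "\<And>i. i \<in> A \<Longrightarrow> P (f i)" for f and A :: "'n set"
    using that by (induction A rule: finite_induct) (simp_all add: assms)
  then have "P (\<Sum>i\<in>UNIV. a $ i *s axis i 1)" using assms(3,4) by simp
  then show ?thesis by (simp add: basis_expansion)
qed

context nonneg_unit_form
begin

text \<open>The sign of the image of \<open>f\<^sub>-\<^sub>i\<close> compensates for \<open>\<epsilon>(c\<^sub>i, - c\<^sub>i) = - 1\<close>, which makes \<open>h\<^sub>i = [f\<^sub>i, f\<^sub>-\<^sub>i]\<close> go to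
  \<open>\<pi>\<^sub>0(c\<^sub>i)\<close>.\<close>

definition simple_value :: "'n::{finite,linorder} generator \<Rightarrow> 'n::{finite,linorder} root_elt" where
  "simple_value g = (case g of Fminus i \<Rightarrow> scale_elt (-1) (e_elt (- basis_vec i))
    | Hgen i \<Rightarrow> pi_elt 0 (cvec (basis_vec i)) | Fplus i \<Rightarrow> e_elt (basis_vec i))"

lemma simple_value_grading: "simple_value g \<in> root_grading q (gen_degree g)"
  by (cases g) (auto simp: simple_value_def q_basis q_rules(3,4)
      intro!: root_grading_closed(3) root_grading_generators)

lemma simple_value_carrier: "simple_value g \<in> carrier RA"
  using simple_value_grading root_grading_carrier by blast

lemma E_grading_carrier: "x \<in> E_grading q B \<rho> \<alpha> \<Longrightarrow> x \<in> carrier EA"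
  using root_grading_carrier E_proj_rules(1) unfolding E_grading_eq by blast

lemma E_grading_bracket:
  "x \<in> E_grading q B \<rho> \<alpha> \<Longrightarrow> y \<in> E_grading q B \<rho> \<beta> \<Longrightarrow> x \<otimes>\<^bsub>EA\<^esub> y \<in> E_grading q B \<rho> (\<alpha> + \<beta>)"
  using E_graded_lie_algebra by (auto simp: graded_lie_algebra_def)

lemma E_grading_outside_roots:
  assumes "\<alpha> \<notin> roots q" "x \<in> E_grading q B \<rho> \<alpha>"
  shows "x = \<zero>\<^bsub>EA\<^esub>"
proof -
  obtain y where y: "y \<in> root_grading q \<alpha>" "x = E_proj y" using assms(2) by (auto simp: E_grading_eq)
  obtain s v \<zeta> where z: "y = scale_elt s (e_elt \<alpha>) + pi_elt \<alpha> v + dual_elt \<zeta>" "q \<alpha> = 1 \<or> s = 0"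
    "q \<alpha> = 0 \<or> v = 0" "\<zeta> \<in> radC_dual q" "\<alpha> = 0 \<or> \<zeta> = 0"
    by (rule root_grading_elim[OF y(1)])
  have "\<alpha> \<noteq> 0" using assms(1) by (auto simp: imag_roots_def q_rules)
  then have "y = 0" using z assms(1)
    by (auto simp: imag_roots_def real_roots_def scale_elt_rules pi_elt_rules simp del: scale_elt_simp)
  then show ?thesis by (simp add: y(2) E_proj_rules)
qed

text \<open>The nested brackets have images that are homogeneous of the degree of the word, and \<open>E\<close> is zero in
  degrees outside \<open>R\<close>.\<close>

lemma simple_values_relations: "relations_hold q EA (\<lambda>g. E_proj (simple_value g))"
  unfolding relations_hold_def
proof (intro conjI allI ballI impI)
  note E = E_proj_rules(3,4)[symmetric]
  note sc = simple_value_carrier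
  show "range (\<lambda>g. E_proj (simple_value g)) \<subseteq> carrier EA" using sc E_proj_rules(1) by blast
  show "E_proj (simple_value (Hgen i)) \<otimes>\<^bsub>EA\<^esub> E_proj (simple_value (Hgen j)) = \<zero>\<^bsub>EA\<^esub>" for i j
    unfolding E(2)[OF sc sc] by (simp add: simple_value_def bracket_generators(1) pi_elt_rules E_proj_rules)
  show "E_proj (simple_value (Hgen i)) \<otimes>\<^bsub>EA\<^esub> E_proj (simple_value (root_gen s j)) =
      of_int (s * form_matrix q i j) \<odot>\<^bsub>EA\<^esub> E_proj (simple_value (root_gen s j))" if s: "s \<in> {1, -1}" for i j s
  proof -
    have act: "\<lbrakk>simple_value (Hgen i), e_elt \<beta>\<rbrakk> = scale_elt (of_int (polar q (basis_vec i) \<beta>)) (e_elt \<beta>)" for \<beta>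
      by (simp add: simple_value_def bracket_generators(2) sgn_cocycle_rules(3) polarC_cvec)
    have "\<lbrakk>simple_value (Hgen i), simple_value (root_gen s j)\<rbrakk> =
        scale_elt (of_int (s * form_matrix q i j)) (simple_value (root_gen s j))"
    proof (cases "s = 1")
      case True
      then have "simple_value (root_gen s j) = e_elt (basis_vec j)" by (simp add: root_gen_def simple_value_def)
      then show ?thesis using True by (simp add: act form_matrix_def)
    next
      case False
      then have "simple_value (root_gen s j) = scale_elt (-1) (e_elt (- basis_vec j))" "s = -1"
        using s by (simp_all add: root_gen_def simple_value_def)
      then show ?thesis
        by (simp add: act bracket_scale form_matrix_def polar_rules(4) scale_elt_rules(3) del: scale_elt_simp)
    qed
    then show ?thesis unfolding E(2)[OF sc sc] E(1)[OF sc] by (rule arg_cong)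
  qed
  show "E_proj (simple_value (Fplus i)) \<otimes>\<^bsub>EA\<^esub> E_proj (simple_value (Fminus i)) = E_proj (simple_value (Hgen i))" for i
  proof -
    have "\<epsilon> (basis_vec i) (- basis_vec i) = -1"
      by (simp add: sgn_cocycle_parity B_rules(3) q_basis)
    then have "\<lbrakk>simple_value (Fplus i), simple_value (Fminus i)\<rbrakk> = simple_value (Hgen i)"
      by (simp add: simple_value_def bracket_scale bracket_e_e_cases q_basis q_rules(3) polar_rules pi_elt_rules
          scale_elt_rules del: scale_elt_simp)
    then show ?thesis unfolding E(2)[OF sc sc] by simp
  qed
  fix ws :: "(int \<times> 'n::{finite,linorder}) list"
  assume ws: "ws \<noteq> [] \<and> (\<forall>(s, i)\<in>set ws. s \<in> {1, -1}) \<and> (\<Sum>(s, i)\<leftarrow>ws. s *s basis_vec i) \<notin> roots q"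
  let ?f = "\<lambda>(s, i). E_proj (simple_value (root_gen s i))"
  have one: "E_proj (simple_value (root_gen s i)) \<in> E_grading q B \<rho> (s *s basis_vec i)" if "s \<in> {1, -1}" for s i
  proof -
    have "gen_degree (root_gen s i) = s *s basis_vec i"
      using that by (auto simp: root_gen_def vec_eq_iff)
    then show ?thesis using simple_value_grading[of "root_gen s i"] by (auto simp: E_grading_eq)
  qed
  have "ws \<noteq> [] \<Longrightarrow> (\<forall>(s, i)\<in>set ws. s \<in> {1, -1}) \<Longrightarrow>
      nested_bracket EA (map ?f ws) \<in> E_grading q B \<rho> (\<Sum>(s, i)\<leftarrow>ws. s *s basis_vec i)" for ws
  proof (induction ws rule: induct_list012)
    case (2 w)
    then show ?case using one by (auto split: prod.splits)
  next
    case (3 w w' ws)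
    obtain s i where w: "w = (s, i)" by (cases w)
    have "nested_bracket EA (map ?f (w' # ws)) \<in> E_grading q B \<rho> (\<Sum>(s, i)\<leftarrow>w' # ws. s *s basis_vec i)"
      using 3 by simp
    moreover have "?f w \<in> E_grading q B \<rho> (s *s basis_vec i)" using 3(4) one[of s i] by (simp add: w)
    ultimately have "?f w \<otimes>\<^bsub>EA\<^esub> nested_bracket EA (map ?f (w' # ws)) \<in>
        E_grading q B \<rho> (s *s basis_vec i + (\<Sum>(s, i)\<leftarrow>w' # ws. s *s basis_vec i))"
      by (intro E_grading_bracket)
    then show ?case by (simp add: w)
  qed simp
  then show "nested_bracket EA (map ?f ws) = \<zero>\<^bsub>EA\<^esub>"
    using ws E_grading_outside_roots by blast
qed

lemma pi_dual_in_E_null: "pi_elt 0 a + dual_elt \<xi> \<in> E_null \<Longrightarrow> a = 0 \<and> \<xi> = 0"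
  by (auto simp: E_null_def radical_families_def pi_elt_def dual_elt_def dest: spec[of _ 0])

text \<open>The homomorphism from \<open>G\<close> extends by the identity on the functionals, because on both sides these act
  by the same scalar on each degree. It is onto because its image contains the simple root vectors
  and their negatives. Equality of the pieces follows from surjectivity: the homogeneous
  components of a preimage map to the components of the image.\<close>

lemma comparison_homomorphism:
  obtains \<phi> where "alg_hom (G_tilde q \<rho>) EA \<phi>" "\<phi> ` carrier (G_tilde q \<rho>) = carrier EA"
    "\<And>\<alpha>. \<phi> ` G_tilde_grading q \<alpha> = E_grading q B \<rho> \<alpha>"
    "\<And>a \<xi>. \<xi> \<in> radC_dual q \<Longrightarrow> \<phi> (cartan_elt q a, \<xi>) = E_proj (pi_elt 0 a + dual_elt \<xi>)"
proof -
  interpret E: bilinear_algebra EA by (rule E_bilinear_algebra)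
  interpret EL: lie_algebra EA by (rule E_lie_algebra)
  interpret G: bilinear_algebra "G_alg q" by (rule G_bilinear_algebra)
  interpret Gt: bilinear_algebra "G_tilde q \<rho>" by (rule G_tilde_bilinear_algebra)
  obtain \<psi> where \<psi>: "alg_hom (G_alg q) EA \<psi>" "\<And>g. \<psi> (G_gen q g) = E_proj (simple_value g)"
    using G_universal[OF E_lie_algebra simple_values_relations] by blast
  note h = alg_homD[OF \<psi>(1)]
  have \<psi>0: "\<psi> \<zero>\<^bsub>G_alg q\<^esub> = \<zero>\<^bsub>EA\<^esub>"
    by (rule linear_map_zero[OF G.complex_module_axioms E.complex_module_axioms h(5)])
  have d: "E_proj (dual_elt \<xi>) \<in> carrier EA" if "\<xi> \<in> radC_dual q" for \<xi>
    using that by (intro E_proj_rules(1)) simp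
  have Egr: "submodule (E_grading q B \<rho> \<alpha>) complex_ring EA" for \<alpha> by (rule E_grading_submodule)
  note Egr' = Egr[unfolded E.submodule_iff]
  have mono: "\<psi> (G_monomial q t) \<in> E_grading q B \<rho> (monomial_degree t)" for t
  proof (induction t)
    case (Gen g)
    show ?case using simple_value_grading[of g] by (auto simp: \<psi>(2) E_grading_eq)
  next
    case (Br s t)
    then show ?case by (simp add: h E_grading_bracket)
  qed
  have \<psi>_grading: "\<psi> x \<in> E_grading q B \<rho> \<alpha>" if "x \<in> G_grading q \<alpha>" for x \<alpha>
  proof -
    have "G_grading q \<alpha> \<subseteq> {x \<in> carrier (G_alg q). \<psi> x \<in> E_grading q B \<rho> \<alpha>}"
    proof (rule G_grading_least)
      show "submodule {x \<in> carrier (G_alg q). \<psi> x \<in> E_grading q B \<rho> \<alpha>} complex_ring (G_alg q)"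
        using Egr'[of \<alpha>] by (auto simp: G.submodule_iff h \<psi>0)
    qed (use mono in auto)
    then show ?thesis using that by blast
  qed
  have \<psi>_dual: "\<psi> (dual_action q \<rho> \<xi> x) = E_proj (dual_elt \<xi>) \<otimes>\<^bsub>EA\<^esub> \<psi> x"
    if \<xi>: "\<xi> \<in> radC_dual q" and x: "x \<in> carrier (G_alg q)" for \<xi> x
  proof -
    let ?V = "{x \<in> carrier (G_alg q). \<psi> (dual_action q \<rho> \<xi> x) = E_proj (dual_elt \<xi>) \<otimes>\<^bsub>EA\<^esub> \<psi> x}"
    have "carrier (G_alg q) \<subseteq> ?V"
    proof (rule G_spanned_by_monomials)
      have z: "dual_action q \<rho> \<xi> \<zero>\<^bsub>G_alg q\<^esub> = \<zero>\<^bsub>G_alg q\<^esub>"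
        using dual_action_rules(3)[of "\<zero>\<^bsub>G_alg q\<^esub>" q "\<zero>\<^bsub>G_alg q\<^esub>" \<rho> \<xi> 0]
          dual_action_rules(1)[of "\<zero>\<^bsub>G_alg q\<^esub>" q "\<zero>\<^bsub>G_alg q\<^esub>" \<rho> \<xi>] by simp
      show "submodule ?V complex_ring (G_alg q)"
        unfolding G.submodule_iff
        by (auto simp: z \<psi>0 d[OF \<xi>] h dual_action_rules E.prod_add_right E.prod_smult_right)
      fix t
      have m: "\<psi> (G_monomial q t) \<in> E_grading q B \<rho> (monomial_degree t)" by (rule mono)
      have "E_proj (dual_elt \<xi>) \<otimes>\<^bsub>EA\<^esub> \<psi> (G_monomial q t) =
          \<xi> (\<rho> (cvec (monomial_degree t))) \<odot>\<^bsub>EA\<^esub> \<psi> (G_monomial q t)"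
        using cartan_operator_eigen[of "(0, \<xi>)", OF _ m] \<xi>
        by (simp add: cartan_operator_def cartan_weight_def dual_weight_def polarC_rules pi_elt_rules)
      then show "G_monomial q t \<in> ?V"
        by (simp add: dual_action_homogeneous[OF G_monomial_grading] h)
    qed
    then show ?thesis using x by blast
  qed
  define \<phi> where "\<phi> p = \<psi> (fst p) \<oplus>\<^bsub>EA\<^esub> E_proj (dual_elt (snd p))" for p
  have hom: "alg_hom (G_tilde q \<rho>) EA \<phi>"
    unfolding alg_hom_def linear_map_def
  proof (intro conjI ballI allI)
    fix p p' assume "p \<in> carrier (G_tilde q \<rho>)" "p' \<in> carrier (G_tilde q \<rho>)"
    then obtain x \<xi> y \<zeta> where p: "p = (x, \<xi>)" "p' = (y, \<zeta>)" "x \<in> carrier (G_alg q)" "\<xi> \<in> radC_dual q"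
      "y \<in> carrier (G_alg q)" "\<zeta> \<in> radC_dual q" by auto
    show "\<phi> p \<in> carrier EA" using p by (simp add: \<phi>_def h d)
    have "E_proj (dual_elt (\<xi> + \<zeta>)) = E_proj (dual_elt \<xi>) \<oplus>\<^bsub>EA\<^esub> E_proj (dual_elt \<zeta>)"
      using p by (simp add: dual_elt_rules(1) E_proj_rules(2))
    then show "\<phi> (p \<oplus>\<^bsub>G_tilde q \<rho>\<^esub> p') = \<phi> p \<oplus>\<^bsub>EA\<^esub> \<phi> p'"
      using p by (simp add: \<phi>_def h d E.M.a_ac)
    have "E_proj (dual_elt (\<lambda>v. r * \<xi> v)) = r \<odot>\<^bsub>EA\<^esub> E_proj (dual_elt \<xi>)" for r
      using p by (simp add: dual_elt_rules(2)[symmetric] E_proj_rules(3) del: scale_elt_simp)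
    then show "\<phi> (r \<odot>\<^bsub>G_tilde q \<rho>\<^esub> p) = r \<odot>\<^bsub>EA\<^esub> \<phi> p" for r
      using p by (simp add: \<phi>_def h d E.csmult_rules)
    have dd: "E_proj (dual_elt \<xi>) \<otimes>\<^bsub>EA\<^esub> E_proj (dual_elt \<zeta>) = \<zero>\<^bsub>EA\<^esub>"
      using p by (simp add: E_proj_rules(4)[symmetric] bracket_generators(9) E_proj_rules(5))
    have anti: "\<psi> x \<otimes>\<^bsub>EA\<^esub> E_proj (dual_elt \<zeta>) = \<ominus>\<^bsub>EA\<^esub> (E_proj (dual_elt \<zeta>) \<otimes>\<^bsub>EA\<^esub> \<psi> x)"
      using p by (intro EL.bracket_antisymmetric) (simp_all add: h d)
    have "\<phi> (p \<otimes>\<^bsub>G_tilde q \<rho>\<^esub> p') =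
        \<psi> x \<otimes>\<^bsub>EA\<^esub> \<psi> y \<oplus>\<^bsub>EA\<^esub> E_proj (dual_elt \<xi>) \<otimes>\<^bsub>EA\<^esub> \<psi> y \<ominus>\<^bsub>EA\<^esub> E_proj (dual_elt \<zeta>) \<otimes>\<^bsub>EA\<^esub> \<psi> x"
      using p by (simp add: \<phi>_def E_proj_rules(5) h \<psi>_dual dual_action_rules(1)
          linear_map_minus[OF G.complex_module_axioms E.complex_module_axioms h(5)] d G.M.minus_closed E.M.minus_closed)
    also have "\<dots> = \<phi> p \<otimes>\<^bsub>EA\<^esub> \<phi> p'"
      using p by (simp add: \<phi>_def E.prod_add_left E.prod_add_right h d dd anti E.M.minus_eq E.M.a_ac)
    finally show "\<phi> (p \<otimes>\<^bsub>G_tilde q \<rho>\<^esub> p') = \<phi> p \<otimes>\<^bsub>EA\<^esub> \<phi> p'" .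
  qed
  note H = alg_homD[OF hom]
  have cartan: "\<psi> (cartan_elt q a) = E_proj (pi_elt 0 a)" for a
  proof (induction a rule: vector_expansion_induct)
    case (4 i)
    have "axis i 1 = cvec (basis_vec i)" by (simp add: cvec_def vec_eq_iff axis_def)
    then show ?case unfolding cartan_elt_axis \<psi>(2) by (simp add: simple_value_def)
  next
    case (3 r v)
    then show ?case
      by (simp add: cartan_elt_linear h pi_elt_rules(2)[symmetric] E_proj_rules(3) q_rules(4) del: scale_elt_simp)
  qed (simp_all add: cartan_elt_linear h \<psi>0 pi_elt_rules E_proj_rules q_rules(4))
  have Hval: "\<phi> (cartan_elt q a, \<xi>) = E_proj (pi_elt 0 a + dual_elt \<xi>)" if "\<xi> \<in> radC_dual q" for a \<xi>
    using that by (simp add: \<phi>_def cartan E_proj_rules(2) q_rules(4))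
  have gen_value: "\<phi> (G_gen q g, 0) = E_proj (simple_value g)" for g
    using E_proj_rules(1)[OF simple_value_carrier] by (simp add: \<phi>_def \<psi>(2) E_proj_rules(5))
  let ?T = "{x \<in> carrier RA. E_proj x \<in> \<phi> ` carrier (G_tilde q \<rho>)}"
  have "carrier RA \<subseteq> ?T"
  proof (rule generated_by_simple_root_vectors)
    have "\<zero>\<^bsub>EA\<^esub> = \<phi> \<zero>\<^bsub>G_tilde q \<rho>\<^esub>"
      by (rule linear_map_zero[OF Gt.complex_module_axioms E.complex_module_axioms H(5), symmetric])
    moreover have "x \<in> carrier RA" if "x \<in> E_null" for x
      using bilinear_algebra.alg_idealD(7)[OF RA_bilinear_algebra E_null_ideal that] .
    ultimately show "E_null \<subseteq> ?T" using E_proj_eq_zero_iff by (metis (mono_tags, lifting) Gt.M.zero_closed imageI mem_Collect_eq subsetI)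
  next
    fix x y assume xy: "x \<in> ?T" "y \<in> ?T"
    then obtain p p' where p: "p \<in> carrier (G_tilde q \<rho>)" "p' \<in> carrier (G_tilde q \<rho>)"
      "E_proj x = \<phi> p" "E_proj y = \<phi> p'" by blast
    have c: "x \<in> carrier RA" "y \<in> carrier RA" using xy by simp_all
    have "E_proj (x + y) = \<phi> (p \<oplus>\<^bsub>G_tilde q \<rho>\<^esub> p')" "E_proj \<lbrakk>x, y\<rbrakk> = \<phi> (p \<otimes>\<^bsub>G_tilde q \<rho>\<^esub> p')"
      unfolding E_proj_rules(2,4)[OF c] H(2,4)[OF p(1,2)] p(3,4) by (rule refl)+
    then show "x + y \<in> ?T" "\<lbrakk>x, y\<rbrakk> \<in> ?T"
      using c bracket_closed[OF c] Gt.M.a_closed[OF p(1,2)] Gt.prod_closed[OF p(1,2)] RA_closed(2)[OF c] by blast+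
  next
    fix r x assume x: "x \<in> ?T"
    then obtain p where p: "p \<in> carrier (G_tilde q \<rho>)" "E_proj x = \<phi> p" by blast
    have c: "x \<in> carrier RA" using x by simp
    have "E_proj (scale_elt r x) = \<phi> (r \<odot>\<^bsub>G_tilde q \<rho>\<^esub> p)"
      unfolding E_proj_rules(3)[OF c] H(3)[OF p(1)] p(2) by (rule refl)
    then show "scale_elt r x \<in> ?T"
      using RA_closed(3)[OF c] Gt.csmult_closed[OF p(1)] by blast
  next
    fix i
    have "(G_gen q g, 0) \<in> carrier (G_tilde q \<rho>)" for g by (simp add: radC_dual_closed)
    then have g: "simple_value g \<in> ?T" for g using gen_value simple_value_carrier by (metis (mono_tags, lifting) imageI mem_Collect_eq)
    show "e_elt (basis_vec i) \<in> ?T" using g[of "Fplus i"] by (simp add: simple_value_def)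
    have m: "(G_gen q (Fminus i), 0) \<in> carrier (G_tilde q \<rho>)" by (simp add: radC_dual_closed)
    have c: "e_elt (- basis_vec i) \<in> carrier RA" by (simp add: q_rules(3) q_basis)
    have "E_proj (e_elt (- basis_vec i)) = E_proj (scale_elt (-1) (simple_value (Fminus i)))"
      by (simp add: simple_value_def scale_elt_rules(3,4) del: scale_elt_simp)
    also have "\<dots> = \<phi> ((-1) \<odot>\<^bsub>G_tilde q \<rho>\<^esub> (G_gen q (Fminus i), 0))"
      unfolding E_proj_rules(3)[OF simple_value_carrier] H(3)[OF m] gen_value by (rule refl)
    finally show "e_elt (- basis_vec i) \<in> ?T" using c Gt.csmult_closed[OF m] by blast
  next
    fix v
    have m: "(cartan_elt q v, 0) \<in> carrier (G_tilde q \<rho>)" by (simp add: radC_dual_closed)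
    have "E_proj (pi_elt 0 v) = \<phi> (cartan_elt q v, 0)" using Hval[OF radC_dual_closed(1)] by simp
    moreover have "pi_elt 0 v \<in> carrier RA" by (simp add: q_rules(4))
    ultimately show "pi_elt 0 v \<in> ?T" using m by blast
  next
    fix \<xi> assume \<xi>: "\<xi> \<in> radC_dual q"
    have m: "(\<zero>\<^bsub>G_alg q\<^esub>, \<xi>) \<in> carrier (G_tilde q \<rho>)" using \<xi> by simp
    have "E_proj (dual_elt \<xi>) = \<phi> (\<zero>\<^bsub>G_alg q\<^esub>, \<xi>)" by (simp add: \<phi>_def \<psi>0 d[OF \<xi>])
    then show "dual_elt \<xi> \<in> ?T" using m RA_generators_closed(3)[OF \<xi>] by blast
  qed
  then have "carrier EA \<subseteq> \<phi> ` carrier (G_tilde q \<rho>)" unfolding E_carrier by blast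
  then have surj: "\<phi> ` carrier (G_tilde q \<rho>) = carrier EA" using H(1) by blast
  have "\<phi> ` G_tilde_grading q \<alpha> = E_grading q B \<rho> \<alpha>" for \<alpha>
  proof (intro equalityI subsetI)
    fix y assume "y \<in> \<phi> ` G_tilde_grading q \<alpha>"
    then obtain x \<xi> where x: "x \<in> G_grading q \<alpha>" "\<xi> \<in> (if \<alpha> = 0 then radC_dual q else {0})" "y = \<phi> (x, \<xi>)"
      by (auto simp: G_tilde_grading_def)
    have "E_proj (dual_elt \<xi>) \<in> E_grading q B \<rho> \<alpha>"
    proof (cases "\<alpha> = 0")
      case True
      then show ?thesis using x(2) root_grading_generators(3)[of \<xi>] by (auto simp: E_grading_eq)
    next
      case False
      then show ?thesis using x(2) Egr'[of \<alpha>] by (simp add: E_proj_rules(5))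
    qed
    then show "y \<in> E_grading q B \<rho> \<alpha>" using Egr'[of \<alpha>] \<psi>_grading[OF x(1)] by (simp add: x(3) \<phi>_def)
  next
    fix y assume y: "y \<in> E_grading q B \<rho> \<alpha>"
    then have yc: "y \<in> carrier EA" by (rule E_grading_carrier)
    then have "y \<in> \<phi> ` (carrier (G_alg q) \<times> radC_dual q)" using surj by simp
    then obtain x \<xi> where x: "x \<in> carrier (G_alg q)" "\<xi> \<in> radC_dual q" "y = \<phi> (x, \<xi>)" by blast
    interpret Gg: graded_module "G_alg q" "G_grading q" by (rule G_graded_module)
    obtain f where f: "homogeneous_decomposition (G_alg q) (G_grading q) x f"
      using Gg.decomposition[OF x(1)] by blast
    let ?A = "{\<beta>. f \<beta> \<noteq> \<zero>\<^bsub>G_alg q\<^esub>}"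
    have fA: "finite ?A" "x = (\<Oplus>\<^bsub>G_alg q\<^esub>\<beta>\<in>?A. f \<beta>)" "\<And>\<beta>. f \<beta> \<in> G_grading q \<beta>"
      using f by (auto simp: homogeneous_decomposition_def)
    have fc: "f \<beta> \<in> carrier (G_alg q)" for \<beta> using fA(3) Gg.graded_piece_carrier by blast
    have sub: "\<forall>\<beta>. submodule (E_grading q B \<rho> \<beta>) complex_ring EA" by (simp add: Egr)
    have hx: "homogeneous_decomposition EA (E_grading q B \<rho>) (\<psi> x) (\<lambda>\<beta>. \<psi> (f \<beta>))"
    proof (rule homogeneous_decompositionI[OF E.complex_module_axioms _ _ fA(1)])
      show "\<forall>\<beta>. E_grading q B \<rho> \<beta> \<subseteq> carrier EA" using E_grading_carrier by blast
      show "\<forall>\<beta>. \<psi> (f \<beta>) \<in> E_grading q B \<rho> \<beta>" using \<psi>_grading fA(3) by blast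
      show "{\<beta>. \<psi> (f \<beta>) \<noteq> \<zero>\<^bsub>EA\<^esub>} \<subseteq> ?A" using \<psi>0 by auto
      have "\<psi> (\<Oplus>\<^bsub>G_alg q\<^esub>\<beta>\<in>?A. f \<beta>) = (\<Oplus>\<^bsub>EA\<^esub>\<beta>\<in>?A. \<psi> (f \<beta>))"
        using fc by (intro linear_map_finsum[OF G.complex_module_axioms E.complex_module_axioms h(5) fA(1)]) blast
      then show "\<psi> x = (\<Oplus>\<^bsub>EA\<^esub>\<beta>\<in>?A. \<psi> (f \<beta>))" using fA(2) by simp
    qed
    have "E_proj (dual_elt \<xi>) \<in> E_grading q B \<rho> 0"
      using root_grading_generators(3)[OF x(2)] by (auto simp: E_grading_eq)
    from homogeneous_decomposition_add[OF E.complex_module_axioms sub hx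
        homogeneous_decomposition_homogeneous[OF E.complex_module_axioms sub this]]
    have "homogeneous_decomposition EA (E_grading q B \<rho>) y
        (\<lambda>\<beta>. \<psi> (f \<beta>) \<oplus>\<^bsub>EA\<^esub> (if \<beta> = 0 then E_proj (dual_elt \<xi>) else \<zero>\<^bsub>EA\<^esub>))"
      by (simp add: x(3) \<phi>_def)
    moreover have "homogeneous_decomposition EA (E_grading q B \<rho>) y (\<lambda>\<beta>. if \<beta> = \<alpha> then y else \<zero>\<^bsub>EA\<^esub>)"
      by (rule homogeneous_decomposition_homogeneous[OF E.complex_module_axioms sub y])
    ultimately have "(\<lambda>\<beta>. if \<beta> = \<alpha> then y else \<zero>\<^bsub>EA\<^esub>) =
        (\<lambda>\<beta>. \<psi> (f \<beta>) \<oplus>\<^bsub>EA\<^esub> (if \<beta> = 0 then E_proj (dual_elt \<xi>) else \<zero>\<^bsub>EA\<^esub>))"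
      using E_decomposition[OF yc] by blast
    from fun_cong[OF this, of \<alpha>]
    have "y = \<phi> (f \<alpha>, if \<alpha> = 0 then \<xi> else 0)" by (simp add: \<phi>_def E_proj_rules(5))
    moreover have "(f \<alpha>, if \<alpha> = 0 then \<xi> else 0) \<in> G_tilde_grading q \<alpha>"
      using fA(3) x(2) by (simp add: G_tilde_grading_def)
    ultimately show "y \<in> \<phi> ` G_tilde_grading q \<alpha>" by blast
  qed
  with that hom surj Hval show ?thesis by blast
qed

text \<open>The comparison map is an isomorphism from the Cartan subalgebra \<open>H_tilde\<close> onto the degree-zero part of
  \<open>E\<close>. So its kernel \<open>K\<close> avoids \<open>H_tilde\<close>, and an ideal \<open>J \<supseteq> K\<close> that avoids \<open>H_tilde\<close> has an image that avoids the
  degree-zero part. That image is zero, hence \<open>J = K\<close>.\<close>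

lemma kernel_is_maximal_and_quotient_is_E:
  "\<exists>K. maximal_ideal_avoiding (G_tilde q \<rho>) (H_tilde q) K \<and>
    isomorphic_graded_lie_algebras (alg_quotient (G_tilde q \<rho>) K)
      (quotient_grading (G_tilde q \<rho>) (G_tilde_grading q) K) EA (E_grading q B \<rho>)"
proof -
  interpret E: bilinear_algebra EA by (rule E_bilinear_algebra)
  interpret Gt: bilinear_algebra "G_tilde q \<rho>" by (rule G_tilde_bilinear_algebra)
  obtain \<phi> where \<phi>: "alg_hom (G_tilde q \<rho>) EA \<phi>" "\<phi> ` carrier (G_tilde q \<rho>) = carrier EA"
    "\<And>\<alpha>. \<phi> ` G_tilde_grading q \<alpha> = E_grading q B \<rho> \<alpha>"
    "\<And>a \<xi>. \<xi> \<in> radC_dual q \<Longrightarrow> \<phi> (cartan_elt q a, \<xi>) = E_proj (pi_elt 0 a + dual_elt \<xi>)"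
    by (rule comparison_homomorphism) blast
  note H = alg_homD[OF \<phi>(1)]
  define K where "K = {x \<in> carrier (G_tilde q \<rho>). \<phi> x = \<zero>\<^bsub>EA\<^esub>}"
  have K: "alg_ideal (G_tilde q \<rho>) K"
    unfolding K_def by (rule kernel_alg_ideal[OF Gt.bilinear_algebra_axioms E.bilinear_algebra_axioms \<phi>(1)])
  have \<phi>0: "\<phi> \<zero>\<^bsub>G_tilde q \<rho>\<^esub> = \<zero>\<^bsub>EA\<^esub>"
    by (rule linear_map_zero[OF Gt.complex_module_axioms E.complex_module_axioms H(5)])
  have Ht: "H_tilde q = {(cartan_elt q a, \<xi>) | a \<xi>. \<xi> \<in> radC_dual q}"
    by (auto simp: H_tilde_def G_H_eq)
  have zero_H: "\<zero>\<^bsub>G_tilde q \<rho>\<^esub> \<in> H_tilde q"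
    using cartan_elt_linear(3)[of q] radC_dual_closed(1)[of q] unfolding Ht by (metis (mono_tags, lifting) G_tilde_simps(2) mem_Collect_eq)
  have "x = \<zero>\<^bsub>G_tilde q \<rho>\<^esub>" if xK: "x \<in> K" and xH: "x \<in> H_tilde q" for x
  proof -
    obtain a \<xi> where x: "x = (cartan_elt q a, \<xi>)" "\<xi> \<in> radC_dual q" using xH Ht by blast
    then have "E_proj (pi_elt 0 a + dual_elt \<xi>) = \<zero>\<^bsub>EA\<^esub>" using xK \<phi>(4)[of \<xi> a] by (simp add: K_def)
    then have "pi_elt 0 a + dual_elt \<xi> \<in> E_null"
      using E_proj_eq_zero_iff[OF cartan_element_carrier[OF x(2)]] by simp
    then have "a = 0" "\<xi> = 0" using pi_dual_in_E_null by blast+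
    then show ?thesis by (simp add: x(1) cartan_elt_linear)
  qed
  then have KH: "K \<inter> H_tilde q = {\<zero>\<^bsub>G_tilde q \<rho>\<^esub>}"
    using zero_H Gt.alg_idealD(2)[OF K] by blast
  have max: "J = K" if J: "alg_ideal (G_tilde q \<rho>) J" "J \<inter> H_tilde q = {\<zero>\<^bsub>G_tilde q \<rho>\<^esub>}" "K \<subseteq> J" for J
  proof -
    note Jd = Gt.alg_idealD[OF J(1)]
    have im: "alg_ideal EA (\<phi> ` J)"
      by (rule image_alg_ideal[OF Gt.bilinear_algebra_axioms E.bilinear_algebra_axioms \<phi>(1,2) J(1)])
    have "y = \<zero>\<^bsub>EA\<^esub>" if y: "y \<in> \<phi> ` J" "y \<in> E_grading q B \<rho> 0" for y
    proof -
      obtain j where j: "j \<in> J" "y = \<phi> j" using y(1) by blast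
      obtain z where z: "z \<in> root_grading q 0" "y = E_proj z" using y(2) by (auto simp: E_grading_eq)
      obtain s v \<zeta> where z': "z = scale_elt s (e_elt 0) + pi_elt 0 v + dual_elt \<zeta>" "q 0 = 1 \<or> s = 0"
        "\<zeta> \<in> radC_dual q" by (rule root_grading_elim[OF z(1)]) blast
      then have zv: "z = pi_elt 0 v + dual_elt \<zeta>" by (simp add: q_rules(4) scale_elt_rules del: scale_elt_simp)
      let ?h = "(cartan_elt q v, \<zeta>)"
      have hc: "?h \<in> carrier (G_tilde q \<rho>)" using z'(3) by simp
      have "\<phi> (j \<ominus>\<^bsub>G_tilde q \<rho>\<^esub> ?h) = \<phi> j \<ominus>\<^bsub>EA\<^esub> \<phi> ?h"
        by (rule linear_map_minus[OF Gt.complex_module_axioms E.complex_module_axioms H(5) Jd(7)[OF j(1)] hc])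
      also have "\<dots> = \<zero>\<^bsub>EA\<^esub>"
        using \<phi>(4)[OF z'(3), of v] j z zv H(1)[OF hc] by simp
      finally have "j \<ominus>\<^bsub>G_tilde q \<rho>\<^esub> ?h \<in> K" using Jd(7)[OF j(1)] hc by (simp add: K_def Gt.M.minus_closed del: G_tilde_simps)
      then have "j \<oplus>\<^bsub>G_tilde q \<rho>\<^esub> (-1) \<odot>\<^bsub>G_tilde q \<rho>\<^esub> (j \<ominus>\<^bsub>G_tilde q \<rho>\<^esub> ?h) \<in> J"
        using J(3) Jd(3,4) j(1) by blast
      moreover have "j \<oplus>\<^bsub>G_tilde q \<rho>\<^esub> (-1) \<odot>\<^bsub>G_tilde q \<rho>\<^esub> (j \<ominus>\<^bsub>G_tilde q \<rho>\<^esub> ?h) = ?h"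
        using Jd(7)[OF j(1)] hc Gt.csmult_neg(1)
        by (simp add: Gt.diff_eq_smult Gt.csmult_rules Gt.M.a_assoc[symmetric] del: G_tilde_simps)
      ultimately have "?h \<in> J \<inter> H_tilde q" using z'(3) Ht by auto
      then have "?h = \<zero>\<^bsub>G_tilde q \<rho>\<^esub>" using J(2) by blast
      then show ?thesis using \<phi>(4)[OF z'(3), of v] z zv \<phi>0 by simp
    qed
    moreover have "\<zero>\<^bsub>EA\<^esub> \<in> \<phi> ` J \<inter> E_grading q B \<rho> 0"
      using \<phi>0 Jd(2) E_grading_submodule[of 0] by (auto simp: E.submodule_iff image_iff intro!: bexI[of _ "\<zero>\<^bsub>G_tilde q \<rho>\<^esub>"] simp del: G_tilde_simps)
    ultimately have "\<phi> ` J = {\<zero>\<^bsub>EA\<^esub>}"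
      by (intro E_ideal_avoiding_degree_zero[OF im]) blast
    then have "J \<subseteq> K" unfolding K_def using Jd(1) by blast
    with J(3) show "J = K" by blast
  qed
  have maximal: "maximal_ideal_avoiding (G_tilde q \<rho>) (H_tilde q) K"
    unfolding maximal_ideal_avoiding_def using K KH max by blast
  obtain g where g: "alg_hom (alg_quotient (G_tilde q \<rho>) K) EA g"
    "\<forall>x\<in>carrier (G_tilde q \<rho>). g (K +>\<^bsub>G_tilde q \<rho>\<^esub> x) = \<phi> x"
    "bij_betw g (carrier (alg_quotient (G_tilde q \<rho>) K)) (carrier EA)"
    by (rule first_isomorphism_theorem[OF Gt.bilinear_algebra_axioms E.bilinear_algebra_axioms \<phi>(1,2) K_def]) blast
  let ?Q = "quotient_grading (G_tilde q \<rho>) (G_tilde_grading q) K"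
  have gr: "G_tilde_grading q \<alpha> \<subseteq> carrier (G_tilde q \<rho>)" for \<alpha>
    using graded_module.graded_piece_carrier[OF G_graded_module] radC_dual_closed(1)[of q]
    by (fastforce simp: G_tilde_grading_def split: if_splits)
  have Qc: "\<forall>\<alpha>. ?Q \<alpha> \<subseteq> carrier (alg_quotient (G_tilde q \<rho>) K)"
    using gr by (auto simp: quotient_grading_def Gt.quotient_carrier)
  have "g ` ?Q \<alpha> = \<phi> ` G_tilde_grading q \<alpha>" for \<alpha>
    unfolding quotient_grading_def image_image using gr[of \<alpha>] g(2) by (intro image_cong refl) blast
  then have Qim: "\<forall>\<alpha>. g ` ?Q \<alpha> = E_grading q B \<rho> \<alpha>" by (simp add: \<phi>(3))
  have "graded_lie_algebra (alg_quotient (G_tilde q \<rho>) K) ?Q"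
    by (rule graded_lie_algebra_transport[OF Gt.quotient_bilinear_algebra[OF K] g(1,3) E_graded_lie_algebra Qc Qim])
  moreover have "g \<in> graded_lie_iso (alg_quotient (G_tilde q \<rho>) K) ?Q EA (E_grading q B \<rho>)"
    unfolding graded_lie_iso_def using g(3) alg_homD(2,3,4)[OF g(1)] Qim by blast
  ultimately show ?thesis
    using maximal E_graded_lie_algebra unfolding isomorphic_graded_lie_algebras_def by blast
qed

end

theorem theorem1p2:
  fixes c :: "'n::{finite,linorder} \<Rightarrow> 'n \<Rightarrow> int"
    and q :: "int ^ 'n::{finite,linorder} \<Rightarrow> int"
    and \<rho> :: "complex ^ 'n::{finite,linorder} \<Rightarrow> complex ^ 'n::{finite,linorder}"
    and B :: "int ^ 'n::{finite,linorder} \<Rightarrow> int ^ 'n::{finite,linorder} \<Rightarrow> int"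
  assumes unit: "q = unit_form c"
    and connected: "connected_coeffs c"
    and nonneg: "nonneg_form q"
    and projection: "radC_projection q \<rho>"
    and bilinear: "admissible_bilinear q B"
  shows "(\<forall>I. unique_maximal_ideal_avoiding (G_tilde q \<rho>) (H_tilde q) I \<longrightarrow>
        isomorphic_graded_lie_algebras
          (alg_quotient (G_tilde q \<rho>) I) (quotient_grading (G_tilde q \<rho>) (G_tilde_grading q) I)
          (E_alg q B \<rho>) (E_grading q B \<rho>)) \<and>
    (\<exists>I. maximal_ideal_avoiding (G_tilde q \<rho>) (H_tilde q) I \<and>
        isomorphic_graded_lie_algebras
          (alg_quotient (G_tilde q \<rho>) I) (quotient_grading (G_tilde q \<rho>) (G_tilde_grading q) I)
          (E_alg q B \<rho>) (E_grading q B \<rho>))"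
proof -
  interpret nonneg_unit_form c q \<rho> B
    by (rule nonneg_unit_form.intro[OF assms])
  obtain K where K: "maximal_ideal_avoiding (G_tilde q \<rho>) (H_tilde q) K"
    "isomorphic_graded_lie_algebras (alg_quotient (G_tilde q \<rho>) K)
      (quotient_grading (G_tilde q \<rho>) (G_tilde_grading q) K) EA (E_grading q B \<rho>)"
    using kernel_is_maximal_and_quotient_is_E by blast
  have "I = K" if "unique_maximal_ideal_avoiding (G_tilde q \<rho>) (H_tilde q) I" for I
    using that K(1) by (simp add: unique_maximal_ideal_avoiding_def)
  with K show ?thesis by blast
qed

end
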